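(* There is a catalytic logspace algorithm that, given $\ell,q,T\in\mathbb{N}$, oracle access to a directed graph $G=(V,E)$ with $n$ vertices and $m$ edges, vertices $s,t$, and $\ell$-bit registers $R_{i,u}$ on the catalytic tape for $i\in\{0,\dots,T\}$ and $u\in V$ that are all valid for modulus $q$, returns \[(\text{number of $s\to t$ paths of length $T$ in $G$}) \bmod q.\] Moreover, the algorithm runs in time $\widetilde{O}(\ell^2\cdot T\cdot(m+n))$, and is locally revertible in time $\widetilde{O}(\ell\cdot d_{\max})$, where $d_{\max}$ is the maximum in-degree of $G$.
   Context: A path of length $T$ is a sequence of $T$ consecutive edges (vertices may repeat). Registers: for $q,\ell\in\mathbb{N}$, let $d$ be the largest integer with $qd\le 2^\ell$; an $\ell$-bit register (interpreted as an integer in $\{0,\dots,2^\ell-1\}$) is valid for modulus $q$ if its initial value is less than $qd$. Catalytic model: read-only input, $O(\log)$-size read-write work tape, a read-write catalytic tape (here containing the registers) starting in an arbitrary configuration $\tau$ that must be restored exactly to $\tau$ at halting, with constant-time random access to catalytic bits. A catalytic algorithm is locally revertible in time $t$ if at any point during its execution with initial catalytic tape $\tau$ it can be paused and queried on an index $i$, returns $\tau_i$ in time $t$, and then continues its execution. Oracle access to $G$: vertex set $[n]$, with in-degree, out-degree, $i$-th in-neighbor and $i$-th out-neighbor queries. $\widetilde{O}(\cdot)$ hides polylogarithmic factors. *)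

theory Defs
  imports Complex_Main "HOL-Library.Log_Nat" "Graph_Theory.Pair_Digraph"
begin

section \<open>Inputs\<close>

text \<open>
  The vertex set \<open>[n]\<close> is rendered as \<open>{..<n}\<close>. The lists \<open>in_nbrs v\<close> and \<open>out_nbrs v\<close> fix the
  (arbitrary) order in which the oracle enumerates neighbours. Self-loops are allowed.
\<close>

record problem =
  reg_bits :: nat
  modulus :: nat
  path_len :: nat
  digr :: "nat pair_pre_digraph"
  in_nbrs :: "nat \<Rightarrow> nat list"
  out_nbrs :: "nat \<Rightarrow> nat list"
  src :: nat
  dst :: nat

definition num_verts :: "problem \<Rightarrow> nat" where
  "num_verts I = card (pverts (digr I))"

definition num_arcs :: "problem \<Rightarrow> nat" where
  "num_arcs I = card (parcs (digr I))"

definition max_in_degree :: "problem \<Rightarrow> nat" where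
  "max_in_degree I = Max (in_degree (with_proj (digr I)) ` pverts (digr I))"

definition well_formed :: "problem \<Rightarrow> bool" where
  "well_formed I \<longleftrightarrow>
     modulus I > 0 \<and>
     pair_fin_digraph (digr I) \<and> pverts (digr I) = {..<num_verts I} \<and>
     src I \<in> pverts (digr I) \<and> dst I \<in> pverts (digr I) \<and>
     (\<forall>v \<in> pverts (digr I).
        distinct (in_nbrs I v) \<and> set (in_nbrs I v) = {u. (u, v) \<in> parcs (digr I)} \<and>
        distinct (out_nbrs I v) \<and> set (out_nbrs I v) = {w. (v, w) \<in> parcs (digr I)})"

definition num_paths :: "problem \<Rightarrow> nat" where
  "num_paths I = card {p. pre_digraph.awalk (with_proj (digr I)) (src I) p (dst I) \<and> length p = path_len I}"


section \<open>Registers on the catalytic tape\<close>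

text \<open>
  The catalytic tape is the concatenation of the registers \<open>R\<^bsub>i,u\<^esub>\<close> in lexicographic order
  of \<open>(i, u)\<close>, each stored with the least significant bit first.
\<close>

definition tape_size :: "problem \<Rightarrow> nat" where
  "tape_size I = (path_len I + 1) * num_verts I * reg_bits I"

definition register :: "problem \<Rightarrow> bool list \<Rightarrow> nat \<Rightarrow> nat \<Rightarrow> nat" where
  "register I \<tau> i u =
     horner_sum of_bool 2 (take (reg_bits I) (drop ((i * num_verts I + u) * reg_bits I) \<tau>))"

definition valid_for :: "nat \<Rightarrow> nat \<Rightarrow> nat \<Rightarrow> bool" where
  "valid_for l q r \<longleftrightarrow> r < q * (GREATEST d. q * d \<le> 2 ^ l)"

definition all_registers_valid :: "problem \<Rightarrow> bool list \<Rightarrow> bool" where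
  "all_registers_valid I \<tau> \<longleftrightarrow>
     (\<forall>i \<le> path_len I. \<forall>u \<in> pverts (digr I).
        valid_for (reg_bits I) (modulus I) (register I \<tau> i u))"


section \<open>Machine model\<close>

text \<open>
  An algorithm is a fixed finite random-access program, the same for all inputs. Its work tape
  is organised as finitely many number-valued cells (only those mentioned by the program can ever
  change); the work space is the total bit length of their contents. Every instruction takes unit
  time and accesses the read-only input, the oracle, or the catalytic tape at most once; access to
  the catalytic tape is by bit address. On cells of \<open>O(log)\<close> bits the arithmetic instructions cost
  only polylogarithmically many bit operations.
\<close>

datatype parameter = Reg_Bits | Modulus | Path_Len | Num_Verts | Src | Dst

datatype arith_op = Add | Sub | Mul | Div | Mod

datatype instr =
    Const nat nat
  | Arith arith_op nat nat nat
  | Param nat parameter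
  | In_Deg nat nat
  | Out_Deg nat nat
  | In_Nbr nat nat nat
  | Out_Nbr nat nat nat
  | Cat_Read nat nat
  | Cat_Write nat nat
  | Jump nat
  | Jump_Less nat nat nat
  | Halt nat

type_synonym program = "instr list"

fun param_value :: "problem \<Rightarrow> parameter \<Rightarrow> nat" where
  "param_value I Reg_Bits = reg_bits I"
| "param_value I Modulus = modulus I"
| "param_value I Path_Len = path_len I"
| "param_value I Num_Verts = num_verts I"
| "param_value I Src = src I"
| "param_value I Dst = dst I"

fun arith_value :: "arith_op \<Rightarrow> nat \<Rightarrow> nat \<Rightarrow> nat" where
  "arith_value Add a b = a + b"
| "arith_value Sub a b = a - b"
| "arith_value Mul a b = a * b"
| "arith_value Div a b = a div b"
| "arith_value Mod a b = a mod b"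

text \<open>Oracle queries about non-vertices or non-existent neighbours are answered by \<open>0\<close>.\<close>

definition degree_query :: "problem \<Rightarrow> (nat \<Rightarrow> nat list) \<Rightarrow> nat \<Rightarrow> nat" where
  "degree_query I nbrs v = (if v < num_verts I then length (nbrs v) else 0)"

definition neighbor_query :: "problem \<Rightarrow> (nat \<Rightarrow> nat list) \<Rightarrow> nat \<Rightarrow> nat \<Rightarrow> nat" where
  "neighbor_query I nbrs v k =
     (if v < num_verts I \<and> k < length (nbrs v) then nbrs v ! k else 0)"

record config =
  pc :: nat
  work :: "nat \<Rightarrow> nat"
  cat :: "bool list"

definition set_cell :: "nat \<Rightarrow> nat \<Rightarrow> config \<Rightarrow> config" where
  "set_cell x a c = c\<lparr>pc := Suc (pc c), work := (work c)(x := a)\<rparr>"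

fun exec_instr :: "problem \<Rightarrow> instr \<Rightarrow> config \<Rightarrow> config" where
  "exec_instr I (Const x a) c = set_cell x a c"
| "exec_instr I (Arith f x y z) c = set_cell x (arith_value f (work c y) (work c z)) c"
| "exec_instr I (Param x p) c = set_cell x (param_value I p) c"
| "exec_instr I (In_Deg x y) c = set_cell x (degree_query I (in_nbrs I) (work c y)) c"
| "exec_instr I (Out_Deg x y) c = set_cell x (degree_query I (out_nbrs I) (work c y)) c"
| "exec_instr I (In_Nbr x y z) c = set_cell x (neighbor_query I (in_nbrs I) (work c y) (work c z)) c"
| "exec_instr I (Out_Nbr x y z) c = set_cell x (neighbor_query I (out_nbrs I) (work c y) (work c z)) c"
| "exec_instr I (Cat_Read x y) c =
     set_cell x (of_bool (work c y < length (cat c) \<and> cat c ! work c y)) c"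
| "exec_instr I (Cat_Write x y) c =
     c\<lparr>pc := Suc (pc c), cat := (cat c)[work c x := (work c y \<noteq> 0)]\<rparr>"
| "exec_instr I (Jump l) c = c\<lparr>pc := l\<rparr>"
| "exec_instr I (Jump_Less x y l) c = c\<lparr>pc := (if work c x < work c y then l else Suc (pc c))\<rparr>"
| "exec_instr I (Halt x) c = c"

text \<open>A program whose counter leaves the instruction list is stuck and never halts.\<close>

definition step :: "problem \<Rightarrow> program \<Rightarrow> config \<Rightarrow> config" where
  "step I P c = (if pc c < length P then exec_instr I (P ! pc c) c else c)"

definition run :: "problem \<Rightarrow> program \<Rightarrow> nat \<Rightarrow> config \<Rightarrow> config" where
  "run I P k c = (step I P ^^ k) c"

definition halted_with :: "program \<Rightarrow> config \<Rightarrow> nat \<Rightarrow> bool" where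
  "halted_with P c a \<longleftrightarrow> pc c < length P \<and> (\<exists>x. P ! pc c = Halt x \<and> work c x = a)"

definition init_config :: "bool list \<Rightarrow> config" where
  "init_config \<tau> = \<lparr>pc = 0, work = (\<lambda>_. 0), cat = \<tau>\<rparr>"

text \<open>In every configuration that is reached below only finitely many cells are nonzero.\<close>

definition work_space :: "config \<Rightarrow> nat" where
  "work_space c = (\<Sum>x | work c x \<noteq> 0. floorlog 2 (work c x))"


section \<open>Asymptotic bounds\<close>

text \<open>
  Work space is measured against the logarithm of all numbers in the input. The polylogarithmic
  factors hidden in time bounds do not involve the modulus. The summand \<open>1\<close> accounts for bounds
  that evaluate to \<open>0\<close>.
\<close>

definition log_space :: "(problem \<Rightarrow> nat) set" where
  "log_space = {f. \<exists>C::real. \<forall>I. well_formed I \<longrightarrow>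
     real (f I) \<le> C * log 2 (real (num_verts I + path_len I + reg_bits I + modulus I + 2))}"

definition soft_O :: "(problem \<Rightarrow> nat) \<Rightarrow> (problem \<Rightarrow> nat) set" where
  "soft_O g = {f. \<exists>(C::real) (k::nat). \<forall>I. well_formed I \<longrightarrow>
     real (f I) \<le> C * real (g I + 1) * log 2 (real (num_verts I + path_len I + reg_bits I + 2)) ^ k}"


section \<open>Catalytic algorithms\<close>

text \<open>
  \<open>query_prog\<close> is the routine that is invoked when the execution of \<open>main_prog\<close> is paused.
\<close>

record algorithm =
  main_prog :: program
  query_prog :: program

text \<open>The catalytic tape is restored whatever its initial contents, valid registers or not.\<close>

definition catalytic_logspace :: "algorithm \<Rightarrow> bool" where
  "catalytic_logspace A \<longleftrightarrow> (\<exists>s \<in> log_space. \<forall>I \<tau>. well_formed I \<and> length \<tau> = tape_size I \<longrightarrow>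
     (\<exists>k a. halted_with (main_prog A) (run I (main_prog A) k (init_config \<tau>)) a \<and>
            cat (run I (main_prog A) k (init_config \<tau>)) = \<tau>) \<and>
     (\<forall>k. work_space (run I (main_prog A) k (init_config \<tau>)) \<le> s I))"

definition returns :: "algorithm \<Rightarrow> problem \<Rightarrow> bool list \<Rightarrow> nat \<Rightarrow> bool" where
  "returns A I \<tau> a \<longleftrightarrow> (\<exists>k. halted_with (main_prog A) (run I (main_prog A) k (init_config \<tau>)) a)"

definition runs_in_time :: "algorithm \<Rightarrow> (problem \<Rightarrow> nat) \<Rightarrow> bool" where
  "runs_in_time A t \<longleftrightarrow> (\<forall>I \<tau>. well_formed I \<and> length \<tau> = tape_size I \<longrightarrow>
     (\<exists>k \<le> t I. \<exists>a. halted_with (main_prog A) (run I (main_prog A) k (init_config \<tau>)) a))"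

text \<open>
  The query routine receives the control point of the paused computation in cell \<open>0\<close> and the
  queried index in cell \<open>1\<close>; the work cells of the paused computation are shifted by two.
  It may modify work cells and catalytic tape, but must leave both as in the paused configuration
  \<open>c\<close>, so that the execution can continue.
\<close>

definition query_config :: "nat \<Rightarrow> config \<Rightarrow> config" where
  "query_config j c =
     \<lparr>pc = 0, work = (\<lambda>x. if x = 0 then pc c else if x = 1 then j else work c (x - 2)), cat = cat c\<rparr>"

definition answers_query ::
  "algorithm \<Rightarrow> problem \<Rightarrow> bool list \<Rightarrow> config \<Rightarrow> nat \<Rightarrow> nat \<Rightarrow> bool" where
  "answers_query A I \<tau> c j t \<longleftrightarrow>
     (\<exists>k \<le> t. let c' = run I (query_prog A) k (query_config j c) in
        halted_with (query_prog A) c' (of_bool (\<tau> ! j)) \<and>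
        cat c' = cat c \<and> (\<forall>x. work c' (x + 2) = work c x))"

definition locally_revertible_in_time :: "algorithm \<Rightarrow> (problem \<Rightarrow> nat) \<Rightarrow> bool" where
  "locally_revertible_in_time A t \<longleftrightarrow>
     (\<exists>s \<in> log_space. \<forall>I \<tau> k j. well_formed I \<and> length \<tau> = tape_size I \<and> j < tape_size I \<longrightarrow>
        (let c = run I (main_prog A) k (init_config \<tau>) in
           answers_query A I \<tau> c j (t I) \<and>
           (\<forall>k'. work_space (run I (query_prog A) k' (query_config j c)) \<le> s I)))"

end

theory Submission
  imports Defs
begin

text \<open>
  Forward, every register \<open>R\<^bsub>i,v\<^esub>\<close> receives the residue sum of its in-neighbours in layer \<open>i - 1\<close>,
  in increasing order. The update is a bijection that only moves a register within its block of
  length \<open>q\<close>, and is the identity on the incomplete last block, hence it can be undone in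
  decreasing order whatever the initial contents. Two such runs, the second with the register of the
  source increased by one, leave two residues in the target register whose difference is the number of
  paths.

  At any time the registers below some boundary are shifted and the others are original, so a query
  subtracts at most one such sum. The register at the boundary is changed bit by bit, and
  the cells of the program always determine the pending carry: this is the invariant
  \<open>recoverable\<close>, which holds after every single instruction.
\<close>

section \<open>Structured programs\<close>

text \<open>A register has \<open>l\<close> bits, while a work cell may hold only logarithmically
  many bits in \<open>l\<close>, so a register does not fit into a cell. Everything is streamed:
  residues and validity are computed from the top bit down, and a register is changed by adding a
  small integer at bit 0 and rippling the carry. This suffices because a shift stays inside a block
  of length \<open>q\<close>, so that old and new value differ exactly as their residues do. Carries
  may be negative while cells hold natural numbers; hence the offsets \<open>q\<close> and
  \<open>2 * q\<close> and the bounds \<open>3 * q\<close> below. Undoing works because a register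
  depends only on registers of smaller index, which are still shifted when it is restored, and
  because validity can be read off the shifted register as well as off the original. The time bounds
  can degenerate to constants: for the run if \<open>path_len I * reg_bits I = 0\<close>, for the
  query if the maximal in-degree is 0. This forces a separate trivial run, and the direct reading of
  registers without in-neighbours, which are never written.\<close>

datatype com =
    Block "instr list"
  | Seq com com
  | If_Less nat nat com com
  | While_Less nat nat com

fun com_size :: "com \<Rightarrow> nat" where
  "com_size (Block is) = length is"
| "com_size (Seq C D) = com_size C + com_size D"
| "com_size (If_Less x y C D) = com_size C + com_size D + 2"
| "com_size (While_Less x y C) = com_size C + 3"

text \<open>Jumps are absolute, so the start address \<open>l\<close> is a parameter. In a
  conditional the alternative comes first: the failing test falls through to it, and only that
  branch needs a closing jump.\<close>

fun compile :: "nat \<Rightarrow> com \<Rightarrow> program" where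
  "compile l (Block is) = is"
| "compile l (Seq C D) = compile l C @ compile (l + com_size C) D"
| "compile l (If_Less x y C D) =
     Jump_Less x y (l + com_size D + 2) # compile (l + 1) D @
     Jump (l + com_size D + com_size C + 2) # compile (l + com_size D + 2) C"
| "compile l (While_Less x y C) =
     Jump_Less x y (l + 2) # Jump (l + com_size C + 3) # compile (l + 2) C @ [Jump l]"

lemma length_compile [simp]: "length (compile l C) = com_size C"
  by (induction C arbitrary: l) auto

fun straight :: "instr \<Rightarrow> bool" where
  "straight (Jump _) = False"
| "straight (Jump_Less _ _ _) = False"
| "straight (Halt _) = False"
| "straight _ = True"

fun straight_com :: "com \<Rightarrow> bool" where
  "straight_com (Block is) = (\<forall>i \<in> set is. straight i)"
| "straight_com (Seq C D) = (straight_com C \<and> straight_com D)"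
| "straight_com (If_Less x y C D) = (straight_com C \<and> straight_com D)"
| "straight_com (While_Less x y C) = straight_com C"

fun jump_target :: "instr \<Rightarrow> nat" where
  "jump_target (Jump l) = l"
| "jump_target (Jump_Less _ _ l) = l"
| "jump_target _ = 0"

lemma jump_target_straight: "straight i \<Longrightarrow> jump_target i = 0"
  by (cases i) auto

lemma jump_target_compile:
  "straight_com C \<Longrightarrow> i \<in> set (compile l C) \<Longrightarrow> jump_target i \<le> l + com_size C"
  by (induction C arbitrary: l) (fastforce simp: jump_target_straight)+

lemma run_0 [simp]: "run I P 0 c = c"
  by (simp add: run_def)

lemma run_Suc: "run I P (Suc k) c = run I P k (step I P c)"
  by (simp add: run_def funpow_swap1)

lemma run_Suc_right: "run I P (Suc k) c = step I P (run I P k c)"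
  by (simp add: run_def)

lemma run_add: "run I P (j + k) c = run I P k (run I P j c)"
  by (simp add: run_def funpow_add add.commute[of j])

lemma pc_step_le:
  assumes "\<forall>i \<in> set P. jump_target i \<le> length P" "pc c \<le> length P"
  shows "pc (step I P c) \<le> length P"
proof (cases "pc c < length P")
  case True
  then have "P ! pc c \<in> set P" by simp
  with assms(1) have "jump_target (P ! pc c) \<le> length P" by blast
  then show ?thesis using True by (cases "P ! pc c") (auto simp: step_def set_cell_def)
qed (use assms in \<open>auto simp: step_def\<close>)

text \<open>A query receives the program counter of the paused run in a work cell, so its size
  counts as work space and needs a bound.\<close>

lemma pc_run_le:
  assumes "\<forall>i \<in> set P. jump_target i \<le> length P" "pc c \<le> length P"
  shows "pc (run I P k c) \<le> length P"
  by (induction k) (use assms in \<open>auto simp: run_Suc_right pc_step_le\<close>)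

fun effect :: "problem \<Rightarrow> instr \<Rightarrow> (nat \<Rightarrow> nat) \<Rightarrow> bool list \<Rightarrow> (nat \<Rightarrow> nat) \<times> bool list" where
  "effect I (Cat_Write x y) w m = (w, m[w x := (w y \<noteq> 0)])"
| "effect I (Const x a) w m = (w(x := a), m)"
| "effect I (Arith f x y z) w m = (w(x := arith_value f (w y) (w z)), m)"
| "effect I (Param x p) w m = (w(x := param_value I p), m)"
| "effect I (In_Deg x y) w m = (w(x := degree_query I (in_nbrs I) (w y)), m)"
| "effect I (Out_Deg x y) w m = (w(x := degree_query I (out_nbrs I) (w y)), m)"
| "effect I (In_Nbr x y z) w m = (w(x := neighbor_query I (in_nbrs I) (w y) (w z)), m)"
| "effect I (Out_Nbr x y z) w m = (w(x := neighbor_query I (out_nbrs I) (w y) (w z)), m)"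
| "effect I (Cat_Read x y) w m = (w(x := of_bool (w y < length m \<and> m ! w y)), m)"
| "effect I _ w m = (w, m)"

abbreviation (input) conf :: "nat \<Rightarrow> (nat \<Rightarrow> nat) \<Rightarrow> bool list \<Rightarrow> config" where
  "conf l w m \<equiv> \<lparr>pc = l, work = w, cat = m\<rparr>"

abbreviation (input) holds :: "((nat \<Rightarrow> nat) \<Rightarrow> bool list \<Rightarrow> bool) \<Rightarrow> config \<Rightarrow> bool" where
  "holds J c \<equiv> J (work c) (cat c)"

lemma exec_straight:
  assumes "straight i" "effect I i w m = (w', m')"
  shows "exec_instr I i (conf l w m) = conf (Suc l) w' m'"
  using assms by (cases i) (auto simp: set_cell_def)

abbreviation (input) ends where
  "ends I P J t Q c l \<equiv> \<exists>k \<le> t. \<exists>w' m'. run I P k c = conf l w' m' \<and> Q w' m' \<and> (\<forall>j \<le> k. holds J (run I P j c))"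

text \<open>
  The condition \<open>J\<close> is imposed after every single step, since the computation may be paused anywhere.
\<close>

definition sat ::
  "problem \<Rightarrow> ((nat \<Rightarrow> nat) \<Rightarrow> bool list \<Rightarrow> bool) \<Rightarrow> com \<Rightarrow> nat \<Rightarrow>
   ((nat \<Rightarrow> nat) \<Rightarrow> bool list \<Rightarrow> bool) \<Rightarrow> (nat \<Rightarrow> nat) \<Rightarrow> bool list \<Rightarrow> bool" where
  "sat I J C t Q w m \<longleftrightarrow> (\<forall>xs ys.
     let P = xs @ compile (length xs) C @ ys; c = conf (length xs) w m in
     ends I P J t Q c (length xs + com_size C))"

lemma satI:
  assumes "\<And>P xs ys. P = xs @ compile (length xs) C @ ys \<Longrightarrow>
     ends I P J t Q (conf (length xs) w m) (length xs + com_size C)"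
  shows "sat I J C t Q w m"
  using assms unfolding sat_def Let_def by blast

lemma satE:
  assumes "sat I J C t Q w m" "P = xs @ compile l C @ ys" "l = length xs" "l' = l + com_size C"
  obtains k w' m' where "k \<le> t" "run I P k (conf l w m) = conf l' w' m'"
    "Q w' m'" "\<And>j. j \<le> k \<Longrightarrow> holds J (run I P j (conf l w m))"
  using assms unfolding sat_def Let_def by metis

lemma J_append:
  assumes "\<And>j. j \<le> k \<Longrightarrow> holds J (run I P j c)"
    and "run I P k c = c'"
    and "\<And>j. j \<le> k' \<Longrightarrow> holds J (run I P j c')"
    and "j \<le> k + k'"
  shows "holds J (run I P j c)"
proof (cases "j \<le> k")
  case False
  then have "run I P j c = run I P (j - k) c'"
    using assms(2) run_add[of I P k "j - k" c] by simp
  then show ?thesis using assms(3)[of "j - k"] assms(4) False by simp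
qed (use assms in auto)

text \<open>The monitored condition holds at the end of the run too, so \<open>J\<close> is
  available when the postcondition is weakened.\<close>

lemma sat_conseq:
  assumes "sat I J C t Q w m" "t \<le> t'" "\<And>w' m'. J w' m' \<Longrightarrow> Q w' m' \<Longrightarrow> Q' w' m'"
  shows "sat I J C t' Q' w m"
proof (rule satI)
  fix P xs ys assume P: "P = xs @ compile (length xs) C @ ys"
  from satE[OF assms(1) P refl refl] obtain k w' m' where
    *: "k \<le> t" "run I P k (conf (length xs) w m) =
      conf (length xs + com_size C) w' m'" "Q w' m'"
    "\<And>j. j \<le> k \<Longrightarrow> holds J (run I P j (conf (length xs) w m))" by blast
  have "J w' m'" using *(4)[of k] *(2) by simp
  then show "ends I P J t' Q' (conf (length xs) w m) (length xs + com_size C)"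
    using * assms(2,3) by (intro exI[of _ k] conjI exI[of _ w'] exI[of _ m']) auto
qed

lemma sat_Nil: "J w m \<Longrightarrow> Q w m \<Longrightarrow> sat I J (Block []) t Q w m"
  by (rule satI) (auto intro!: exI[of _ 0])

lemma step_at:
  "P = xs @ i # ys \<Longrightarrow> l = length xs \<Longrightarrow>
   step I P (conf l w m) = exec_instr I i (conf l w m)"
  by (simp add: step_def)

lemma all_le_Suc: "(\<forall>j \<le> Suc k. R j) \<longleftrightarrow> R 0 \<and> (\<forall>j \<le> k. R (Suc j))"
  by (metis Suc_le_mono le0 not0_implies_Suc)

lemma sat_Cons:
  assumes "straight i" "J w m" "effect I i w m = (w', m')" "sat I J (Block is) t Q w' m'"
  shows "sat I J (Block (i # is)) (Suc t) Q w m"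
proof (rule satI)
  fix P xs ys assume P: "P = xs @ compile (length xs) (Block (i # is)) @ ys"
  have st: "step I P (conf (length xs) w m) = conf (Suc (length xs)) w' m'"
    using step_at[of P xs i "is @ ys" "length xs"] P exec_straight[OF assms(1,3)] by simp
  have "P = (xs @ [i]) @ compile (Suc (length xs)) (Block is) @ ys" using P by simp
  from satE[OF assms(4) this, of "Suc (length xs) + length is"] obtain k w1 m1 where
    *: "k \<le> t" "run I P k (conf (Suc (length xs)) w' m') =
      conf (Suc (length xs) + length is) w1 m1" "Q w1 m1"
    "\<And>j. j \<le> k \<Longrightarrow> holds J (run I P j (conf (Suc (length xs)) w' m'))" by auto
  show "ends I P J (Suc t) Q (conf (length xs) w m) (length xs + com_size (Block (i # is)))"
    using * assms(2)
    by (intro exI[of _ "Suc k"] conjI exI[of _ w1] exI[of _ m1]) (auto simp: run_Suc st all_le_Suc)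
qed

lemma sat_Seq:
  assumes "sat I J C t (sat I J D t' Q) w m"
  shows "sat I J (Seq C D) (t + t') Q w m"
proof (rule satI)
  fix P xs ys assume P: "P = xs @ compile (length xs) (Seq C D) @ ys"
  let ?l = "length xs" and ?c = "conf (length xs) w m"
  have P1: "P = xs @ compile ?l C @ compile (?l + com_size C) D @ ys" using P by simp
  have P2: "P = (xs @ compile ?l C) @ compile (?l + com_size C) D @ ys" using P by simp
  from satE[OF assms P1 refl refl] obtain k w1 m1 where
    1: "k \<le> t" "run I P k ?c = conf (?l + com_size C) w1 m1"
    "sat I J D t' Q w1 m1" "\<And>j. j \<le> k \<Longrightarrow> holds J (run I P j ?c)" by blast
  from satE[OF 1(3) P2 _ refl] obtain k' w2 m2 where
    2: "k' \<le> t'" "run I P k' (conf (?l + com_size C) w1 m1) =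
       conf (?l + com_size C + com_size D) w2 m2" "Q w2 m2"
    "\<And>j. j \<le> k' \<Longrightarrow> holds J (run I P j (conf (?l + com_size C) w1 m1))" by auto
  show "ends I P J (t + t') Q ?c (?l + com_size (Seq C D))"
    using 1 2 J_append[of k J I P ?c _ k', OF 1(4) 1(2) 2(4)]
    by (intro exI[of _ "k + k'"] conjI exI[of _ w2] exI[of _ m2]) (auto simp: run_add)
qed

text \<open>The two extra steps are the test and, after the alternative, the jump over the other
  branch.\<close>

lemma sat_If:
  assumes "J w m"
    and "w x < w y \<Longrightarrow> sat I J C t Q w m"
    and "\<not> w x < w y \<Longrightarrow> sat I J D t Q w m"
  shows "sat I J (If_Less x y C D) (t + 2) Q w m"
proof (rule satI)
  fix P xs ys assume P: "P = xs @ compile (length xs) (If_Less x y C D) @ ys"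
  let ?l = "length xs" and ?c = "\<lambda>l. conf l w m"
  let ?e = "?l + com_size D + com_size C + 2"
  have P1: "P = (xs @ Jump_Less x y (?l + com_size D + 2) # compile (?l + 1) D @ [Jump ?e]) @
    compile (?l + com_size D + 2) C @ ys" using P by simp
  have P2: "P = (xs @ [Jump_Less x y (?l + com_size D + 2)]) @ compile (?l + 1) D @
    Jump ?e # compile (?l + com_size D + 2) C @ ys" using P by simp
  have P3: "P = (xs @ Jump_Less x y (?l + com_size D + 2) # compile (?l + 1) D) @
    Jump ?e # compile (?l + com_size D + 2) C @ ys" using P by simp
  have st: "step I P (?c ?l) = ?c (if w x < w y then ?l + com_size D + 2 else Suc ?l)"
    using P by (simp add: step_at)
  show "ends I P J (t + 2) Q (?c ?l) (?l + com_size (If_Less x y C D))"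
  proof (cases "w x < w y")
    case True
    from satE[OF assms(2)[OF True] P1, of ?e] obtain k w1 m1 where
      1: "k \<le> t" "run I P k (?c (?l + com_size D + 2)) = conf ?e w1 m1"
      "Q w1 m1" "\<And>j. j \<le> k \<Longrightarrow> holds J (run I P j (?c (?l + com_size D + 2)))"
      by auto
    then show ?thesis using st True assms(1)
      by (intro exI[of _ "Suc k"] conjI exI[of _ w1] exI[of _ m1])
         (auto simp: run_Suc all_le_Suc algebra_simps)
  next
    case False
    from satE[OF assms(3)[OF False] P2, of "?l + 1 + com_size D"] obtain k w1 m1 where
      1: "k \<le> t" "run I P k (?c (Suc ?l)) = conf (Suc ?l + com_size D) w1 m1"
      "Q w1 m1" "\<And>j. j \<le> k \<Longrightarrow> holds J (run I P j (?c (Suc ?l)))"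
      by auto
    have st': "step I P (conf (Suc ?l + com_size D) w1 m1) = conf ?e w1 m1"
      using step_at[OF P3, of "Suc ?l + com_size D"] by simp
    have 2: "run I P 1 (conf (Suc ?l + com_size D) w1 m1) = conf ?e w1 m1"
      using st' by (simp add: run_Suc)
    have "J w1 m1" using 1(4)[of k] 1(2) by simp
    then have 3: "holds J (run I P j (conf (Suc ?l + com_size D) w1 m1))" if "j \<le> 1" for j
      using that st' by (cases j) (auto simp: run_Suc)
    have "holds J (run I P j (?c (Suc ?l)))" if "j \<le> k + 1" for j
      using J_append[of k J I P, OF 1(4) 1(2) 3 that] .
    then have "\<forall>j\<le>Suc (k + 1). holds J (run I P j (?c ?l))"
      using st False assms(1) by (simp only: all_le_Suc run_Suc if_False run_0 config.simps) simp
    moreover have "run I P (Suc (k + 1)) (?c ?l) = conf ?e w1 m1"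
      using st False 1(2) 2 by (simp only: run_Suc[of I P "k + 1"] run_add if_False)
    ultimately show ?thesis using 1(1,3)
      by (intro exI[of _ "Suc (k + 1)"] conjI exI[of _ w1] exI[of _ m1]) auto
  qed
qed

text \<open>The invariant is indexed by the number of rounds still to come, so termination and
  running time come out together. Letting \<open>tb\<close> vary with the round makes it possible to
  charge each register by its own in-degree. A round adds the test and the jump back; the exit adds
  a failing test and a jump.\<close>

lemma sat_While:
  assumes body: "\<And>k w m. J w m \<Longrightarrow> Inv (Suc k) w m \<Longrightarrow> w x < w y \<and> sat I J C (tb k) (Inv k) w m"
    and exit: "\<And>w m. J w m \<Longrightarrow> Inv 0 w m \<Longrightarrow> \<not> w x < w y \<and> Q w m"
    and "J w m" "Inv k w m"
  shows "sat I J (While_Less x y C) ((\<Sum>j<k. tb j + 2) + 2) Q w m"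
proof (rule satI)
  fix P xs ys assume P: "P = xs @ compile (length xs) (While_Less x y C) @ ys"
  let ?l = "length xs" and ?c = "\<lambda>l w m. conf l w m"
  let ?e = "?l + com_size C + 3"
  have P1: "P = (xs @ [Jump_Less x y (?l + 2)]) @ Jump ?e # compile (?l + 2) C @ Jump ?l # ys" using P by simp
  have P2: "P = (xs @ [Jump_Less x y (?l + 2), Jump ?e]) @ compile (?l + 2) C @ Jump ?l # ys" using P by simp
  have P3: "P = (xs @ Jump_Less x y (?l + 2) # Jump ?e # compile (?l + 2) C) @ Jump ?l # ys" using P by simp
  have st: "step I P (?c ?l w m) = ?c (if w x < w y then ?l + 2 else Suc ?l) w m" for w m
    using P by (simp add: step_at)
  have st1: "step I P (?c (Suc ?l) w m) = ?c ?e w m" for w m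
    using step_at[OF P1, of "Suc ?l"] by simp
  have st2: "step I P (?c (?l + 2 + com_size C) w m) = ?c ?l w m" for w m
    using step_at[OF P3, of "?l + 2 + com_size C"] by simp
  show "ends I P J ((\<Sum>j<k. tb j + 2) + 2) Q (?c ?l w m) (?l + com_size (While_Less x y C))"
    using assms(3,4)
  proof (induction k arbitrary: w m)
    case 0
    from exit[OF 0] 0(1) show ?case
      by (intro exI[of _ "Suc (Suc 0)"] conjI exI[of _ w] exI[of _ m]) (auto simp: run_Suc st st1 all_le_Suc)
  next
    case (Suc k)
    from body[OF Suc.prems] have le: "w x < w y" and s: "sat I J C (tb k) (Inv k) w m" by auto
    from satE[OF s P2, of "?l + 2 + com_size C"] obtain k1 w1 m1 where
      1: "k1 \<le> tb k" "run I P k1 (?c (?l + 2) w m) = ?c (?l + 2 + com_size C) w1 m1"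
      "Inv k w1 m1" "\<And>j. j \<le> k1 \<Longrightarrow> holds J (run I P j (?c (?l + 2) w m))"
      by auto
    have J1: "J w1 m1" using 1(4)[of k1] 1(2) by simp
    from Suc.IH[OF J1 1(3)] obtain k2 w2 m2 where
      2: "k2 \<le> (\<Sum>j<k. tb j + 2) + 2" "run I P k2 (?c ?l w1 m1) = ?c ?e w2 m2" "Q w2 m2"
       "\<And>j. j \<le> k2 \<Longrightarrow> holds J (run I P j (?c ?l w1 m1))" by auto
    have 3: "holds J (run I P j (?c (?l + 2 + com_size C) w1 m1))"
      if "j \<le> Suc k2" for j
      using that J1 2(4)[of "j - 1"] st2 by (cases j) (auto simp: run_Suc)
    have 4: "holds J (run I P j (?c (?l + 2) w m))" if "j \<le> k1 + Suc k2" for j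
      using J_append[of k1 J I P, OF 1(4) 1(2) 3 that] .
    have 5: "run I P (k1 + Suc k2) (?c (?l + 2) w m) = ?c ?e w2 m2"
      using 1(2) 2(2) st2 by (simp add: run_add run_Suc del: add_Suc_right)
    have "run I P (Suc (k1 + Suc k2)) (?c ?l w m) = ?c ?e w2 m2"
      using 5 st[of w m] le by (simp only: run_Suc if_True)
    moreover have "\<forall>j\<le>Suc (k1 + Suc k2). holds J (run I P j (?c ?l w m))"
      using 4 st[of w m] le Suc.prems(1) by (simp only: all_le_Suc run_Suc if_True run_0 config.simps) simp
    ultimately show ?case using 1(1) 2(1,3)
      by (intro exI[of _ "Suc (k1 + Suc k2)"] conjI exI[of _ w2] exI[of _ m2]) auto
  qed
qed

section \<open>Registers\<close>

definition nregs :: "problem \<Rightarrow> nat" where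
  "nregs I = (path_len I + 1) * num_verts I"

definition reg :: "problem \<Rightarrow> bool list \<Rightarrow> nat \<Rightarrow> nat" where
  "reg I m g = horner_sum of_bool 2 (take (reg_bits I) (drop (g * reg_bits I) m))"

lemma register_eq_reg: "register I m i u = reg I m (i * num_verts I + u)"
  by (simp add: register_def reg_def)

lemma address_less:
  fixes g :: nat assumes "g < N" "k < l" shows "g * l + k < N * l"
proof -
  have "g * l + k < Suc g * l" using assms by simp
  also have "\<dots> \<le> N * l" using assms by (intro mult_right_mono) auto
  finally show ?thesis .
qed

lemma register_length:
  assumes "length m = nregs I * reg_bits I" "g < nregs I"
  shows "length (take (reg_bits I) (drop (g * reg_bits I) m)) = reg_bits I"
proof -
  have "Suc g * reg_bits I \<le> nregs I * reg_bits I"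
    using assms by (intro mult_right_mono) auto
  then show ?thesis using assms by simp
qed

lemma register_drop:
  assumes "length m = nregs I * reg_bits I" "g < nregs I"
  shows "drop (g * reg_bits I) m ! k = m ! (g * reg_bits I + k)"
proof -
  have "g * reg_bits I \<le> length m" using assms by (simp add: mult_right_mono)
  then show ?thesis by simp
qed

lemma reg_less: "reg I m g < 2 ^ reg_bits I"
proof -
  have "reg I m g < 2 ^ length (take (reg_bits I) (drop (g * reg_bits I) m))"
    unfolding reg_def by (rule horner_sum_bound)
  also have "\<dots> \<le> 2 ^ reg_bits I" by (intro power_increasing) auto
  finally show ?thesis .
qed

lemma bit_reg:
  assumes "length m = nregs I * reg_bits I" "g < nregs I" "k < reg_bits I"
  shows "bit (reg I m g) k = m ! (g * reg_bits I + k)"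
  using register_length[OF assms(1,2)] assms register_drop[OF assms(1,2)]
  by (simp add: reg_def bit_horner_sum_bit_iff)

lemma reg_eq_sum:
  assumes "length m = nregs I * reg_bits I" "g < nregs I"
  shows "reg I m g = (\<Sum>k<reg_bits I. of_bool (m ! (g * reg_bits I + k)) * 2 ^ k)"
  unfolding reg_def horner_sum_eq_sum register_length[OF assms] atLeast0LessThan
proof (rule sum.cong[OF refl])
  fix k assume "k \<in> {..<reg_bits I}"
  then show "of_bool (take (reg_bits I) (drop (g * reg_bits I) m) ! k) * 2 ^ k =
         of_bool (m ! (g * reg_bits I + k)) * (2::nat) ^ k"
    using register_drop[OF assms] by simp
qed

text \<open>Reading from the top, each prefix arises from the previous one by doubling and adding a
  bit; this is the Horner step behind the scan.\<close>

lemma reg_div_step: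
  assumes "length m = nregs I * reg_bits I" "g < nregs I" "k < reg_bits I"
  shows "reg I m g div 2 ^ k = 2 * (reg I m g div 2 ^ Suc k) + of_bool (m ! (g * reg_bits I + k))"
proof -
  have "of_bool (m ! (g * reg_bits I + k)) = (reg I m g div 2 ^ k) mod 2"
    using bit_reg[OF assms] by (simp add: bit_iff_odd mod_2_eq_odd)
  then show ?thesis by (simp add: div_mult2_eq power_Suc2 del: power_Suc)
qed

text \<open>The tape consists of registers and nothing else, so restoring it may be checked register
  by register.\<close>

lemma reg_ext:
  assumes "length m = nregs I * reg_bits I" "length m' = nregs I * reg_bits I"
    and "\<And>g. g < nregs I \<Longrightarrow> reg I m g = reg I m' g"
  shows "m = m'"
proof (rule nth_equalityI)
  fix j assume j: "j < length m"
  then have l: "0 < reg_bits I" using assms(1) by (cases "reg_bits I") auto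
  then have "j div reg_bits I < nregs I" "j mod reg_bits I < reg_bits I"
    using j assms(1) by (auto simp: less_mult_imp_div_less)
  with bit_reg[OF assms(1) this] bit_reg[OF assms(2) this] assms(3)
  show "m ! j = m' ! j" by simp
qed (use assms in simp)

lemma reg_update_other:
  assumes "length m = nregs I * reg_bits I" "g < nregs I" "g' < nregs I" "g \<noteq> g'" "k < reg_bits I"
  shows "reg I (m[g * reg_bits I + k := x]) g' = reg I m g'"
proof -
  have "g * reg_bits I + k \<noteq> g' * reg_bits I + k'" if "k' < reg_bits I" for k'
  proof
    assume "g * reg_bits I + k = g' * reg_bits I + k'"
    then have "(g * reg_bits I + k) div reg_bits I = (g' * reg_bits I + k') div reg_bits I" by simp
    then show False using assms(4,5) that by simp
  qed
  then show ?thesis using assms by (auto simp: reg_eq_sum intro!: sum.cong)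
qed

text \<open>
  The register that is named by \<open>g\<close> is \<open>R\<^bsub>i,u\<^esub>\<close> for \<open>i = g div n\<close> and \<open>u = g mod n\<close>.
  Layer \<open>0\<close> receives no contributions. In the second run, \<open>\<rho> = 1\<close>, the source register of layer \<open>0\<close>
  is read as if it had been incremented, so that layer \<open>0\<close> is never written.
\<close>

definition indeg :: "problem \<Rightarrow> nat \<Rightarrow> nat" where
  "indeg I g = (if g < num_verts I then 0 else length (in_nbrs I (g mod num_verts I)))"

definition pred_reg :: "problem \<Rightarrow> nat \<Rightarrow> nat \<Rightarrow> nat" where
  "pred_reg I g e = (g div num_verts I - 1) * num_verts I + in_nbrs I (g mod num_verts I) ! e"

definition seed :: "problem \<Rightarrow> nat \<Rightarrow> nat \<Rightarrow> nat \<Rightarrow> nat" where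
  "seed I \<rho> g e = of_bool (in_nbrs I (g mod num_verts I) ! e = src I \<and> g div num_verts I = 1) * \<rho>"

definition insum :: "problem \<Rightarrow> nat \<Rightarrow> (nat \<Rightarrow> nat) \<Rightarrow> nat \<Rightarrow> nat" where
  "insum I \<rho> V g = (\<Sum>e<indeg I g. V (pred_reg I g e) + seed I \<rho> g e)"

text \<open>The incomplete last block has \<open>2 ^ reg_bits I mod modulus I\<close> elements, so
  \<open>x\<close> lies below it iff at least that many numbers of the range exceed
  \<open>x\<close>. In this form the right side may be capped at \<open>modulus I\<close>, which
  leaves a comparison of small numbers.\<close>

definition is_valid :: "problem \<Rightarrow> nat \<Rightarrow> bool" where
  "is_valid I x \<longleftrightarrow> 2 ^ reg_bits I mod modulus I \<le> 2 ^ reg_bits I - 1 - x"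

definition increment :: "problem \<Rightarrow> nat \<Rightarrow> (nat \<Rightarrow> nat) \<Rightarrow> nat \<Rightarrow> nat" where
  "increment I \<rho> V g = of_bool (is_valid I (V g)) * (insum I \<rho> V g mod modulus I)"

section \<open>Verification conditions for straight-line code\<close>

text \<open>Shared by the main run and the query: \<open>R\<close> depends only on the cells below
  \<open>b\<close>, all cells in use lie below \<open>K\<close>, and \<open>B\<close> bounds their
  contents. The factor 8 leaves room for all intermediate values, such as bit addresses,
  \<open>4 * N\<close> and sums of a few multiples of \<open>q\<close>.\<close>

locale monitored =
  fixes I :: problem and B K b :: nat and R :: "(nat \<Rightarrow> nat) \<Rightarrow> bool list \<Rightarrow> bool"
  assumes wf: "well_formed I"
    and stable: "(\<And>x. x < b \<Longrightarrow> w' x = w x) \<Longrightarrow> R w m \<Longrightarrow> R w' m"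
    and big: "8 * (nregs I * reg_bits I) + 8 * nregs I + 8 * reg_bits I + 8 * path_len I + 8 * modulus I + 16 \<le> B"
begin

abbreviation "n \<equiv> num_verts I"
abbreviation "l \<equiv> reg_bits I"
abbreviation "q \<equiv> modulus I"
abbreviation "N \<equiv> nregs I"

definition J :: "(nat \<Rightarrow> nat) \<Rightarrow> bool list \<Rightarrow> bool" where
  "J w m \<longleftrightarrow> R w m \<and> (\<forall>x. w x \<le> B) \<and> (\<forall>x \<ge> K. w x = 0)"

text \<open>\<open>R\<close> has to be re-established only when a monitored cell is written; for
  scratch cells the assumption \<open>stable\<close> supplies it.\<close>

definition assigns ::
  "nat \<Rightarrow> nat \<Rightarrow> ((nat \<Rightarrow> nat) \<Rightarrow> bool list \<Rightarrow> bool) \<Rightarrow> (nat \<Rightarrow> nat) \<Rightarrow> bool list \<Rightarrow> bool" where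
  "assigns x v Q w m \<longleftrightarrow> x < K \<and> v \<le> B \<and> (x < b \<longrightarrow> R (w(x := v)) m) \<and> Q (w(x := v)) m"

fun wp_instr ::
  "instr \<Rightarrow> ((nat \<Rightarrow> nat) \<Rightarrow> bool list \<Rightarrow> bool) \<Rightarrow> (nat \<Rightarrow> nat) \<Rightarrow> bool list \<Rightarrow> bool" where
  "wp_instr (Const x a) Q w m = assigns x a Q w m"
| "wp_instr (Arith f x y z) Q w m = assigns x (arith_value f (w y) (w z)) Q w m"
| "wp_instr (Param x p) Q w m = assigns x (param_value I p) Q w m"
| "wp_instr (In_Deg x y) Q w m = assigns x (degree_query I (in_nbrs I) (w y)) Q w m"
| "wp_instr (In_Nbr x y z) Q w m = assigns x (neighbor_query I (in_nbrs I) (w y) (w z)) Q w m"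
| "wp_instr (Cat_Read x y) Q w m = assigns x (of_bool (w y < length m \<and> m ! w y)) Q w m"
| "wp_instr (Cat_Write x y) Q w m =
     (R w (m[w x := (w y \<noteq> 0)]) \<and> Q w (m[w x := (w y \<noteq> 0)]))"
| "wp_instr _ Q w m = False"

primrec wp ::
  "instr list \<Rightarrow> ((nat \<Rightarrow> nat) \<Rightarrow> bool list \<Rightarrow> bool) \<Rightarrow> (nat \<Rightarrow> nat) \<Rightarrow> bool list \<Rightarrow> bool" where
  "wp [] Q w m = Q w m"
| "wp (i # is) Q w m = wp_instr i (wp is Q) w m"

lemmas [simp] = assigns_def

lemma J_upd:
  assumes "J w m" "x < K" "v \<le> B" "x < b \<longrightarrow> R (w(x := v)) m"
  shows "J (w(x := v)) m"
proof (cases "x < b")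
  case False
  then have "R (w(x := v)) m" using assms(1) by (intro stable[of "w(x := v)" w]) (auto simp: J_def)
  then show ?thesis using assms by (auto simp: J_def)
qed (use assms in \<open>auto simp: J_def\<close>)

lemma sat_Block:
  assumes "J w m" "wp is (\<lambda>w m. J w m \<longrightarrow> Q w m) w m"
  shows "sat I J (Block is) (length is) Q w m"
  using assms
proof (induction "is" arbitrary: w m)
  case (Cons i "is")
  have A: "straight i \<Longrightarrow> effect I i w m = (w', m') \<Longrightarrow> J w' m' \<Longrightarrow>
      wp is (\<lambda>w m. J w m \<longrightarrow> Q w m) w' m' \<Longrightarrow> ?case" for w' m'
    using sat_Cons[of i J w m I w' m' "is" "length is" Q] Cons by simp
  have As: "straight i \<Longrightarrow> effect I i w m = (w(x := v), m) \<Longrightarrow>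
      assigns x v (wp is (\<lambda>w m. J w m \<longrightarrow> Q w m)) w m \<Longrightarrow> ?case" for x v
    using A[of "w(x := v)" m] J_upd[OF Cons.prems(1), of x v] by (auto simp: assigns_def)
  show ?case
  proof (cases i)
    case (Cat_Write x y)
    then show ?thesis using A[of w "m[w x := (w y \<noteq> 0)]"] Cons.prems by (auto simp: J_def)
  qed (use As Cons.prems in simp_all)
qed (simp add: sat_Nil)

lemma sat_BlockI:
  assumes "J w m" "wp is (\<lambda>w m. J w m \<longrightarrow> Q w m) w m" "length is \<le> t"
  shows "sat I J (Block is) t Q w m"
  using sat_conseq[OF sat_Block[OF assms(1,2)] assms(3)] .

lemma sat_SeqI:
  assumes "sat I J C ta (\<lambda>w m. J w m \<longrightarrow> sat I J D tb Q w m) w m" "ta + tb \<le> t"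
  shows "sat I J (Seq C D) t Q w m"
proof -
  have "sat I J C ta (\<lambda>w m. sat I J D tb Q w m) w m" by (rule sat_conseq[OF assms(1)]) auto
  from sat_conseq[OF sat_Seq[OF this] assms(2)] show ?thesis .
qed

lemma sat_SeqR:
  assumes "sat I J C ta P w m" "\<And>w' m'. J w' m' \<Longrightarrow> P w' m' \<Longrightarrow> sat I J D tb Q w' m'" "ta + tb \<le> t"
  shows "sat I J (Seq C D) t Q w m"
  by (rule sat_SeqI[OF sat_conseq[OF assms(1) order.refl] assms(3)]) (use assms(2) in blast)

lemma vertices: "pverts (digr I) = {..<n}" and q_pos: "0 < q" and src_less: "src I < n" and dst_less: "dst I < n"
  and n_pos: "0 < n"
  using wf by (auto simp: well_formed_def)

lemma in_nbrs_set: "v < n \<Longrightarrow> set (in_nbrs I v) = {u. (u, v) \<in> parcs (digr I)}"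
  and in_nbrs_distinct: "v < n \<Longrightarrow> distinct (in_nbrs I v)"
  using wf by (auto simp: well_formed_def)

lemma fin_digraph: "pair_fin_digraph (digr I)"
  using wf by (auto simp: well_formed_def)

lemma in_nbrs_less: "v < n \<Longrightarrow> e < length (in_nbrs I v) \<Longrightarrow> in_nbrs I v ! e < n"
proof -
  assume v: "v < n" and e: "e < length (in_nbrs I v)"
  interpret pair_fin_digraph "digr I" by (rule fin_digraph)
  have "in_nbrs I v ! e \<in> set (in_nbrs I v)" using e by simp
  then have "(in_nbrs I v ! e, v) \<in> parcs (digr I)" using in_nbrs_set[OF v] by simp
  from in_arcsD1[OF this] show ?thesis using vertices by simp
qed

lemma length_in_nbrs_le: "v < n \<Longrightarrow> length (in_nbrs I v) \<le> n"
proof -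
  assume v: "v < n"
  have "set (in_nbrs I v) \<subseteq> {..<n}" using in_nbrs_less[OF v] by (auto simp: in_set_conv_nth)
  from card_mono[OF _ this] show ?thesis using distinct_card[OF in_nbrs_distinct[OF v]] by simp
qed

lemma n_le_B: "n \<le> B" and N_pos: "0 < N"
  using big n_pos by (auto simp: nregs_def)

lemma indeg_le: "indeg I g \<le> n"
  using length_in_nbrs_le[of "g mod n"] n_pos by (auto simp: indeg_def)

text \<open>In-neighbours are read in the previous layer, hence at smaller indices: the order of
  updates is acyclic even if the graph is not.\<close>

lemma pred_reg_less_N:
  assumes "g < N" "e < indeg I g" shows "pred_reg I g e < g"
proof -
  have g: "n \<le> g" and e: "e < length (in_nbrs I (g mod n))"
    using assms by (auto simp: indeg_def split: if_splits)
  have "in_nbrs I (g mod n) ! e < n" using in_nbrs_less[OF _ e] n_pos by simp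
  moreover have "0 < g div n" using g n_pos by (simp add: div_greater_zero_iff)
  ultimately have "pred_reg I g e < (g div n) * n"
    by (cases "g div n") (auto simp: pred_reg_def)
  also have "\<dots> \<le> g" by simp
  finally show ?thesis .
qed

end

section \<open>Reading registers and summing over in-neighbours\<close>

abbreviation (input) "v_num c \<equiv> c"
abbreviation (input) "v_bits c \<equiv> c + 1"
abbreviation (input) "v_mod c \<equiv> c + 2"
abbreviation (input) "v_src c \<equiv> c + 3"
abbreviation (input) "v_run c \<equiv> c + 4"
abbreviation (input) "v_reg c \<equiv> c + 5"
abbreviation (input) "v_one c \<equiv> c + 6"
abbreviation (input) "v_zero c \<equiv> c + 7"
abbreviation (input) "v_layer c \<equiv> c + 8"
abbreviation (input) "v_vert c \<equiv> c + 9"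
abbreviation (input) "v_deg c \<equiv> c + 10"
abbreviation (input) "v_edge c \<equiv> c + 11"
abbreviation (input) "v_nbr c \<equiv> c + 12"
abbreviation (input) "v_idx c \<equiv> c + 13"
abbreviation (input) "v_sum c \<equiv> c + 14"
abbreviation (input) "v_pos c \<equiv> c + 15"
abbreviation (input) "v_addr c \<equiv> c + 16"
abbreviation (input) "v_bit c \<equiv> c + 17"
abbreviation (input) "v_res c \<equiv> c + 18"
abbreviation (input) "v_comp c \<equiv> c + 19"
abbreviation (input) "v_pow c \<equiv> c + 20"
abbreviation (input) "v_t c \<equiv> c + 21"
abbreviation (input) "v_t' c \<equiv> c + 22"

text \<open>
  One pass over the bits of a register \<open>x\<close>, most significant bit first, computes \<open>x mod q\<close>,
  \<open>2\<^sup>\<ell> mod q\<close> and \<open>min (2\<^sup>\<ell> - 1 - x) q\<close>. The register is valid iff the second number is at most the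
  third. The truncated difference \<open>y - (y - q)\<close> is \<open>min y q\<close>.
\<close>

definition scan_body :: "nat \<Rightarrow> instr list" where
  "scan_body c =
    [Arith Sub (v_pos c) (v_pos c) (v_one c),
     Arith Mul (v_addr c) (v_idx c) (v_bits c),
     Arith Add (v_addr c) (v_addr c) (v_pos c),
     Cat_Read (v_bit c) (v_addr c),
     Arith Add (v_res c) (v_res c) (v_res c),
     Arith Add (v_res c) (v_res c) (v_bit c),
     Arith Mod (v_res c) (v_res c) (v_mod c),
     Arith Add (v_comp c) (v_comp c) (v_comp c),
     Arith Add (v_comp c) (v_comp c) (v_one c),
     Arith Sub (v_comp c) (v_comp c) (v_bit c),
     Arith Sub (v_t c) (v_comp c) (v_mod c),
     Arith Sub (v_comp c) (v_comp c) (v_t c),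
     Arith Add (v_pow c) (v_pow c) (v_pow c),
     Arith Mod (v_pow c) (v_pow c) (v_mod c)]"

definition scan :: "nat \<Rightarrow> com" where
  "scan c = Seq
    (Block [Const (v_res c) 0, Const (v_comp c) 0, Const (v_pow c) 1,
            Arith Mod (v_pow c) (v_pow c) (v_mod c), Param (v_pos c) Reg_Bits])
    (While_Less (v_zero c) (v_pos c) (Block (scan_body c)))"

text \<open>With truncated subtraction, \<open>1 - (1 - layer)\<close> is 0 in layer 0 and 1
  elsewhere, so the last product suppresses the in-degree in layer 0.\<close>

definition prepare :: "nat \<Rightarrow> instr list" where
  "prepare c =
    [Arith Div (v_layer c) (v_reg c) (v_num c),
     Arith Mod (v_vert c) (v_reg c) (v_num c),
     In_Deg (v_t c) (v_vert c),
     Arith Sub (v_t' c) (v_one c) (v_layer c),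
     Arith Sub (v_t' c) (v_one c) (v_t' c),
     Arith Mul (v_deg c) (v_t c) (v_t' c)]"

definition gather_before :: "nat \<Rightarrow> instr list" where
  "gather_before c =
    [In_Nbr (v_nbr c) (v_vert c) (v_edge c),
     Arith Sub (v_idx c) (v_layer c) (v_one c),
     Arith Mul (v_idx c) (v_idx c) (v_num c),
     Arith Add (v_idx c) (v_idx c) (v_nbr c)]"

text \<open>With truncated subtraction, \<open>1 - ((x - y) + (y - x))\<close> is the truth value of \<open>x = y\<close>.\<close>

definition gather_after :: "nat \<Rightarrow> instr list" where
  "gather_after c =
    [Arith Add (v_sum c) (v_sum c) (v_res c),
     Arith Sub (v_t c) (v_nbr c) (v_src c),
     Arith Sub (v_t' c) (v_src c) (v_nbr c),
     Arith Add (v_t c) (v_t c) (v_t' c),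
     Arith Sub (v_t c) (v_one c) (v_t c),
     Arith Sub (v_t' c) (v_layer c) (v_one c),
     Arith Sub (v_t' c) (v_one c) (v_t' c),
     Arith Mul (v_t c) (v_t c) (v_t' c),
     Arith Mul (v_t c) (v_t c) (v_run c),
     Arith Add (v_sum c) (v_sum c) (v_t c),
     Arith Mod (v_sum c) (v_sum c) (v_mod c),
     Arith Add (v_edge c) (v_edge c) (v_one c)]"

text \<open>The final scan is of the register itself: its residue is needed for the later
  difference, and its validity, as a factor 0 or 1, switches the sum on or off.\<close>

definition gather :: "nat \<Rightarrow> com" where
  "gather c =
    Seq (Block [Const (v_sum c) 0, Const (v_edge c) 0])
   (Seq (While_Less (v_edge c) (v_deg c)
           (Seq (Block (gather_before c)) (Seq (scan c) (Block (gather_after c)))))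
   (Seq (Block [Arith Add (v_idx c) (v_reg c) (v_zero c)])
   (Seq (scan c)
        (Block [Arith Sub (v_t c) (v_pow c) (v_comp c),
                Arith Sub (v_t c) (v_one c) (v_t c),
                Arith Mul (v_sum c) (v_sum c) (v_t c)]))))"

section \<open>Correctness of the scan and of the sum over in-neighbours\<close>

context monitored
begin

definition consts_ok :: "nat \<Rightarrow> (nat \<Rightarrow> nat) \<Rightarrow> bool" where
  "consts_ok c w \<longleftrightarrow> w (v_num c) = n \<and> w (v_bits c) = l \<and> w (v_mod c) = q \<and> w (v_src c) = src I \<and>
     w (v_one c) = 1 \<and> w (v_zero c) = 0"

lemma scratch_cells:
  assumes "b \<le> c" "c + 23 \<le> K"
  shows "\<not> c < b" "c < K" "\<And>j. \<not> c + j < b" "\<And>j. j < 23 \<Longrightarrow> c + j < K"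
  using assms by auto

text \<open>\<open>k\<close> bits are still unread, so \<open>reg I m h div 2 ^ k\<close> is the
  prefix read so far, and \<open>v_comp\<close> holds its bitwise complement capped at
  \<open>q\<close>.\<close>

definition scan_inv where
  "scan_inv c w0 m h k w m' \<longleftrightarrow> m' = m \<and> (\<forall>x < c + 15. w x = w0 x) \<and> k \<le> l \<and> w (v_pos c) = k \<and>
     w (v_res c) = reg I m h div 2 ^ k mod q \<and>
     w (v_comp c) = min (2 ^ (l - k) - 1 - reg I m h div 2 ^ k) q \<and>
     w (v_pow c) = 2 ^ (l - k) mod q"

lemma scan_body_sat:
  assumes c: "b \<le> c" "c + 23 \<le> K" and cs: "consts_ok c w0" and h: "w0 (v_idx c) = h" "h < N"
    and m: "length m = N * l" and J: "J w m'" and inv: "scan_inv c w0 m h (Suc k) w m'"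
  shows "sat I J (Block (scan_body c)) 14 (scan_inv c w0 m h k) w m'"
proof -
  have [simp]: "w (v_num c) = n" "w (v_bits c) = l" "w (v_mod c) = q" "w (v_one c) = 1" "w (v_zero c) = 0" "w (v_idx c) = h"
    using inv cs h(1) by (auto simp: scan_inv_def consts_ok_def)
  have k: "k < l" and [simp]: "m' = m" using inv by (auto simp: scan_inv_def)
  define x where "x = reg I m h div 2 ^ Suc k"
  define \<beta> :: nat where "\<beta> = of_bool (m ! (h * l + k))"
  define y where "y = 2 ^ (l - Suc k) - 1 - x"
  define v where "v = min y q"
  have step: "reg I m h div 2 ^ k = 2 * x + \<beta>"
    unfolding x_def \<beta>_def by (rule reg_div_step[OF m h(2) k])
  have \<beta>: "\<beta> \<le> 1" by (simp add: \<beta>_def)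
  have "(2::nat) ^ (l - Suc k) * 2 ^ Suc k = 2 ^ l"
    using k by (simp only: power_add[symmetric]) simp
  then have "reg I m h < 2 ^ (l - Suc k) * 2 ^ Suc k" using reg_less[of I m h] by (simp only:)
  then have x: "x < 2 ^ (l - Suc k)" unfolding x_def by (rule less_mult_imp_div_less)
  have pow: "2 ^ (l - k) = 2 * (2::nat) ^ (l - Suc k)"
    using k by (metis Suc_diff_Suc power_Suc)
  \<comment> \<open>The complement of a prefix obeys the same Horner recursion, with the
    complemented bit.\<close>
  have y: "2 ^ (l - k) - 1 - (2 * x + \<beta>) = 2 * y + 1 - \<beta>"
    using x \<beta> unfolding pow y_def by linarith
  have [simp]: "w (v_pos c) = Suc k" "w (v_res c) = x mod q" "w (v_comp c) = v" "w (v_pow c) = 2 ^ (l - Suc k) mod q"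
    using inv unfolding scan_inv_def x_def y_def v_def by auto
  have old: "w z = w0 z" if "z < c + 15" for z using inv that by (auto simp: scan_inv_def)
  have a: "h * l + k < N * l" by (rule address_less[OF h(2) k])
  then have hl: "h * l \<le> B" "h * l + k \<le> B" "k \<le> B" using big k by - linarith+
  have qB: "4 * q + 4 \<le> B" using big by linarith
  have bit: "of_bool (h * l + k < length m \<and> m ! (h * l + k)) = \<beta>" using a m by (simp add: \<beta>_def)
  have xq: "x mod q < q" "(2::nat) ^ (l - Suc k) mod q < q" using q_pos by simp_all
  have r: "(x mod q + x mod q + \<beta>) mod q = (2 * x + \<beta>) mod q"
    unfolding mult_2 by (metis mod_add_eq mod_add_left_eq)
  have p: "((2::nat) ^ (l - Suc k) mod q + 2 ^ (l - Suc k) mod q) mod q = 2 ^ (l - k) mod q"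
    unfolding pow mult_2 by (rule mod_add_eq)
  have v: "v \<le> q" by (simp add: v_def)
  \<comment> \<open>Capping commutes with the doubling step: if \<open>y \<ge> q\<close>, both sides
    equal \<open>q\<close>.\<close>
  have cm: "v + v + 1 - \<beta> - (v + v + 1 - \<beta> - q) = min (2 * y + 1 - \<beta>) q"
    using \<beta> unfolding v_def min_def by (simp add: mult_2 split: if_splits) linarith?
  have b1: "v + v \<le> B" "v + v + 1 \<le> B" "v + v + 1 - \<beta> \<le> B" "v + v + 1 - \<beta> - q \<le> B"
    using qB v by simp_all
  have b2: "x mod q + x mod q \<le> B" "x mod q + x mod q + \<beta> \<le> B" "\<beta> \<le> B"
    "(2::nat) ^ (l - Suc k) mod q + 2 ^ (l - Suc k) mod q \<le> B"
    using qB xq \<beta> by - linarith+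
  have b3: "min (2 * y + 1 - \<beta>) q \<le> B" using qB by (simp add: min_def)
  have b4: "z mod q \<le> B" for z using mod_less_divisor[OF q_pos, of z] qB by linarith
  note c' = scratch_cells[OF c]
  show ?thesis
    supply [[linarith_split_limit = 0]]
    apply (rule sat_BlockI[OF J])
     apply (insert r p cm b1 b2 b3 y k)
     apply (simp add: scan_body_def c' hl b4 bit old step scan_inv_def
       del: One_nat_def add_2_eq_Suc add_2_eq_Suc')
    apply (simp add: scan_body_def)
    done
qed

lemma scan_sat:
  assumes c: "b \<le> c" "c + 23 \<le> K" and cs: "consts_ok c w" and h: "w (v_idx c) = h" "h < N"
    and m: "length m = N * l" and J: "J w m"
  shows "sat I J (scan c) (16 * l + 7)
    (\<lambda>w' m'. m' = m \<and> (\<forall>x < c + 15. w' x = w x) \<and> w' (v_res c) = reg I m h mod q \<and>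
       w' (v_comp c) = min (2 ^ l - 1 - reg I m h) q \<and> w' (v_pow c) = 2 ^ l mod q) w m"
    (is "sat I J _ _ ?Q w m")
proof -
  note c' = scratch_cells[OF c]
  have [simp]: "w (v_num c) = n" "w (v_bits c) = l" "w (v_mod c) = q" "w (v_one c) = 1" "w (v_zero c) = 0" "w (v_idx c) = h"
    using cs h(1) by (auto simp: consts_ok_def)
  have B: "l \<le> B" "1 \<le> B" "1 mod q \<le> B" using big mod_less_eq_dividend[of 1 q] by - linarith+
  have loop: "sat I J (While_Less (v_zero c) (v_pos c) (Block (scan_body c))) ((\<Sum>j<l. 14 + 2) + 2) ?Q w1 m1"
    if J1: "J w1 m1" and inv: "scan_inv c w m h l w1 m1" for w1 m1
  proof (rule sat_While[where Inv = "scan_inv c w m h" and tb = "\<lambda>_. 14"])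
    fix k w2 m2 assume *: "J w2 m2" "scan_inv c w m h (Suc k) w2 m2"
    have "w2 (v_zero c) < w2 (v_pos c)" using * by (simp add: scan_inv_def)
    with scan_body_sat[OF c cs h m *]
    show "w2 (v_zero c) < w2 (v_pos c) \<and> sat I J (Block (scan_body c)) 14 (scan_inv c w m h k) w2 m2" by blast
  next
    fix w2 m2 assume "J w2 m2" "scan_inv c w m h 0 w2 m2"
    then show "\<not> w2 (v_zero c) < w2 (v_pos c) \<and> ?Q w2 m2" by (simp add: scan_inv_def)
  qed (use that in auto)
  have 0: "reg I m h div 2 ^ l = 0" using reg_less by simp
  show ?thesis unfolding scan_def
  proof (rule sat_SeqI[where ta = 5 and tb = "16 * l + 2"])
    show "sat I J (Block [Const (v_res c) 0, Const (v_comp c) 0, Const (v_pow c) 1,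
            Arith Mod (v_pow c) (v_pow c) (v_mod c), Param (v_pos c) Reg_Bits]) 5
          (\<lambda>w1 m1. J w1 m1 \<longrightarrow> sat I J (While_Less (v_zero c) (v_pos c) (Block (scan_body c))) (16 * l + 2) ?Q w1 m1) w m"
      apply (rule sat_BlockI[OF J])
       apply (insert B)
       apply (simp add: c' del: One_nat_def add_2_eq_Suc add_2_eq_Suc')
       apply (intro impI sat_conseq[OF loop])
          apply (auto simp: scan_inv_def 0 simp del: add_2_eq_Suc add_2_eq_Suc')
      done
  qed simp
qed

lemma prepare_sat:
  assumes c: "b \<le> c" "c + 23 \<le> K" and cs: "consts_ok c w" and g: "w (v_reg c) = g" "g < N" and J: "J w m"
  shows "sat I J (Block (prepare c)) 6
    (\<lambda>w' m'. m' = m \<and> (\<forall>x < c + 8. w' x = w x) \<and> w' (v_layer c) = g div n \<and>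
       w' (v_vert c) = g mod n \<and> w' (v_deg c) = indeg I g) w m"
proof -
  note c' = scratch_cells[OF c]
  have [simp]: "w (v_num c) = n" "w (v_one c) = 1" "w (v_reg c) = g"
    using cs g(1) by (auto simp: consts_ok_def)
  have u: "g mod n < n" using n_pos by simp
  have le: "length (in_nbrs I (g mod n)) \<le> B" using length_in_nbrs_le[OF u] n_le_B by simp
  have B: "g \<le> B" "1 \<le> B" "2 \<le> B" using g(2) big by - linarith+
  have gB: "g div n \<le> B" "g mod n \<le> B" using B(1) div_le_dividend[of g n] mod_less_eq_dividend[of g n] by linarith+
  have d: "length (in_nbrs I (g mod n)) * (1 - (1 - g div n)) = indeg I g" (is "_ = ?d")
    using n_pos by (cases "g div n") (auto simp: indeg_def div_eq_0_iff)
  have dB: "?d \<le> B" using indeg_le n_le_B order.trans by blast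
  have B1: "1 - x \<le> B" "degree_query I (in_nbrs I) (g mod n) = length (in_nbrs I (g mod n))" for x
    using B u by (simp_all add: degree_query_def)
  show ?thesis
    using [[linarith_split_limit = 0]]
    by (rule sat_BlockI[OF J]) (simp_all add: prepare_def c' gB B1 le d dB del: One_nat_def add_2_eq_Suc add_2_eq_Suc')
qed

definition gather_inv where
  "gather_inv c w0 m \<rho> g k w m' \<longleftrightarrow> m' = m \<and> (\<forall>x < c + 11. w x = w0 x) \<and> k \<le> indeg I g \<and>
     w (v_edge c) = indeg I g - k \<and>
     w (v_sum c) = (\<Sum>e<indeg I g - k. reg I m (pred_reg I g e) + seed I \<rho> g e) mod q"

lemma gather_before_sat:
  assumes c: "b \<le> c" "c + 23 \<le> K" and cs: "consts_ok c w"
    and g: "g < N" "w (v_layer c) = g div n" "w (v_vert c) = g mod n"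
    and e: "w (v_edge c) = e" "e < indeg I g" and J: "J w m"
  shows "sat I J (Block (gather_before c)) 4
    (\<lambda>w' m'. m' = m \<and> (\<forall>x < c + 12. w' x = w x) \<and> w' (v_sum c) = w (v_sum c) \<and>
       w' (v_nbr c) = in_nbrs I (g mod n) ! e \<and> w' (v_idx c) = pred_reg I g e) w m"
proof -
  note c' = scratch_cells[OF c]
  have [simp]: "w (v_num c) = n" "w (v_one c) = 1" "w (v_layer c) = g div n" "w (v_vert c) = g mod n" "w (v_edge c) = e"
    using cs g e(1) by (auto simp: consts_ok_def)
  have u: "g mod n < n" using n_pos by simp
  have el: "e < length (in_nbrs I (g mod n))" using e(2) by (auto simp: indeg_def split: if_splits)
  have q: "neighbor_query I (in_nbrs I) (g mod n) e = in_nbrs I (g mod n) ! e"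
    using u el by (simp add: neighbor_query_def)
  have nb: "in_nbrs I (g mod n) ! e \<le> B" using in_nbrs_less[OF u el] n_le_B by simp
  have pr: "(g div n - 1) * n + in_nbrs I (g mod n) ! e = pred_reg I g e" (is "?a + _ = _") by (simp add: pred_reg_def)
  have prB: "pred_reg I g e \<le> B" using pred_reg_less_N[OF g(1) e(2)] g(1) big by linarith
  then have aB: "?a \<le> B" unfolding pr[symmetric] by simp
  have "g div n \<le> B" using div_le_dividend[of g n] g(1) big by linarith
  then have iB: "g div n - 1 \<le> B" by simp
  show ?thesis
    using [[linarith_split_limit = 0]]
    by (rule sat_BlockI[OF J]) (simp_all add: gather_before_def c' q nb pr prB aB iB del: One_nat_def add_2_eq_Suc add_2_eq_Suc')
qed

text \<open>The bound on \<open>\<rho>\<close> is 2 and not 1 because a query may come at the final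
  time \<open>4 * N\<close>, where \<open>phase_run\<close> is 2.\<close>

lemma gather_after_sat:
  assumes c: "b \<le> c" "c + 23 \<le> K" and cs: "consts_ok c w"
    and g: "g < N" "n \<le> g" "w (v_layer c) = g div n" "w (v_run c) = \<rho>" "\<rho> \<le> 2"
    and e: "w (v_edge c) = e" "e < n" "w (v_nbr c) = in_nbrs I (g mod n) ! e" "in_nbrs I (g mod n) ! e < n"
    and s: "w (v_sum c) = s mod q" "w (v_res c) = r mod q" and J: "J w m"
  shows "sat I J (Block (gather_after c)) 12
    (\<lambda>w' m'. m' = m \<and> (\<forall>x < c + 11. w' x = w x) \<and> w' (v_edge c) = Suc e \<and>
       w' (v_sum c) = (s + (r + seed I \<rho> g e)) mod q) w m"
proof -
  define v where "v = in_nbrs I (g mod n) ! e"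
  note c' = scratch_cells[OF c]
  have [simp]: "w (v_num c) = n" "w (v_one c) = 1" "w (v_mod c) = q" "w (v_src c) = src I"
    "w (v_layer c) = g div n" "w (v_edge c) = e" "w (v_nbr c) = v" "w (v_run c) = \<rho>"
    "w (v_sum c) = s mod q" "w (v_res c) = r mod q"
    using cs g e s by (auto simp: consts_ok_def v_def)
  have vB: "v - src I \<le> B" "src I - v \<le> B" "v - src I + (src I - v) \<le> B"
    using e(4) src_less n_le_B by (auto simp: v_def)
  have i: "0 < g div n" using g(2) n_pos by (simp add: div_greater_zero_iff)
  have "g div n \<le> B" using div_le_dividend[of g n] g(1) big by linarith
  then have iB: "g div n - 1 \<le> B" by simp
  have B: "1 \<le> B" "2 \<le> B" "Suc e \<le> B" using big e(2) n_le_B by - linarith+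
  have m: "x mod q < q" for x using q_pos by simp
  have qB: "8 * q + 16 \<le> B" using big by linarith
  have ind: "1 - (v - src I + (src I - v)) = of_bool (v = src I)" by auto
  have ind': "1 - (g div n - 1) = of_bool (g div n = 1)" using i by auto
  have sd: "of_bool (v = src I) * of_bool (g div n = 1) * \<rho> = seed I \<rho> g e" by (simp add: seed_def v_def)
  have sd2: "seed I \<rho> g e \<le> 2" using g(5) by (simp add: seed_def)
  have b: "s mod q + r mod q \<le> B" "s mod q + r mod q + seed I \<rho> g e \<le> B" "seed I \<rho> g e \<le> B"
    using qB m[of s] m[of r] sd2 by - linarith+
  have ob: "of_bool P \<le> B" "of_bool P * of_bool P' \<le> B" for P P' using B by simp_all
  have mB: "x mod q \<le> B" for x using qB m[of x] by linarith
  have md: "(s mod q + r mod q + seed I \<rho> g e) mod q = (s + (r + seed I \<rho> g e)) mod q"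
    unfolding add.assoc[symmetric] by (metis mod_add_eq mod_add_left_eq)
  show ?thesis
    using [[linarith_split_limit = 0]]
    by (rule sat_BlockI[OF J], simp_all add: gather_after_def c' vB iB B b ob mB ind ind' sd md del: One_nat_def add_2_eq_Suc add_2_eq_Suc' of_bool_eq_1_iff of_bool_conj)
      (use B(3) in simp)
qed

lemma gather_body_sat:
  assumes c: "b \<le> c" "c + 23 \<le> K" and cs: "consts_ok c w0"
    and g: "g < N" "w0 (v_layer c) = g div n" "w0 (v_vert c) = g mod n" "w0 (v_deg c) = indeg I g"
      "w0 (v_run c) = \<rho>" "\<rho> \<le> 2"
    and m: "length m = N * l" and J: "J w m'" and inv: "gather_inv c w0 m \<rho> g (Suc k) w m'"
  shows "sat I J (Seq (Block (gather_before c)) (Seq (scan c) (Block (gather_after c)))) (16 * l + 23)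
    (gather_inv c w0 m \<rho> g k) w m'"
proof -
  define e where "e = indeg I g - Suc k"
  have e: "e < indeg I g" "indeg I g - k = Suc e" and [simp]: "m' = m" using inv by (auto simp: gather_inv_def e_def)
  have ng: "n \<le> g" and el: "e < length (in_nbrs I (g mod n))" using e(1) by (auto simp: indeg_def split: if_splits)
  have en: "e < n" using e(1) indeg_le[of g] by linarith
  have nb: "in_nbrs I (g mod n) ! e < n" using in_nbrs_less[OF _ el] n_pos by simp
  have pN: "pred_reg I g e < N" using pred_reg_less_N[OF g(1) e(1)] g(1) by linarith
  have cs1: "consts_ok c w" using cs inv by (auto simp: gather_inv_def consts_ok_def)
  have w: "w (v_layer c) = g div n" "w (v_vert c) = g mod n" "w (v_edge c) = e"
    using inv g by (auto simp: gather_inv_def e_def)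
  show ?thesis
  proof (rule sat_SeqI[where ta = 4 and tb = "16 * l + 19"])
    show "sat I J (Block (gather_before c)) 4 (\<lambda>v k'. J v k' \<longrightarrow>
       sat I J (Seq (scan c) (Block (gather_after c))) (16 * l + 19) (gather_inv c w0 m \<rho> g k) v k') w m'"
    proof (rule sat_conseq[OF gather_before_sat[OF c cs1 g(1) w e(1) J] order.refl], intro impI)
      fix w1 m1 assume J1: "J w1 m1" and *: "m1 = m' \<and> (\<forall>x<c + 12. w1 x = w x) \<and> w1 (v_sum c) = w (v_sum c) \<and>
        w1 (v_nbr c) = in_nbrs I (g mod n) ! e \<and> w1 (v_idx c) = pred_reg I g e"
      have cs2: "consts_ok c w1" using cs1 * by (auto simp: consts_ok_def)
      have m1: "length m1 = N * l" using * m by simp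
      have i1: "w1 (v_idx c) = pred_reg I g e" using * by blast
      show "sat I J (Seq (scan c) (Block (gather_after c))) (16 * l + 19) (gather_inv c w0 m \<rho> g k) w1 m1"
      proof (rule sat_SeqI[where ta = "16 * l + 7" and tb = 12])
        show "sat I J (scan c) (16 * l + 7) (\<lambda>v k'. J v k' \<longrightarrow>
          sat I J (Block (gather_after c)) 12 (gather_inv c w0 m \<rho> g k) v k') w1 m1"
        proof (rule sat_conseq[OF scan_sat[OF c cs2 i1 pN m1 J1] order.refl], intro impI)
          fix w2 m2 assume J2: "J w2 m2" and **: "m2 = m1 \<and> (\<forall>x<c + 15. w2 x = w1 x) \<and>
            w2 (v_res c) = reg I m1 (pred_reg I g e) mod q \<and>
            w2 (v_comp c) = min (2 ^ l - 1 - reg I m1 (pred_reg I g e)) q \<and> w2 (v_pow c) = 2 ^ l mod q"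
          have cs3: "consts_ok c w2" using cs2 ** by (auto simp: consts_ok_def)
          have "w2 x = w0 x" if "x < c + 11" for x using that * ** inv by (simp add: gather_inv_def)
          then have o: "\<forall>x<c + 11. w2 x = w0 x" by simp
          have A: "w2 (v_layer c) = g div n" "w2 (v_run c) = \<rho>" using o g by simp_all
          have A2: "w2 (v_edge c) = e" "w2 (v_nbr c) = in_nbrs I (g mod n) ! e" using * ** w(3) by simp_all
          have A3: "w2 (v_sum c) = (\<Sum>e<e. reg I m (pred_reg I g e) + seed I \<rho> g e) mod q"
            "w2 (v_res c) = reg I m (pred_reg I g e) mod q"
            using * ** inv by (simp_all add: gather_inv_def e_def)
          show "sat I J (Block (gather_after c)) 12 (gather_inv c w0 m \<rho> g k) w2 m2"
            apply (rule sat_conseq[OF gather_after_sat[OF c cs3 g(1) ng A g(6) A2(1) en A2(2) nb A3 J2] order.refl])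
            using * ** o e inv by (simp add: gather_inv_def)
        qed
      qed simp
    qed
  qed simp
qed

text \<open>\<open>2 ^ l mod q\<close> is less than \<open>q\<close>, so capping the other side at
  \<open>q\<close> does not change the comparison, and truncated subtraction turns it into a test
  for 0.\<close>

lemma is_valid_min: "is_valid I x \<longleftrightarrow> 2 ^ l mod q - min (2 ^ l - 1 - x) q = 0"
  using mod_less_divisor[OF q_pos, of "2 ^ l"] by (auto simp: is_valid_def)

lemma gather_final_sat:
  assumes c: "b \<le> c" "c + 23 \<le> K" and cs: "consts_ok c w"
    and w: "w (v_comp c) = min (2 ^ l - 1 - x) q" "w (v_pow c) = 2 ^ l mod q" "w (v_sum c) = s mod q"
    and J: "J w m"
  shows "sat I J (Block [Arith Sub (v_t c) (v_pow c) (v_comp c),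
                Arith Sub (v_t c) (v_one c) (v_t c),
                Arith Mul (v_sum c) (v_sum c) (v_t c)]) 3
    (\<lambda>w' m'. m' = m \<and> (\<forall>x < c + 11. w' x = w x) \<and> w' (v_res c) = w (v_res c) \<and>
       w' (v_sum c) = of_bool (is_valid I x) * (s mod q)) w m"
proof -
  note c' = scratch_cells[OF c]
  define pw where "pw = 2 ^ l mod q"
  define cm where "cm = min (2 ^ l - 1 - x) q"
  define t where "t = pw - cm"
  have t: "1 - t = of_bool (is_valid I x)"
    unfolding is_valid_min t_def pw_def[symmetric] cm_def[symmetric] by auto
  have w': "w (v_comp c) = cm" "w (v_pow c) = pw" using w by (simp_all add: pw_def cm_def)
  have [simp]: "w (v_one c) = 1" using cs by (auto simp: consts_ok_def)
  have B: "z mod q \<le> B" for z using mod_less_divisor[OF q_pos, of z] big by linarith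
  have B1: "1 \<le> B" using big by linarith
  have tB: "t \<le> B" using B[of "2 ^ l"] by (simp add: t_def pw_def)
  have ob: "of_bool P \<le> B" "of_bool P * (s mod q) \<le> B" "(s mod q) * of_bool P \<le> B" for P using B B1 by simp_all
  show ?thesis
    supply [[linarith_split_limit = 0]]
    apply (rule sat_BlockI[OF J])
     apply (simp only: wp.simps wp_instr.simps)
     apply (simp add: c' w(3) w' t_def[symmetric] tB B ob t del: One_nat_def add_2_eq_Suc add_2_eq_Suc')
    apply simp
    done
qed

lemma gather_sat:
  assumes c: "b \<le> c" "c + 23 \<le> K" and cs: "consts_ok c w"
    and g: "w (v_reg c) = g" "g < N" "w (v_layer c) = g div n" "w (v_vert c) = g mod n" "w (v_deg c) = indeg I g"
      "w (v_run c) = \<rho>" "\<rho> \<le> 2"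
    and m: "length m = N * l" and J: "J w m"
  shows "sat I J (gather c) ((indeg I g + 1) * (16 * l + 25))
    (\<lambda>w' m'. m' = m \<and> (\<forall>x < c + 11. w' x = w x) \<and> w' (v_res c) = reg I m g mod q \<and>
       w' (v_sum c) = increment I \<rho> (reg I m) g) w m"
    (is "sat I J _ _ ?Q w m")
proof -
  note c' = scratch_cells[OF c]
  let ?C3 = "Block [Arith Sub (v_t c) (v_pow c) (v_comp c), Arith Sub (v_t c) (v_one c) (v_t c),
                Arith Mul (v_sum c) (v_sum c) (v_t c)]"
  let ?C1 = "Seq (Block [Arith Add (v_idx c) (v_reg c) (v_zero c)]) (Seq (scan c) ?C3)"
  let ?W = "While_Less (v_edge c) (v_deg c)
           (Seq (Block (gather_before c)) (Seq (scan c) (Block (gather_after c))))"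
  have fin: "sat I J (Seq (scan c) ?C3) (16 * l + 10) ?Q w1 m1"
    if J1: "J w1 m1" and *: "m1 = m" "\<forall>x<c + 11. w1 x = w x" "w1 (v_idx c) = g" "w1 (v_sum c) = insum I \<rho> (reg I m) g mod q" for w1 m1
  proof (rule sat_SeqI[where ta = "16 * l + 7" and tb = 3])
    have cs1: "consts_ok c w1" using cs *(2) by (auto simp: consts_ok_def)
    have m1: "length m1 = N * l" using *(1) m by simp
    show "sat I J (scan c) (16 * l + 7) (\<lambda>w m. J w m \<longrightarrow> sat I J ?C3 3 ?Q w m) w1 m1"
    proof (rule sat_conseq[OF scan_sat[OF c cs1 *(3) g(2) m1 J1] order.refl], intro impI)
      fix w2 m2 assume J2: "J w2 m2" and **: "m2 = m1 \<and> (\<forall>x<c + 15. w2 x = w1 x) \<and>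
          w2 (v_res c) = reg I m1 g mod q \<and>
          w2 (v_comp c) = min (2 ^ l - 1 - reg I m1 g) q \<and> w2 (v_pow c) = 2 ^ l mod q"
      have cs2: "consts_ok c w2" using cs1 ** by (auto simp: consts_ok_def)
      have A: "w2 (v_comp c) = min (2 ^ l - 1 - reg I m1 g) q" "w2 (v_pow c) = 2 ^ l mod q"
        "w2 (v_sum c) = insum I \<rho> (reg I m) g mod q" using * ** by simp_all
      show "sat I J ?C3 3 ?Q w2 m2"
        by (rule sat_conseq[OF gather_final_sat[OF c cs2 A J2] order.refl])
           (use * ** in \<open>simp add: increment_def\<close>)
    qed
  qed simp
  have after: "sat I J ?C1 (16 * l + 11) ?Q w1 m1" if J1: "J w1 m1" and inv: "gather_inv c w m \<rho> g 0 w1 m1" for w1 m1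
  proof (rule sat_SeqI[where ta = 1 and tb = "16 * l + 10"])
    have w1: "w1 (v_reg c) = g" "w1 (v_zero c) = 0" "g \<le> B" using inv g cs J1 big
      by (auto simp: gather_inv_def consts_ok_def)
    show "sat I J (Block [Arith Add (v_idx c) (v_reg c) (v_zero c)]) 1
       (\<lambda>w m. J w m \<longrightarrow> sat I J (Seq (scan c) ?C3) (16 * l + 10) ?Q w m) w1 m1"
      apply (rule sat_BlockI[OF J1])
       apply (simp add: c' w1)
       apply (intro impI fin)
      using inv by (auto simp: gather_inv_def insum_def)
  qed simp
  have loop: "sat I J ?W (indeg I g * (16 * l + 25) + 2) (gather_inv c w m \<rho> g 0) w1 m1"
    if J1: "J w1 m1" and inv: "gather_inv c w m \<rho> g (indeg I g) w1 m1" for w1 m1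
  proof -
    have "sat I J ?W ((\<Sum>j<indeg I g. (16 * l + 23) + 2) + 2) (gather_inv c w m \<rho> g 0) w1 m1"
    proof (rule sat_While[where Inv = "gather_inv c w m \<rho> g" and tb = "\<lambda>_. 16 * l + 23"])
      fix k w2 m2 assume *: "J w2 m2" "gather_inv c w m \<rho> g (Suc k) w2 m2"
      have "w2 (v_edge c) < w2 (v_deg c)" using *(2) g by (auto simp: gather_inv_def)
      with gather_body_sat[OF c cs g(2-7) m *]
      show "w2 (v_edge c) < w2 (v_deg c) \<and> sat I J (Seq (Block (gather_before c)) (Seq (scan c) (Block (gather_after c))))
         (16 * l + 23) (gather_inv c w m \<rho> g k) w2 m2" by blast
    next
      fix w2 m2 assume "J w2 m2" "gather_inv c w m \<rho> g 0 w2 m2"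
      then show "\<not> w2 (v_edge c) < w2 (v_deg c) \<and> gather_inv c w m \<rho> g 0 w2 m2" using g by (auto simp: gather_inv_def)
    qed (use that in auto)
    then show ?thesis by (rule sat_conseq) auto
  qed
  show ?thesis unfolding gather_def
  \<comment> \<open>What happens outside the loop costs less than one more round, which the factor
    \<open>indeg I g + 1\<close> absorbs.\<close>
  proof (rule sat_SeqI[where ta = 2 and tb = "(indeg I g * (16 * l + 25) + 2) + (16 * l + 11)"])
    show "sat I J (Block [Const (v_sum c) 0, Const (v_edge c) 0]) 2
      (\<lambda>w m. J w m \<longrightarrow> sat I J (Seq ?W ?C1) ((indeg I g * (16 * l + 25) + 2) + (16 * l + 11)) ?Q w m) w m"
      apply (rule sat_BlockI[OF J])
       apply (simp add: c' del: One_nat_def add_2_eq_Suc add_2_eq_Suc')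
       apply (rule impI)
       apply (rule sat_SeqI[where ta = "indeg I g * (16 * l + 25) + 2" and tb = "16 * l + 11"])
        apply (rule sat_conseq[OF loop order.refl])
          apply assumption
         apply (simp add: gather_inv_def)
        apply (rule impI)
        apply (erule after)
        apply assumption
       apply simp
      apply simp
      done
  qed simp
qed

end

section \<open>Shifted registers\<close>

text \<open>Rotation by \<open>a\<close> within the block of length \<open>modulus I\<close> that
  contains \<open>x\<close>.\<close>

definition shift :: "problem \<Rightarrow> nat \<Rightarrow> nat \<Rightarrow> nat" where
  "shift I x a = modulus I * (x div modulus I) + (x mod modulus I + a) mod modulus I"

text \<open>Recursion over layers makes the definition primitive; \<open>shifted_eq\<close> recovers
  the recursion over register indices that is actually used.\<close>

primrec layer_val :: "problem \<Rightarrow> bool list \<Rightarrow> nat \<Rightarrow> nat \<Rightarrow> nat \<Rightarrow> nat" where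
  "layer_val I \<tau> \<rho> 0 u = reg I \<tau> u"
| "layer_val I \<tau> \<rho> (Suc i) u =
     (let g = Suc i * num_verts I + u in
      shift I (reg I \<tau> g)
        (of_bool (is_valid I (reg I \<tau> g)) *
         ((\<Sum>e<indeg I g. layer_val I \<tau> \<rho> i (in_nbrs I u ! e) + seed I \<rho> g e) mod modulus I)))"

definition shifted :: "problem \<Rightarrow> bool list \<Rightarrow> nat \<Rightarrow> nat \<Rightarrow> nat" where
  "shifted I \<tau> \<rho> g = layer_val I \<tau> \<rho> (g div num_verts I) (g mod num_verts I)"

section \<open>Shifts, their inverses and the invariance of validity\<close>

context monitored
begin

text \<open>Shows that validity depends only on the quotient by \<open>q\<close>, which shifting
  preserves.\<close>

lemma is_valid_iff: "x < 2 ^ l \<Longrightarrow> is_valid I x \<longleftrightarrow> x div q < 2 ^ l div q"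
proof -
  assume x: "x < 2 ^ l"
  have "q * (2 ^ l div q) + 2 ^ l mod q = 2 ^ l" by simp
  then have "is_valid I x \<longleftrightarrow> x < 2 ^ l div q * q"
    using x unfolding is_valid_def mult.commute[of "2 ^ l div q"] by (intro iffI) linarith+
  then show ?thesis using q_pos by (simp add: div_less_iff_less_mult)
qed

lemma valid_for_iff: "x < 2 ^ l \<Longrightarrow> valid_for l q x \<longleftrightarrow> is_valid I x"
proof -
  assume x: "x < 2 ^ l"
  have "(GREATEST d. q * d \<le> 2 ^ l) = 2 ^ l div q"
    by (rule Greatest_equality) (use q_pos in \<open>auto simp: less_eq_div_iff_mult_less_eq mult.commute\<close>)
  then show ?thesis using q_pos
    by (simp add: valid_for_def is_valid_iff[OF x] div_less_iff_less_mult mult.commute)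
qed

lemma shift_0 [simp]: "shift I x 0 = x"
  by (simp add: shift_def)

lemma shift_div: "shift I x a div q = x div q"
  using q_pos by (simp add: shift_def)

lemma shift_mod: "shift I x a mod q = (x mod q + a) mod q"
  by (simp add: shift_def)

lemma int_shift: "int (shift I x a) = int x - int (x mod q) + int ((x mod q + a) mod q)"
proof -
  have "int x = int (q * (x div q) + x mod q)" by simp
  then show ?thesis by (simp only: shift_def of_nat_add)
qed

lemma shift_less:
  assumes "x < 2 ^ l" "is_valid I x \<or> a = 0"
  shows "shift I x a < 2 ^ l"
proof (cases "is_valid I x")
  case True
  then have v: "Suc (x div q) \<le> 2 ^ l div q" using is_valid_iff[OF assms(1)] by simp
  have "shift I x a < q * Suc (x div q)" using mod_less_divisor[OF q_pos] by (simp add: shift_def)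
  also have "\<dots> \<le> q * (2 ^ l div q)" using v by (rule mult_le_mono2)
  also have "\<dots> \<le> 2 ^ l" by simp
  finally show ?thesis .
qed (use assms in auto)

text \<open>A further rotation by \<open>q - a\<close> completes a full turn of the block, also for
  \<open>a = 0\<close>.\<close>

lemma unshift_shift: "a < q \<Longrightarrow> shift I (shift I x a) (q - a) = x"
proof -
  assume a: "a < q"
  have "((x mod q + a) mod q + (q - a)) mod q = (x mod q + a + (q - a)) mod q"
    by (rule mod_add_left_eq)
  also have "\<dots> = x mod q" using a by simp
  finally have "shift I (shift I x a) (q - a) = q * (x div q) + x mod q"
    by (simp add: shift_def[of I _ "q - a"] shift_div shift_mod)
  then show ?thesis by simp
qed

lemma is_valid_shift: "x < 2 ^ l \<Longrightarrow> is_valid I x \<or> a = 0 \<Longrightarrow> is_valid I (shift I x a) \<longleftrightarrow> is_valid I x"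
  using shift_less[of x a] by (simp add: is_valid_iff shift_div)

abbreviation S where "S \<tau> \<rho> \<equiv> shifted I \<tau> \<rho>"

lemma insum_cong: "(\<And>e. e < indeg I g \<Longrightarrow> V (pred_reg I g e) = V' (pred_reg I g e)) \<Longrightarrow> insum I \<rho> V g = insum I \<rho> V' g"
  by (auto simp: insum_def intro!: sum.cong)

lemma shifted_eq: 
  "S \<tau> \<rho> g = shift I (reg I \<tau> g) (of_bool (is_valid I (reg I \<tau> g)) * (insum I \<rho> (S \<tau> \<rho>) g mod q))"
proof (cases "g div n")
  case 0
  then have "indeg I g = 0" "g mod n = g" using n_pos by (auto simp: div_eq_0_iff indeg_def)
  with 0 show ?thesis by (simp add: shifted_def insum_def)
next
  case (Suc i)
  have g: "Suc i * n + g mod n = g" using Suc[symmetric] by simp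
  have "S \<tau> \<rho> (pred_reg I g e) = layer_val I \<tau> \<rho> i (in_nbrs I (g mod n) ! e)" if "e < indeg I g" for e
  proof -
    have "in_nbrs I (g mod n) ! e < n" using in_nbrs_less[of "g mod n" e] that n_pos by (auto simp: indeg_def split: if_splits)
    then show ?thesis using Suc by (simp add: shifted_def pred_reg_def)
  qed
  then have "insum I \<rho> (S \<tau> \<rho>) g = (\<Sum>e<indeg I g. layer_val I \<tau> \<rho> i (in_nbrs I (g mod n) ! e) + seed I \<rho> g e)"
    by (simp add: insum_def)
  then show ?thesis unfolding shifted_def[of I \<tau> \<rho> g] Suc layer_val.simps Let_def g by simp
qed

lemma shifted_less: "S \<tau> \<rho> g < 2 ^ l"
  by (subst shifted_eq) (auto intro!: shift_less reg_less)

lemma is_valid_shifted: "is_valid I (S \<tau> \<rho> g) \<longleftrightarrow> is_valid I (reg I \<tau> g)"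
  by (subst shifted_eq, rule is_valid_shift[OF reg_less]) auto

lemma increment_less: "increment I \<rho> V g < q"
  using q_pos by (simp add: increment_def)

text \<open>Whether register \<open>g\<close> is still original or already shifted, the same
  increment is computed: its in-neighbours are shifted in both cases and validity is invariant.
  Hence the amount that was added can be recomputed when it has to be removed, by the main program
  or by a query.\<close>

lemma increment_eq:
  assumes "\<And>e. e < indeg I g \<Longrightarrow> V (pred_reg I g e) = S \<tau> \<rho> (pred_reg I g e)"
    and "V g = reg I \<tau> g \<or> V g = S \<tau> \<rho> g"
  shows "increment I \<rho> V g = of_bool (is_valid I (reg I \<tau> g)) * (insum I \<rho> (S \<tau> \<rho>) g mod q)"
  using assms is_valid_shifted[of \<tau> \<rho> g] insum_cong[of g V "S \<tau> \<rho>" \<rho>] by (auto simp: increment_def)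

lemma shift_increment:
  assumes "\<And>e. e < indeg I g \<Longrightarrow> V (pred_reg I g e) = S \<tau> \<rho> (pred_reg I g e)" "V g = reg I \<tau> g"
  shows "shift I (V g) (increment I \<rho> V g) = S \<tau> \<rho> g"
  using increment_eq[of g V \<tau> \<rho>] assms shifted_eq[of \<tau> \<rho> g] by auto

lemma unshift_increment:
  assumes "\<And>e. e < indeg I g \<Longrightarrow> V (pred_reg I g e) = S \<tau> \<rho> (pred_reg I g e)" "V g = S \<tau> \<rho> g"
  shows "shift I (V g) (q - increment I \<rho> V g) = reg I \<tau> g"
proof -
  have i: "increment I \<rho> V g = of_bool (is_valid I (reg I \<tau> g)) * (insum I \<rho> (S \<tau> \<rho>) g mod q)"
    using increment_eq[of g V \<tau> \<rho>] assms by auto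
  have "shift I (shift I (reg I \<tau> g) (increment I \<rho> V g)) (q - increment I \<rho> V g) = reg I \<tau> g"
    by (rule unshift_shift[OF increment_less])
  moreover have "shift I (reg I \<tau> g) (increment I \<rho> V g) = V g"
    unfolding i assms(2) by (rule shifted_eq[symmetric])
  ultimately show ?thesis by simp
qed

lemma shifted_indeg_0: "indeg I g = 0 \<Longrightarrow> S \<tau> \<rho> g = reg I \<tau> g"
  by (subst shifted_eq) (simp add: insum_def)

end

section \<open>A register in the course of being written\<close>

text \<open>
  A difference is added to register \<open>g\<close> bit by bit, least significant bit first. Bits below \<open>p\<close> are
  done and the carry \<open>c - q\<close> is due at position \<open>p\<close>. While \<open>p' \<noteq> p\<close>, the bit at
  position \<open>p\<close> is in transition and \<open>s - 2 q\<close> takes the place of the bit and the carry. The offsets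
  keep the cells nonnegative.
\<close>

definition virtual :: "problem \<Rightarrow> bool list \<Rightarrow> nat \<Rightarrow> nat \<Rightarrow> nat \<Rightarrow> nat \<Rightarrow> nat \<Rightarrow> int" where
  "virtual I m g p p' c s = int (reg I m g) +
     (if p < reg_bits I then
        (if p' \<noteq> p then int s - 2 * int (modulus I) - of_bool (m ! (g * reg_bits I + p))
         else int c - int (modulus I)) * 2 ^ p
      else 0)"

text \<open>A congruence is enough and lets the carry out of the top bit be dropped.
  \<open>d - modulus I\<close> is the excess of the completed register over the original
  \<open>x\<close>: zero when undoing, the added difference when shifting. The bounds on
  \<open>c\<close>, \<open>d\<close> and \<open>s\<close> keep the cells small.\<close>

definition in_flux :: "problem \<Rightarrow> bool list \<Rightarrow> nat \<Rightarrow> nat \<Rightarrow> nat \<Rightarrow> nat \<Rightarrow> nat \<Rightarrow> nat \<Rightarrow> nat \<Rightarrow> bool" where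
  "in_flux I m g p p' c s d x \<longleftrightarrow>
     2 ^ reg_bits I dvd virtual I m g p p' c s - (int d - int (modulus I)) - int x \<and>
     (p' = p \<or> p' = Suc p \<and> p < reg_bits I \<and> s \<le> 3 * modulus I + 1) \<and>
     c \<le> 2 * modulus I \<and> d \<le> 2 * modulus I"

lemma reg_update:
  assumes m: "length m = nregs I * reg_bits I" and g: "g < nregs I" and p: "p < reg_bits I"
  shows "int (reg I (m[g * reg_bits I + p := v]) g) =
    int (reg I m g) + (of_bool v - of_bool (m ! (g * reg_bits I + p))) * 2 ^ p"
proof -
  let ?b = "g * reg_bits I"
  let ?m = "m[?b + p := v]"
  have "int (reg I ?m g) = (\<Sum>k<reg_bits I. of_bool (?m ! (?b + k)) * 2 ^ k)"
    using reg_eq_sum[of ?m I g] m g by simp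
  also have "\<dots> = of_bool v * 2 ^ p + (\<Sum>k\<in>{..<reg_bits I} - {p}. of_bool (m ! (?b + k)) * 2 ^ k)"
    using p address_less[OF g p] m by (subst sum.remove[of _ p]) (auto intro!: sum.cong)
  finally have 1: "int (reg I ?m g) = \<dots>" .
  have "int (reg I m g) = (\<Sum>k<reg_bits I. of_bool (m ! (?b + k)) * 2 ^ k)"
    using reg_eq_sum[of m I g] m g by simp
  also have "\<dots> = of_bool (m ! (?b + p)) * 2 ^ p + (\<Sum>k\<in>{..<reg_bits I} - {p}. of_bool (m ! (?b + k)) * 2 ^ k)"
    using p by (subst sum.remove[of _ p]) auto
  finally show ?thesis using 1 by (simp add: algebra_simps)
qed

lemma in_flux_start:
  assumes "0 < reg_bits I" "c \<le> 2 * modulus I" "d \<le> 2 * modulus I"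
    "int (reg I m g) + int c - int d = int x"
  shows "in_flux I m g 0 0 c s d x"
proof -
  have "virtual I m g 0 0 c s - (int d - int (modulus I)) - int x = 0"
    using assms(1,4) by (simp add: virtual_def)
  then show ?thesis using assms(2,3) by (simp add: in_flux_def)
qed

lemma in_flux_s: "in_flux I m g p p c s d x \<Longrightarrow> in_flux I m g p p c s' d x"
proof -
  have "virtual I m g p p c s' = virtual I m g p p c s" by (simp add: virtual_def)
  then show "in_flux I m g p p c s d x \<Longrightarrow> in_flux I m g p p c s' d x" by (simp add: in_flux_def)
qed

text \<open>The new \<open>s\<close> is bit plus carry with offset \<open>2 * modulus I\<close>, so
  the value is merely transferred from the tape bit and the carry cell to \<open>s\<close>.\<close>

lemma in_flux_enter:
  assumes "in_flux I m g p p c s d x" "p < reg_bits I"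
  shows "in_flux I m g p (Suc p) c (of_bool (m ! (g * reg_bits I + p)) + c + modulus I) d x"
proof -
  have "virtual I m g p (Suc p) c (of_bool (m ! (g * reg_bits I + p)) + c + modulus I) = virtual I m g p p c s"
    using assms(2) by (simp add: virtual_def)
  then show ?thesis using assms by (auto simp: in_flux_def)
qed

text \<open>In transition \<open>virtual\<close> subtracts the tape bit at \<open>p\<close> again,
  so its content is irrelevant; \<open>in_flux_c\<close> expresses the same for the carry
  cell.\<close>

lemma in_flux_write:
  assumes "in_flux I m g p (Suc p) c s d x" and m: "length m = nregs I * reg_bits I" "g < nregs I"
  shows "in_flux I (m[g * reg_bits I + p := v]) g p (Suc p) c s d x"
proof -
  have p: "p < reg_bits I" using assms(1) by (simp add: in_flux_def)
  have "virtual I (m[g * reg_bits I + p := v]) g p (Suc p) c s = virtual I m g p (Suc p) c s"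
    using p reg_update[OF m p, of v] address_less[OF m(2) p] m(1) by (simp add: virtual_def algebra_simps)
  then show ?thesis using assms(1) by (simp add: in_flux_def)
qed

lemma in_flux_c: "in_flux I m g p (Suc p) c s d x \<Longrightarrow> c' \<le> 2 * modulus I \<Longrightarrow> in_flux I m g p (Suc p) c' s d x"
proof -
  have "p < reg_bits I \<Longrightarrow> virtual I m g p (Suc p) c' s = virtual I m g p (Suc p) c s" by (simp add: virtual_def)
  then show "in_flux I m g p (Suc p) c s d x \<Longrightarrow> c' \<le> 2 * modulus I \<Longrightarrow> in_flux I m g p (Suc p) c' s d x"
    by (auto simp: in_flux_def)
qed

text \<open>The offset \<open>2 * modulus I\<close> of \<open>s\<close> is even: it does not affect
  the bit to be written, and halving turns it into the offset \<open>modulus I\<close> of the next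
  carry.\<close>

lemma in_flux_leave:
  assumes "in_flux I m g p (Suc p) c' s d x" "m ! (g * reg_bits I + p) \<longleftrightarrow> odd s" "c = s div 2" "c \<le> 2 * modulus I"
  shows "in_flux I m g (Suc p) (Suc p) c s d x"
proof -
  have p: "p < reg_bits I" using assms(1) by (simp add: in_flux_def)
  have "int s = 2 * int (s div 2) + of_bool (odd s)" by (cases "odd s") (auto elim!: oddE evenE)
  then have "(int s - 2 * int (modulus I) - of_bool (odd s)) * 2 ^ p = (int c - int (modulus I)) * 2 ^ Suc p"
    by (simp add: assms(3) algebra_simps)
  then have v: "virtual I m g p (Suc p) c' s = int (reg I m g) + (int c - int (modulus I)) * 2 ^ Suc p"
    using p assms(2) by (simp add: virtual_def)
  show ?thesis
  proof (cases "Suc p < reg_bits I")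
    case True
    then have "virtual I m g (Suc p) (Suc p) c s = virtual I m g p (Suc p) c' s" unfolding v by (simp add: virtual_def)
    then show ?thesis using assms(1,4) by (simp add: in_flux_def)
  next
    \<comment> \<open>At the top position the carry has weight \<open>2 ^ reg_bits I\<close> and
      vanishes in the congruence.\<close>
    case False
    then have l: "reg_bits I = Suc p" using p by simp
    have eq: "virtual I m g (Suc p) (Suc p) c s - (int d - int (modulus I)) - int x =
      virtual I m g p (Suc p) c' s - (int d - int (modulus I)) - int x - 2 ^ reg_bits I * (int c - int (modulus I))"
      unfolding v using l by (simp add: virtual_def)
    have "2 ^ reg_bits I dvd virtual I m g (Suc p) (Suc p) c s - (int d - int (modulus I)) - int x"
      unfolding eq using assms(1) unfolding in_flux_def by (intro dvd_diff[OF _ dvd_triv_left]) blast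
    then show ?thesis using assms(4) assms(1) by (simp add: in_flux_def)
  qed
qed

text \<open>Both numbers are below \<open>2 ^ reg_bits I\<close>, so the congruence becomes an
  equality. This is why the target value has to fit into the register.\<close>

lemma in_flux_finish:
  assumes "in_flux I m g (reg_bits I) p' c s d x" "int y = int x + int d - int (modulus I)" "y < 2 ^ reg_bits I"
  shows "reg I m g = y"
proof -
  have "virtual I m g (reg_bits I) p' c s - (int d - int (modulus I)) - int x = int (reg I m g) - int y"
    using assms(2) by (simp add: virtual_def)
  then have "2 ^ reg_bits I dvd int (reg I m g) - int y" using assms(1) by (simp add: in_flux_def)
  then have "int (reg I m g) mod 2 ^ reg_bits I = int y mod 2 ^ reg_bits I" by (rule mod_eq_dvd_iff[THEN iffD2])
  then have "int (reg I m g) mod int (2 ^ reg_bits I) = int y mod int (2 ^ reg_bits I)" by simp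
  then have "reg I m g mod 2 ^ reg_bits I = y mod 2 ^ reg_bits I" by (simp only: zmod_int[symmetric] of_nat_eq_iff)
  then show ?thesis using reg_less[of I m g] assms(3) by (simp only: mod_less)
qed

section \<open>Recoverability\<close>

definition front :: "problem \<Rightarrow> nat \<Rightarrow> nat" where
  "front I z = (if odd (z div nregs I) then nregs I - z mod nregs I else z mod nregs I)"

definition phase_run :: "problem \<Rightarrow> nat \<Rightarrow> nat" where
  "phase_run I z = z div nregs I div 2"

text \<open>
  At time \<open>z\<close> exactly the registers below \<open>front I z\<close> are shifted, except that
  \<open>X = Suc f\<close> announces that register \<open>f\<close>, at this boundary, is being written.
\<close>

definition recoverable ::
  "problem \<Rightarrow> bool list \<Rightarrow> nat \<Rightarrow> nat \<Rightarrow> nat \<Rightarrow> nat \<Rightarrow> nat \<Rightarrow> nat \<Rightarrow> nat \<Rightarrow> bool list \<Rightarrow> bool" where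
  "recoverable I \<tau> z X p p' c s d m \<longleftrightarrow>
     length m = nregs I * reg_bits I \<and> z \<le> 4 * nregs I \<and>
     (if X = 0 then \<forall>g < nregs I. reg I m g = (if g < front I z then shifted I \<tau> (phase_run I z) g else reg I \<tau> g)
      else X \<le> nregs I \<and> 0 < indeg I (X - 1) \<and> (front I z = X - 1 \<or> front I z = X) \<and>
        (\<forall>g < X - 1. reg I m g = shifted I \<tau> (phase_run I z) g) \<and>
        (\<forall>g < nregs I. X \<le> g \<longrightarrow> reg I m g = reg I \<tau> g) \<and>
        in_flux I m (X - 1) p p' c s d (reg I \<tau> (X - 1)))"

section \<open>The main program\<close>

abbreviation (input) "c_time \<equiv> 0 :: nat"
abbreviation (input) "c_flux \<equiv> 2 :: nat"
abbreviation (input) "c_pos \<equiv> 3 :: nat"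
abbreviation (input) "c_pos' \<equiv> 4 :: nat"
abbreviation (input) "c_carry \<equiv> 5 :: nat"
abbreviation (input) "c_digit \<equiv> 6 :: nat"
abbreviation (input) "c_diff \<equiv> 7 :: nat"
abbreviation (input) "c_regs \<equiv> 8 :: nat"
abbreviation (input) "c_out \<equiv> 9 :: nat"
abbreviation (input) "c_odd \<equiv> 10 :: nat"
abbreviation (input) "c_target \<equiv> 11 :: nat"
abbreviation (input) "c_end \<equiv> 12 :: nat"
abbreviation (input) "c_x \<equiv> 13 :: nat"
abbreviation (input) "c_y \<equiv> 14 :: nat"
abbreviation (input) "c_u \<equiv> 15 :: nat"
abbreviation (input) "c_v \<equiv> 16 :: nat"
abbreviation (input) "base \<equiv> 17 :: nat"

definition load_params :: "nat \<Rightarrow> instr list" where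
  "load_params c = [Param (v_num c) Num_Verts, Param (v_bits c) Reg_Bits, Param (v_mod c) Modulus,
    Param (v_src c) Src, Const (v_one c) 1, Const (v_zero c) 0]"

definition main_init :: "instr list" where
  "main_init =
    [Param c_x Path_Len,
     Arith Add c_regs c_x (v_one base),
     Arith Mul c_regs c_regs (v_num base),
     Arith Mul c_target c_x (v_num base),
     Param c_y Dst,
     Arith Add c_target c_target c_y,
     Arith Add c_end c_regs c_regs,
     Arith Add c_end c_end c_end,
     Arith Mul c_u c_x (v_bits base)]"

text \<open>Covers \<open>path_len I * reg_bits I = 0\<close>, where the time bound leaves
  constantly many steps. For length 0 only the empty path counts; for registers without bits,
  validity forces modulus 1, and the final reduction yields 0.\<close>

definition main_trivial :: "instr list" where
  "main_trivial =
    [Arith Sub c_x (v_src base) c_y,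
     Arith Sub c_u c_y (v_src base),
     Arith Add c_x c_x c_u,
     Arith Sub c_x (v_one base) c_x,
     Arith Mod c_out c_x (v_mod base)]"

text \<open>
  Time \<open>z\<close> runs through four phases of \<open>N\<close> steps. Even phases shift the registers in increasing order,
  odd phases undo this in decreasing order, and the phases \<open>2\<close> and \<open>3\<close> form the second run.
\<close>

definition main_locate :: "instr list" where
  "main_locate =
    [Arith Div c_x c_time c_regs,
     Arith Mod c_y c_time c_regs,
     Const c_u 2,
     Arith Mod c_odd c_x c_u,
     Arith Div (v_run base) c_x c_u,
     Arith Sub c_u (v_one base) c_odd,
     Arith Mul c_u c_u c_y,
     Arith Sub c_v c_regs (v_one base),
     Arith Sub c_v c_v c_y,
     Arith Mul c_v c_v c_odd,
     Arith Add (v_reg base) c_u c_v]"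

text \<open>\<open>c_x\<close> becomes the new residue, from the sum or from \<open>q\<close> minus
  the sum according to the phase. Its difference to the old residue, with offset \<open>q\<close>,
  is the first carry. \<open>c_diff\<close> equals it in even phases; in odd phases it is
  \<open>q\<close>, standing for 0, as the finished register is then the original itself.\<close>

definition main_difference :: "instr list" where
  "main_difference =
    [Arith Sub c_x (v_mod base) (v_sum base),
     Arith Mul c_x c_x c_odd,
     Arith Sub c_y (v_one base) c_odd,
     Arith Mul c_u c_y (v_sum base),
     Arith Add c_x c_x c_u,
     Arith Add c_x c_x (v_res base),
     Arith Mod c_x c_x (v_mod base),
     Arith Add c_carry c_x (v_mod base),
     Arith Sub c_carry c_carry (v_res base),
     Arith Mul c_diff c_odd (v_mod base),
     Arith Mul c_u c_y c_carry,
     Arith Add c_diff c_diff c_u]"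

definition main_output_test :: "instr list" where
  "main_output_test =
    [Arith Sub c_u (v_reg base) c_target,
     Arith Sub c_v c_target (v_reg base),
     Arith Add c_u c_u c_v,
     Arith Sub c_u (v_one base) c_u,
     Arith Mul c_u c_u c_y]"

text \<open>The output is replaced by the new residue minus itself. Starting from 0, the first visit
  thus stores a residue and the second one the difference of the two.\<close>

definition main_output :: "instr list" where
  "main_output =
    [Arith Add c_x c_x (v_mod base),
     Arith Sub c_x c_x c_out,
     Arith Mod c_out c_x (v_mod base)]"

text \<open>\<open>c_pos'\<close> advances only when the digit is complete, and \<open>c_pos\<close>
  only after bit and carry have been replaced. In between, \<open>c_digit\<close> preserves the
  information that is being overwritten.\<close>

definition main_digit :: "instr list" where
  "main_digit =
    [Arith Mul c_x (v_reg base) (v_bits base),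
     Arith Add c_x c_x c_pos,
     Cat_Read c_y c_x,
     Arith Add c_digit c_y c_carry,
     Arith Add c_digit c_digit (v_mod base),
     Arith Add c_pos' c_pos' (v_one base)]"

definition main_write :: "instr list" where
  "main_write =
    [Const c_u 2,
     Arith Mod c_v c_digit c_u,
     Cat_Write c_x c_v,
     Arith Div c_carry c_digit c_u,
     Arith Add c_pos c_pos (v_one base)]"

text \<open>The announcement in \<open>c_flux\<close> comes last, when positions, carry and
  difference are in place.\<close>

definition main_flux :: com where
  "main_flux =
    Seq (Block [Const c_pos 0, Const c_pos' 0, Arith Add c_flux (v_reg base) (v_one base)])
        (While_Less c_pos (v_bits base) (Seq (Block main_digit) (Block main_write)))"

definition main_body :: com where
  "main_body =
    Seq (Block main_locate)
   (Seq (Block (prepare base))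
   (Seq (gather base)
   (Seq (Block main_difference)
   (Seq (Block main_output_test)
   (Seq (If_Less (v_zero base) c_u (Block main_output) (Block []))
   (Seq (If_Less (v_zero base) (v_deg base) main_flux (Block []))
        (Block [Arith Add c_time c_time (v_one base), Const c_flux 0])))))))"

definition main_com :: com where
  "main_com =
    Seq (Block (load_params base))
   (Seq (Block main_init)
        (If_Less (v_zero base) c_u
          (While_Less c_time c_end main_body)
          (Block main_trivial)))"

definition current :: "problem \<Rightarrow> nat \<Rightarrow> nat" where
  "current I z = (if odd (z div nregs I) then nregs I - 1 - z mod nregs I else z mod nregs I)"

definition idle :: "problem \<Rightarrow> bool list \<Rightarrow> nat \<Rightarrow> bool list \<Rightarrow> bool" where
  "idle I \<tau> z m \<longleftrightarrow> length m = nregs I * reg_bits I \<and> z \<le> 4 * nregs I \<and>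
     (\<forall>g < nregs I. reg I m g = (if g < front I z then shifted I \<tau> (phase_run I z) g else reg I \<tau> g))"

lemma recoverable_0 [simp]: "recoverable I \<tau> z 0 p p' c s d m \<longleftrightarrow> idle I \<tau> z m"
  by (simp add: recoverable_def idle_def)

section \<open>The effect of one time step on the tape\<close>

context monitored
begin

lemma Suc_divmod:
  fixes z :: nat
  shows "Suc z div N = (if Suc (z mod N) = N then Suc (z div N) else z div N)"
    "Suc z mod N = (if Suc (z mod N) = N then 0 else Suc (z mod N))"
  by (simp_all add: div_Suc mod_Suc)

lemma current_less: "current I z < N"
  using N_pos by (auto simp: current_def)

lemma front_current: "front I z = (if odd (z div N) then Suc (current I z) else current I z)"
  using N_pos mod_less_divisor[of N z] by (simp add: front_def current_def Suc_diff_Suc)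

lemma front_Suc: "front I (Suc z) = (if odd (z div N) then current I z else Suc (current I z))"
  using N_pos mod_less_divisor[of N z]
  by (cases "Suc (z mod N) = N"; cases "odd (z div N)") (simp_all add: front_def current_def Suc_divmod)

text \<open>The run number changes only after the last step of an odd phase, and there
  \<open>current\<close> is 0, so that no shifted register remains whose meaning could
  change.\<close>

lemma phase_run_Suc: "even (z div N) \<or> g < current I z \<Longrightarrow> phase_run I (Suc z) = phase_run I z"
  by (cases "Suc (z mod N) = N"; cases "odd (z div N)") (simp_all add: phase_run_def current_def Suc_divmod)

lemma phase_run_le: "z \<le> 4 * N \<Longrightarrow> phase_run I z \<le> 2"
proof -
  assume "z \<le> 4 * N"
  then have "z div N \<le> 4 * N div N" by (rule div_le_mono)
  then have "z div N \<le> 4" using N_pos by simp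
  then show ?thesis by (simp add: phase_run_def)
qed

definition moved :: "nat \<Rightarrow> bool list \<Rightarrow> nat" where
  "moved z m = (let g = current I z; a = increment I (phase_run I z) (reg I m) g in
     shift I (reg I m g) (if odd (z div N) then q - a else a))"

lemma idle_current:
  assumes "idle I \<tau> z m"
  shows "reg I m (current I z) = (if odd (z div N) then S \<tau> (phase_run I z) (current I z) else reg I \<tau> (current I z))"
    and "g < current I z \<Longrightarrow> reg I m g = S \<tau> (phase_run I z) g"
  using assms current_less[of z] by (auto simp: idle_def front_current)

text \<open>In both kinds of phase the in-neighbours are shifted at this moment, since undoing
  proceeds downwards; so the increment is the one belonging to \<open>S\<close>.\<close>

lemma moved_eq:
  assumes "idle I \<tau> z m"
  shows "moved z m = (if odd (z div N) then reg I \<tau> (current I z) else S \<tau> (phase_run I z) (current I z))"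
proof -
  have p: "reg I m (pred_reg I (current I z) e) = S \<tau> (phase_run I z) (pred_reg I (current I z) e)"
    if "e < indeg I (current I z)" for e
    using idle_current(2)[OF assms pred_reg_less_N[OF current_less that]] .
  show ?thesis
  proof (cases "odd (z div N)")
    case True
    then show ?thesis
      using unshift_increment[of "current I z" "reg I m" \<tau> "phase_run I z"] p idle_current(1)[OF assms]
      by (simp add: moved_def Let_def)
  next
    case False
    then show ?thesis
      using shift_increment[of "current I z" "reg I m" \<tau> "phase_run I z"] p idle_current(1)[OF assms]
      by (simp add: moved_def Let_def)
  qed
qed

lemma moved_less: "idle I \<tau> z m \<Longrightarrow> moved z m < 2 ^ l"
  using moved_eq[of \<tau> z m] reg_less[of I \<tau>] shifted_less[of \<tau>] by simp

lemma idle_Suc: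
  assumes "idle I \<tau> z m" "z < 4 * N" "length m' = N * l"
    and "reg I m' (current I z) = moved z m"
    and "\<And>g. g < N \<Longrightarrow> g \<noteq> current I z \<Longrightarrow> reg I m' g = reg I m g"
  shows "idle I \<tau> (Suc z) m'"
  unfolding idle_def
proof (intro conjI allI impI)
  fix g assume g: "g < N"
  consider "g = current I z" | "g < current I z" | "current I z < g" by linarith
  then show "reg I m' g = (if g < front I (Suc z) then S \<tau> (phase_run I (Suc z)) g else reg I \<tau> g)"
  proof cases
    case 1
    then show ?thesis using assms(4) moved_eq[OF assms(1)] phase_run_Suc[of z]
      by (cases "even (z div N)") (simp_all add: front_Suc)
  next
    case 2
    then show ?thesis using assms(5)[OF g] idle_current(2)[OF assms(1) 2] phase_run_Suc[of z g] by (simp add: front_Suc)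
  next
    case 3
    then have "reg I m g = reg I \<tau> g" using assms(1) g by (auto simp: idle_def front_current)
    then show ?thesis using assms(5)[OF g] 3 by (simp add: front_Suc)
  qed
qed (use assms in auto)

lemma idle_Suc_indeg_0:
  assumes "idle I \<tau> z m" "z < 4 * N" "indeg I (current I z) = 0"
  shows "idle I \<tau> (Suc z) m"
proof (rule idle_Suc[OF assms(1,2)])
  show "reg I m (current I z) = moved z m"
    using idle_current(1)[OF assms(1)] moved_eq[OF assms(1)] shifted_indeg_0[OF assms(3)] by simp
qed (use assms in \<open>auto simp: idle_def\<close>)

definition writing where
  "writing \<tau> z p p' c s d m \<longleftrightarrow> recoverable I \<tau> z (Suc (current I z)) p p' c s d m"

text \<open>The tape \<open>m0\<close> at the start of the step serves as reference: the other
  registers only have to be untouched.\<close>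

lemma writing_iff:
  assumes "idle I \<tau> z m0" "0 < indeg I (current I z)"
  shows "writing \<tau> z p p' c s d m \<longleftrightarrow> length m = N * l \<and>
    (\<forall>g < N. g \<noteq> current I z \<longrightarrow> reg I m g = reg I m0 g) \<and>
    in_flux I m (current I z) p p' c s d (reg I \<tau> (current I z))"
proof -
  let ?f = "current I z"
  have m0: "reg I m0 g = (if g < ?f then S \<tau> (phase_run I z) g else reg I \<tau> g)"
    if "g < N" "g \<noteq> ?f" for g
    using assms(1) that by (auto simp: idle_def front_current)
  have "(\<forall>g < ?f. reg I m g = S \<tau> (phase_run I z) g) \<and> (\<forall>g < N. Suc ?f \<le> g \<longrightarrow> reg I m g = reg I \<tau> g)
    \<longleftrightarrow> (\<forall>g < N. g \<noteq> ?f \<longrightarrow> reg I m g = reg I m0 g)" (is "?L \<longleftrightarrow> ?R")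
  proof
    assume L: ?L
    show ?R
    proof (intro allI impI)
      fix g assume g: "g < N" "g \<noteq> ?f"
      with L show "reg I m g = reg I m0 g" unfolding m0[OF g] by (cases "g < ?f") auto
    qed
  next
    assume R: ?R
    then have "reg I m g = (if g < ?f then S \<tau> (phase_run I z) g else reg I \<tau> g)" if "g < N" "g \<noteq> ?f" for g
      using that m0[OF that] by simp
    moreover have "g < ?f \<Longrightarrow> g < N" for g using current_less[of z] by simp
    ultimately show ?L by simp
  qed
  moreover have "z \<le> 4 * N" using assms(1) by (simp add: idle_def)
  moreover have "Suc ?f \<le> N" using current_less[of z] by simp
  moreover have "front I z = Suc ?f \<or> front I z = ?f" by (simp add: front_current)
  ultimately show ?thesis using assms(2)
    unfolding writing_def recoverable_def by (simp only: diff_Suc_1 nat.distinct if_False) blast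
qed

text \<open>Time is advanced by one instruction and the announcement withdrawn by the next. In
  between, the old announcement stands beside the new time, which is why \<open>recoverable\<close>
  admits two positions of the front.\<close>

lemma writing_Suc:
  assumes "idle I \<tau> z m0" "0 < indeg I (current I z)" "z < 4 * N" "writing \<tau> z p p' c s d m"
  shows "recoverable I \<tau> (Suc z) (Suc (current I z)) p p' c s d m"
proof -
  have "front I (Suc z) = current I z \<or> front I (Suc z) = Suc (current I z)" by (simp add: front_Suc)
  moreover have "g < current I z \<Longrightarrow> phase_run I (Suc z) = phase_run I z" for g using phase_run_Suc by blast
  moreover have "Suc z \<le> 4 * N" using assms(3) by simp
  ultimately show ?thesis using assms(4)
    unfolding writing_def recoverable_def by (simp only: diff_Suc_1 nat.distinct if_False) metis
qed

lemma writing_finish: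
  assumes "idle I \<tau> z m0" "0 < indeg I (current I z)" "z < 4 * N" "writing \<tau> z l p' c s d m"
    and "int d - int q = int (moved z m0) - int (reg I \<tau> (current I z))"
  shows "idle I \<tau> (Suc z) m"
proof (rule idle_Suc[OF assms(1,3)])
  have w: "length m = N * l" "in_flux I m (current I z) l p' c s d (reg I \<tau> (current I z))"
    "\<forall>g < N. g \<noteq> current I z \<longrightarrow> reg I m g = reg I m0 g"
    using assms(4) unfolding writing_iff[OF assms(1,2)] by auto
  then show "length m = N * l" by simp
  show "reg I m (current I z) = moved z m0"
    by (rule in_flux_finish[OF w(2) _ moved_less[OF assms(1)]]) (use assms(5) in simp)
  show "reg I m g = reg I m0 g" if "g < N" "g \<noteq> current I z" for g using w(3) that by simp
qed

end

definition target :: "problem \<Rightarrow> nat" where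
  "target I = path_len I * num_verts I + dst I"

text \<open>The output cell receives the residue of the target register when the first run reaches it, and
  the difference of the two residues when the second run does.\<close>

definition outcome :: "problem \<Rightarrow> bool list \<Rightarrow> nat \<Rightarrow> nat" where
  "outcome I \<tau> z =
    (let r = \<lambda>\<rho>. shifted I \<tau> \<rho> (target I) mod modulus I in
     if z \<le> target I then 0 else if z \<le> 2 * nregs I + target I then r 0
     else (r 1 + modulus I - r 0) mod modulus I)"

text \<open>
  From here on, statements address the cells numerically, in the form that the simplifier produces:
  \<open>0, 2, \<dots>, 16\<close> are the cells \<open>c_time, c_flux, \<dots>, c_v\<close>, and \<open>17 + x\<close> is cell \<open>x\<close> relative
  to \<open>base\<close>. In the query routine, \<open>qbase = 60\<close> plays this part.
\<close>

locale main_run =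
  fixes I :: problem and \<tau> :: "bool list" and B :: nat
  assumes well_formed: "well_formed I"
    and bound: "8 * (nregs I * reg_bits I) + 8 * nregs I + 8 * reg_bits I + 8 * path_len I + 8 * modulus I + 16 \<le> B"
begin

text \<open>\<open>recoverable\<close> reads only cells below 8, and 40 is \<open>base + 23\<close>,
  the end of the scratch area.\<close>

sublocale monitored I B 40 8
  "\<lambda>w m. recoverable I \<tau> (w c_time) (w c_flux) (w c_pos) (w c_pos') (w c_carry) (w c_digit) (w c_diff) m"
  by unfold_locales (use well_formed bound in auto)

definition main_state :: "nat \<Rightarrow> nat \<Rightarrow> (nat \<Rightarrow> nat) \<Rightarrow> bool" where
  "main_state z x w \<longleftrightarrow> w 0 = z \<and> w 8 = N \<and> w 9 = x \<and> w 11 = target I \<and> w 12 = 4 * N \<and>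
     w 17 = n \<and> w 18 = l \<and> w 19 = q \<and> w 20 = src I \<and> w 23 = 1 \<and> w 24 = 0"

lemma main_state_consts: "main_state z x w \<Longrightarrow> consts_ok base w"
  by (simp add: main_state_def consts_ok_def)

lemma main_state_frame: "main_state z x w \<Longrightarrow> \<forall>v < 25. w' v = w v \<Longrightarrow> main_state z x w'"
  by (simp add: main_state_def)

lemma J_idle: "J w m \<Longrightarrow> w 2 = 0 \<Longrightarrow> w 0 = z \<Longrightarrow> idle I \<tau> z m"
  by (auto simp: J_def)

lemma target_less: "target I < N"
  using address_less[of "path_len I" "path_len I + 1" "dst I" n] dst_less by (simp add: target_def nregs_def)

section \<open>Verification of the main program, block by block\<close>

lemma locate_sat:
  assumes J: "J w m" and s: "main_state z x w" and X: "w 2 = 0" and z: "z < 4 * N"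
  shows "sat I J (Block main_locate) 11 (\<lambda>w' m'. m' = m \<and> main_state z x w' \<and> w' 2 = 0 \<and>
    w' 10 = of_bool (odd (z div N)) \<and> w' 21 = phase_run I z \<and> w' 22 = current I z) w m"
proof -
  have [simp]: "w 0 = z" "w 8 = N" "w 9 = x" "w 11 = target I" "w 12 = 4 * N"
     "w 17 = n" "w 18 = l" "w 19 = q" "w 20 = src I" "w 23 = 1" "w 24 = 0" "w 2 = 0"
    using s X by (simp_all add: main_state_def)
  have i: "idle I \<tau> z m" using J_idle[OF J X] by simp
  have zB: "z \<le> B" using z big by linarith
  have mN: "z mod N < N" using N_pos by simp
  have NB: "N \<le> B" "2 \<le> B" "Suc 0 \<le> B" "N - 1 \<le> B" "N - 1 - z mod N \<le> B" "N - Suc 0 \<le> B" "N - Suc (z mod N) \<le> B"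
    using big by - linarith+
  have wB: "z mod N \<le> B" "z div N \<le> B" "z div N div 2 \<le> B"
    using mN NB(1) zB div_le_dividend[of z N] div_le_dividend[of "z div N" 2] by - linarith+
  have cB: "current I z \<le> B" using current_less[of z] NB(1) by linarith
  show ?thesis
  proof (cases "odd (z div N)")
    case True
    have m2: "z div N mod 2 = 1" using True by (simp add: odd_iff_mod_2_eq_one)
    show ?thesis
      using [[linarith_split_limit = 0]]
      by (rule sat_BlockI[OF J]) (simp_all add: main_locate_def i zB NB wB m2 main_state_def phase_run_def True current_def)
  next
    case False
    have m2: "z div N mod 2 = 0" using False by (simp add: even_iff_mod_2_eq_zero)
    show ?thesis
      using [[linarith_split_limit = 0]]
      by (rule sat_BlockI[OF J]) (simp_all add: main_locate_def i zB NB wB m2 main_state_def phase_run_def False current_def)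
  qed
qed

lemma difference_sat:
  assumes J: "J w m" and s: "main_state z x w" and X: "w 2 = 0" and z: "z < 4 * N"
    and w: "w 10 = of_bool (odd (z div N))" "w 35 = reg I m (current I z) mod q"
      "w 31 = increment I (phase_run I z) (reg I m) (current I z)"
  shows "sat I J (Block main_difference) 12 (\<lambda>w' m'. m' = m \<and> (\<forall>v \<ge> 17. w' v = w v) \<and> main_state z x w' \<and> w' 2 = 0 \<and>
    w' 13 = moved z m mod q \<and> w' 14 = of_bool (even (z div N)) \<and>
    w' 5 = moved z m mod q + q - reg I m (current I z) mod q \<and>
    w' 7 = (if odd (z div N) then q else moved z m mod q + q - reg I m (current I z) mod q)) w m"
proof -
  define r where "r = reg I m (current I z) mod q"
  define a where "a = increment I (phase_run I z) (reg I m) (current I z)"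
  have [simp]: "w 0 = z" "w 8 = N" "w 9 = x" "w 11 = target I" "w 12 = 4 * N"
     "w 17 = n" "w 18 = l" "w 19 = q" "w 20 = src I" "w 23 = 1" "w 24 = 0" "w 2 = 0" "w 35 = r" "w 31 = a"
    using s X w by (simp_all add: main_state_def r_def a_def)
  have i: "idle I \<tau> z m" using J_idle[OF J X] by simp
  have r: "r < q" and a: "a < q" using q_pos increment_less by (simp_all add: r_def a_def)
  have qB: "8 * q + 16 \<le> B" using big by linarith
  have m: "y mod q < q" for y using q_pos by simp
  have b: "q - a \<le> B" "q - a + r \<le> B" "a + r \<le> B" "y mod q \<le> B" "y mod q + q \<le> B" "y mod q + q - r \<le> B" "q \<le> B" "Suc 0 \<le> B" "a \<le> B" for y
    using qB r a m[of y] by - linarith+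
  have mv: "moved z m mod q = (if odd (z div N) then q - a + r else a + r) mod q"
    by (simp add: moved_def Let_def shift_mod a_def[symmetric] mod_add_left_eq r_def mod_add_right_eq add.commute)
  show ?thesis
  proof (cases "odd (z div N)")
    case True
    have [simp]: "w 10 = 1" using w True by simp
    show ?thesis
      using [[linarith_split_limit = 0]]
      by (rule sat_BlockI[OF J]) (simp_all add: main_difference_def i b True main_state_def r_def[symmetric] mv)
  next
    case False
    have [simp]: "w 10 = 0" using w False by simp
    show ?thesis
      using [[linarith_split_limit = 0]]
      by (rule sat_BlockI[OF J]) (simp_all add: main_difference_def i b False main_state_def r_def[symmetric] mv)
  qed
qed

lemma output_test_sat:
  assumes J: "J w m" and s: "main_state z x w" and X: "w 2 = 0"
    and w: "w 14 = of_bool e" "w 22 = g" "g < N"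
  shows "sat I J (Block main_output_test) 5 (\<lambda>w' m'. m' = m \<and> (\<forall>v. v \<noteq> 15 \<and> v \<noteq> 16 \<longrightarrow> w' v = w v) \<and>
    w' 15 = of_bool (g = target I \<and> e)) w m"
proof -
  have [simp]: "w 11 = target I" "w 23 = 1" "w 22 = g" using s w by (simp_all add: main_state_def)
  have b: "g - target I \<le> B" "target I - g \<le> B" "g - target I + (target I - g) \<le> B" "1 \<le> B"
    using big target_less w(3) by - linarith+
  have e: "1 - (g - target I + (target I - g)) = of_bool (g = target I)" by auto
  have ob: "of_bool P \<le> B" for P using b(4) by simp
  show ?thesis
    supply [[linarith_split_limit = 0]]
    apply (rule sat_BlockI[OF J])
     apply (cases e)
      apply (simp_all only: main_output_test_def)
      apply (simp add: b e ob w del: One_nat_def)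
     apply (simp add: b e ob w del: One_nat_def)
    apply simp
    done
qed

text \<open>Each phase visits the target once, so the output changes only at its visits in phases 0
  and 2.\<close>

lemma outcome_Suc:
  assumes "z < 4 * N"
  shows "outcome I \<tau> (Suc z) =
    (if current I z = target I \<and> even (z div N)
     then (S \<tau> (phase_run I z) (target I) mod q + q - outcome I \<tau> z) mod q else outcome I \<tau> z)"
proof -
  have t: "target I < N" by (rule target_less)
  have m: "z mod N < N" using N_pos by simp
  have z: "z = z div N * N + z mod N" by simp
  have "z div N < 4" using assms N_pos by (simp add: div_less_iff_less_mult)
  then consider "z div N = 0" | "z div N = 1" | "z div N = 2" | "z div N = 3" by linarith
  then show ?thesis
  proof cases
    case 1
    then have "z = z mod N" "z < N" using z m by simp_all
    then show ?thesis using t 1 by (auto simp: outcome_def current_def phase_run_def Let_def)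
  next
    case 2
    then have "z = N + z mod N" using z by simp
    then have "N \<le> z" "z < 2 * N" using m by linarith+
    then show ?thesis using t 2 by (simp add: outcome_def Let_def)
  next
    case 3
    then have "z = 2 * N + z mod N" using z by simp
    then have *: "2 * N \<le> z" "z < 3 * N" "z mod N = target I \<longleftrightarrow> z = 2 * N + target I" using m by linarith+
    then show ?thesis using t 3 by (auto simp: outcome_def current_def phase_run_def Let_def)
  next
    case 4
    then have "z = 3 * N + z mod N" using z by simp
    then have "3 * N \<le> z" by linarith
    then show ?thesis using t 4 by (simp add: outcome_def Let_def)
  qed
qed

lemma output_sat:
  assumes J: "J w m" and s: "main_state z (outcome I \<tau> z) w" and X: "w 2 = 0" and z: "z < 4 * N"
    and w: "w 13 = moved z m mod q" "w 15 = of_bool (current I z = target I \<and> even (z div N))"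
  shows "sat I J (If_Less (v_zero base) c_u (Block main_output) (Block [])) 5
    (\<lambda>w' m'. m' = m \<and> (\<forall>v. v \<noteq> 9 \<and> v \<noteq> 13 \<longrightarrow> w' v = w v) \<and> main_state z (outcome I \<tau> (Suc z)) w') w m"
    (is "sat I J _ _ ?Q w m")
proof -
  have [simp]: "w 0 = z" "w 8 = N" "w 9 = outcome I \<tau> z" "w 11 = target I" "w 12 = 4 * N"
     "w 17 = n" "w 18 = l" "w 19 = q" "w 20 = src I" "w 23 = 1" "w 24 = 0" "w 2 = 0"
    using s X by (simp_all add: main_state_def)
  have i: "idle I \<tau> z m" using J_idle[OF J X] by simp
  have qB: "8 * q + 16 \<le> B" using big by linarith
  have m: "y mod q < q" for y using q_pos by simp
  have b: "y mod q + q \<le> B" "y mod q + q - y' \<le> B" "y mod q \<le> B" for y y'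
    using qB m[of y] by - linarith+
  have "sat I J (If_Less (v_zero base) c_u (Block main_output) (Block [])) (3 + 2) ?Q w m"
  proof (rule sat_If)
    show "J w m" by (rule J)
  next
    assume "w (v_zero base) < w c_u"
    then have c: "current I z = target I \<and> even (z div N)" using w(2) by (simp split: if_splits)
    then have o: "outcome I \<tau> (Suc z) = (moved z m mod q + q - outcome I \<tau> z) mod q"
      using outcome_Suc[OF z] moved_eq[OF i] by simp
    show "sat I J (Block main_output) 3 ?Q w m"
      using [[linarith_split_limit = 0]]
      by (rule sat_BlockI[OF J]) (simp_all add: main_output_def b w(1) main_state_def o)
  next
    assume "\<not> w (v_zero base) < w c_u"
    then have "\<not> (current I z = target I \<and> even (z div N))" using w(2) by (simp split: if_splits)
    then have "outcome I \<tau> (Suc z) = outcome I \<tau> z" using outcome_Suc[OF z] by auto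
    then show "sat I J (Block []) 3 ?Q w m" using J s by (intro sat_Nil) simp_all
  qed
  then show ?thesis by simp
qed

text \<open>Within a block, value and residue change by the same amount; so the difference of two
  long numbers is known from two short residues.\<close>

lemma moved_int: "int (moved z m) = int (reg I m (current I z)) - int (reg I m (current I z) mod q) + int (moved z m mod q)"
  unfolding moved_def Let_def by (simp only: int_shift shift_mod)

definition kept :: "(nat \<Rightarrow> nat) \<Rightarrow> (nat \<Rightarrow> nat) \<Rightarrow> bool" where
  "kept w0 w \<longleftrightarrow> w 0 = w0 0 \<and> w 2 = w0 2 \<and> (\<forall>v. 7 \<le> v \<and> v \<le> 12 \<or> 17 \<le> v \<longrightarrow> w v = w0 v)"

lemma kept_refl: "kept w w"
  by (simp add: kept_def)

lemma kept_trans: "kept w0 w1 \<Longrightarrow> kept w1 w2 \<Longrightarrow> kept w0 w2"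
  by (simp add: kept_def)

lemma main_state_kept: "main_state z x w0 \<Longrightarrow> kept w0 w \<Longrightarrow> main_state z x w"
  by (simp add: kept_def main_state_def)

lemma J_writing:
  "J w m \<Longrightarrow> w 0 = z \<Longrightarrow> w 2 = Suc (current I z) \<Longrightarrow> writing \<tau> z (w 3) (w 4) (w 5) (w 6) (w 7) m"
  by (auto simp: J_def writing_def)

lemma digit_sat:
  assumes J: "J w m" and s: "main_state z x w" and X: "w 2 = Suc (current I z)" "w 22 = current I z"
    and p: "w 3 = p" "w 4 = p" "p < l"
    and i: "idle I \<tau> z m0" "0 < indeg I (current I z)"
  shows "sat I J (Block main_digit) 6 (\<lambda>w' m'. m' = m \<and> kept w w' \<and> w' 3 = p \<and> w' 4 = Suc p \<and>
    w' 13 = current I z * l + p) w m"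
proof -
  let ?g = "current I z"
  have [simp]: "w 0 = z" "w 18 = l" "w 19 = q" "w 23 = 1" "w 22 = ?g" "w 2 = Suc ?g" "w 3 = p" "w 4 = p"
    using s X p by (simp_all add: main_state_def)
  have wr: "writing \<tau> z p p (w 5) (w 6) (w 7) m" using J_writing[OF J] by simp
  then have W: "length m = N * l" "\<forall>g < N. g \<noteq> ?g \<longrightarrow> reg I m g = reg I m0 g"
    "in_flux I m ?g p p (w 5) (w 6) (w 7) (reg I \<tau> ?g)"
    unfolding writing_iff[OF i] by auto
  define \<beta> :: nat where "\<beta> = of_bool (m ! (?g * l + p))"
  \<comment> \<open>While the two positions agree, \<open>c_digit\<close> is not consulted, so its
    intermediate values are harmless.\<close>
  have R1: "recoverable I \<tau> z (Suc ?g) p p (w 5) s' (w 7) m" for s'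
    using W in_flux_s[OF W(3)] unfolding writing_def[symmetric] writing_iff[OF i] by simp
  have R2: "recoverable I \<tau> z (Suc ?g) p (Suc p) (w 5) (\<beta> + w 5 + q) (w 7) m"
    using W in_flux_enter[OF W(3) p(3)] unfolding writing_def[symmetric] writing_iff[OF i] \<beta>_def by simp
  have a: "?g * l + p < N * l" by (rule address_less[OF current_less p(3)])
  have c: "w 5 \<le> 2 * q" using W(3) by (simp add: in_flux_def)
  have \<beta>: "\<beta> \<le> 1" by (simp add: \<beta>_def)
  have b: "?g * l \<le> B" "?g * l + p \<le> B" "\<beta> \<le> B" "\<beta> + w 5 \<le> B" "\<beta> + w 5 + q \<le> B" "Suc p \<le> B"
    using big a c \<beta> p(3) by - linarith+
  have bit: "of_bool (?g * l + p < length m \<and> m ! (?g * l + p)) = \<beta>" using a W(1) by (simp add: \<beta>_def)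
  show ?thesis
    using [[linarith_split_limit = 0]]
    by (rule sat_BlockI[OF J]) (simp_all add: main_digit_def bit b R1 R2 kept_def)
qed

lemma write_sat:
  assumes J: "J w m" and s: "main_state z x w" and X: "w 2 = Suc (current I z)"
    and p: "w 3 = p" "w 4 = Suc p" "w 13 = current I z * l + p"
    and i: "idle I \<tau> z m0" "0 < indeg I (current I z)"
  shows "sat I J (Block main_write) 5 (\<lambda>w' m'. kept w w' \<and> w' 3 = Suc p \<and> w' 4 = Suc p) w m"
proof -
  let ?g = "current I z"
  define s where "s = w 6"
  have [simp]: "w 0 = z" "w 18 = l" "w 19 = q" "w 23 = 1" "w 2 = Suc ?g" "w 3 = p" "w 4 = Suc p" "w 13 = ?g * l + p" "w 6 = s"
    using s X p by (simp_all add: main_state_def s_def)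
  have wr: "writing \<tau> z p (Suc p) (w 5) s (w 7) m" using J_writing[OF J] by simp
  then have W: "length m = N * l" "\<forall>g < N. g \<noteq> ?g \<longrightarrow> reg I m g = reg I m0 g"
    "in_flux I m ?g p (Suc p) (w 5) s (w 7) (reg I \<tau> ?g)"
    unfolding writing_iff[OF i] by auto
  have pl: "p < l" and sq: "s \<le> 3 * q + 1" using W(3) by (auto simp: in_flux_def)
  have a: "?g * l + p < N * l" by (rule address_less[OF current_less pl])
  let ?m = "m[?g * l + p := odd s]"
  have m: "length ?m = N * l" "\<forall>g < N. g \<noteq> ?g \<longrightarrow> reg I ?m g = reg I m0 g"
    using W(1,2) reg_update_other[OF W(1) current_less _ _ pl] by auto
  have c: "s div 2 \<le> 2 * q" using sq q_pos by linarith
  note f1 = in_flux_write[OF W(3) W(1) current_less, of "odd s"]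
  note f2 = in_flux_c[OF f1 c]
  have f3: "in_flux I ?m ?g (Suc p) (Suc p) (s div 2) s (w 7) (reg I \<tau> ?g)"
    by (rule in_flux_leave[OF f1 _ refl c]) (use a W(1) in simp)
  \<comment> \<open>One state for each of the instructions that replace the bit, the carry and the
    position.\<close>
  have R: "recoverable I \<tau> z (Suc ?g) p (Suc p) (w 5) s (w 7) ?m"
    "recoverable I \<tau> z (Suc ?g) p (Suc p) (s div 2) s (w 7) ?m"
    "recoverable I \<tau> z (Suc ?g) (Suc p) (Suc p) (s div 2) s (w 7) ?m"
    using m f1 f2 f3 unfolding writing_def[symmetric] writing_iff[OF i] by auto
  have od: "(s mod 2 = Suc 0) = odd s" by (simp add: odd_iff_mod_2_eq_one)
  have b: "s div 2 \<le> B" "s mod 2 \<le> B" "Suc p \<le> B" "2 \<le> B"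
    using big c pl by - linarith+
  show ?thesis
    using [[linarith_split_limit = 0]]
    by (rule sat_BlockI[OF J]) (simp_all add: main_write_def b kept_def R od)
qed

lemma flux_loop_sat:
  assumes J: "J w m" and s: "main_state z x w" and X: "w 2 = Suc (current I z)" "w 22 = current I z"
    and p: "w 3 = 0" "w 4 = 0" and i: "idle I \<tau> z m0" "0 < indeg I (current I z)"
  shows "sat I J (While_Less c_pos (v_bits base) (Seq (Block main_digit) (Block main_write))) (13 * l + 2)
    (\<lambda>w' m'. kept w w' \<and> w' 3 = l) w m"
proof -
  define Inv where "Inv = (\<lambda>k w' (m'::bool list). kept w w' \<and> k \<le> l \<and> w' 3 = l - k \<and> w' 4 = l - k)"
  have "sat I J (While_Less c_pos (v_bits base) (Seq (Block main_digit) (Block main_write))) ((\<Sum>k<l. 11 + 2) + 2)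
    (\<lambda>w' m'. kept w w' \<and> w' 3 = l) w m"
  proof (rule sat_While[where Inv = Inv and tb = "\<lambda>_. 11"])
    fix k w1 m1 assume J1: "J w1 m1" and inv: "Inv (Suc k) w1 m1"
    define p where "p = l - Suc k"
    have k: "kept w w1" "w1 3 = p" "w1 4 = p" "p < l" "Suc p = l - k" "k \<le> l" using inv by (auto simp: Inv_def p_def)
    have s1: "main_state z x w1" using main_state_kept[OF s k(1)] .
    have X1: "w1 2 = Suc (current I z)" "w1 22 = current I z" using k(1) X by (simp_all add: kept_def)
    have "sat I J (Seq (Block main_digit) (Block main_write)) 11 (Inv k) w1 m1"
    proof (rule sat_SeqI[where ta = 6 and tb = 5])
      show "sat I J (Block main_digit) 6 (\<lambda>w m. J w m \<longrightarrow> sat I J (Block main_write) 5 (Inv k) w m) w1 m1"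
      proof (rule sat_conseq[OF digit_sat[OF J1 s1 X1 k(2,3,4) i] order.refl], intro impI)
        fix w2 m2 assume J2: "J w2 m2" and *: "m2 = m1 \<and> kept w1 w2 \<and> w2 3 = p \<and> w2 4 = Suc p \<and> w2 13 = current I z * l + p"
        have s2: "main_state z x w2" using main_state_kept[OF s1] * by blast
        have X2: "w2 2 = Suc (current I z)" using * X1 by (simp add: kept_def)
        have A: "w2 3 = p" "w2 4 = Suc p" "w2 13 = current I z * l + p" using * by simp_all
        have kt: "kept w w'" if "kept w2 w'" for w'
          using kept_trans[OF k(1) kept_trans[OF _ that]] * by blast
        show "sat I J (Block main_write) 5 (Inv k) w2 m2"
          by (rule sat_conseq[OF write_sat[OF J2 s2 X2 A i] order.refl])
             (use k(5,6) in \<open>simp add: Inv_def kt\<close>)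
      qed
    qed simp
    moreover have "w1 c_pos < w1 (v_bits base)" using k s1 by (simp add: main_state_def)
    ultimately show "w1 c_pos < w1 (v_bits base) \<and> sat I J (Seq (Block main_digit) (Block main_write)) 11 (Inv k) w1 m1"
      by blast
  next
    fix w1 m1 assume "J w1 m1" and inv: "Inv 0 w1 m1"
    have "main_state z x w1" using main_state_kept[OF s] inv by (simp add: Inv_def)
    then show "\<not> w1 c_pos < w1 (v_bits base) \<and> kept w w1 \<and> w1 3 = l" using inv by (simp add: Inv_def main_state_def)
  next
    show "Inv l w m" using p by (simp add: Inv_def kept_refl)
  qed (rule J)
  then show ?thesis by (rule sat_conseq) auto
qed

lemma flux_sat:
  assumes J: "J w m" and s: "main_state z x w" and X: "w 2 = 0" "w 22 = current I z" and l: "0 < l" and z: "z < 4 * N"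
    and w: "w 5 = moved z m mod q + q - reg I m (current I z) mod q"
      "w 7 = (if odd (z div N) then q else moved z m mod q + q - reg I m (current I z) mod q)"
    and d: "0 < indeg I (current I z)"
  shows "sat I J main_flux (13 * l + 5)
    (\<lambda>w' m'. main_state z x w' \<and> idle I \<tau> (Suc z) m' \<and>
       recoverable I \<tau> (Suc z) (w' 2) (w' 3) (w' 4) (w' 5) (w' 6) (w' 7) m') w m"
    (is "sat I J _ _ ?Q w m")
proof -
  let ?W = "While_Less c_pos (v_bits base) (Seq (Block main_digit) (Block main_write))"
  let ?g = "current I z"
  have i: "idle I \<tau> z m" using J_idle[OF J X(1)] s by (simp add: main_state_def)
  have r: "reg I m ?g mod q < q" "moved z m mod q < q" using q_pos by simp_all
  have cq: "w 5 \<le> 2 * q" "w 7 \<le> 2 * q" using w r by auto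
  have c5: "int (w 5) = int (moved z m mod q) + int q - int (reg I m ?g mod q)"
    unfolding w(1) using r by linarith
  \<comment> \<open>Undoing ends at the original value, with \<open>c_diff\<close> standing for 0;
    shifting starts from it, with \<open>c_diff\<close> equal to the change.\<close>
  have cs: "moved z m = reg I \<tau> ?g \<and> w 7 = q \<or> reg I m ?g = reg I \<tau> ?g \<and> w 7 = w 5"
    using idle_current(1)[OF i] moved_eq[OF i] w by (cases "odd (z div N)") simp_all
  note mi = moved_int[of z m]
  from cs have "int (reg I m ?g) + int (w 5) - int (w 7) = int (reg I \<tau> ?g) \<and>
     int (w 7) - int q = int (moved z m) - int (reg I \<tau> ?g)"
  proof (elim disjE conjE)
    assume h: "moved z m = reg I \<tau> ?g" "w 7 = q"
    show ?thesis using mi c5 unfolding h(2) h(1)[symmetric] by linarith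
  next
    assume h: "reg I m ?g = reg I \<tau> ?g" "w 7 = w 5"
    show ?thesis using mi c5 unfolding h(2) h(1)[symmetric] by linarith
  qed
  then have O: "int (reg I m ?g) + int (w 5) - int (w 7) = int (reg I \<tau> ?g)"
    and O': "int (w 7) - int q = int (moved z m) - int (reg I \<tau> ?g)" by simp_all
  have f: "recoverable I \<tau> z (Suc ?g) 0 0 (w 5) (w 6) (w 7) m"
    unfolding writing_def[symmetric] writing_iff[OF i d]
    using in_flux_start[OF l cq O] i by (auto simp: idle_def)
  have [simp]: "w 0 = z" "w 23 = 1" "w 2 = 0" "w 22 = ?g" using s X by (simp_all add: main_state_def)
  have b: "Suc ?g \<le> B" using current_less[of z] big by linarith
  have loop: "sat I J ?W (13 * l + 2) ?Q w1 m"
    if J1: "J w1 m" and k: "w1 0 = w 0" "\<forall>v \<ge> 5. w1 v = w v" "w1 2 = Suc ?g" "w1 3 = 0" "w1 4 = 0" for w1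
  proof -
    have s1: "main_state z x w1" using s k by (simp add: main_state_def)
    have X1: "w1 22 = ?g" using k X by simp
    show ?thesis
    proof (rule sat_conseq[OF flux_loop_sat[OF J1 s1 k(3) X1 k(4,5) i d] order.refl])
      fix w2 m2 assume J2: "J w2 m2" and *: "kept w1 w2 \<and> w2 3 = l"
      have s2: "main_state z x w2" using main_state_kept[OF s1] * by blast
      have X2: "w2 2 = Suc ?g" "w2 7 = w 7" using * k by (simp_all add: kept_def)
      have wr: "writing \<tau> z l (w2 4) (w2 5) (w2 6) (w 7) m2"
        using J_writing[OF J2 _ X2(1)] s2 X2(2) * by (simp add: main_state_def)
      show "?Q w2 m2"
        using s2 X2 * writing_finish[OF i d z wr O'] writing_Suc[OF i d z wr] by simp
    qed
  qed
  show ?thesis unfolding main_flux_def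
  proof (rule sat_SeqI[where ta = 3 and tb = "13 * l + 2"])
    show "sat I J (Block [Const c_pos 0, Const c_pos' 0, Arith Add c_flux (v_reg base) (v_one base)]) 3
      (\<lambda>w m. J w m \<longrightarrow> sat I J ?W (13 * l + 2) ?Q w m) w m"
      supply [[linarith_split_limit = 0]]
      apply (rule sat_BlockI[OF J])
       apply (simp add: b f i)
       apply (intro impI)
       apply (rule loop[simplified])
            apply assumption
           apply simp_all
      done
  qed simp
qed

lemma idle_length: "idle I \<tau> z m \<Longrightarrow> length m = N * l"
  by (simp add: idle_def)

lemma tick_sat:
  assumes J: "J w m" and s: "main_state z x w" and z: "z < 4 * N" and i: "idle I \<tau> (Suc z) m"
    and R: "recoverable I \<tau> (Suc z) (w 2) (w 3) (w 4) (w 5) (w 6) (w 7) m"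
  shows "sat I J (Block [Arith Add c_time c_time (v_one base), Const c_flux 0]) 2
    (\<lambda>w' m'. main_state (Suc z) x w' \<and> w' 2 = 0) w m"
proof -
  have [simp]: "w 0 = z" "w 23 = 1" using s by (simp_all add: main_state_def)
  have "Suc z \<le> B" using z big by linarith
  with R i s show ?thesis
    by (intro sat_BlockI[OF J]) (simp_all add: main_state_def)
qed

text \<open>The coefficient 29 is 16 for scanning a bit plus 13 for rewriting it; per step only one
  register is rewritten, whatever its in-degree.\<close>

lemma body_sat:
  assumes J: "J w m" and s: "main_state z (outcome I \<tau> z) w" and X: "w 2 = 0" and z: "z < 4 * N" and l: "0 < l"
  shows "sat I J main_body ((indeg I (current I z) + 1) * (29 * l + 75))
    (\<lambda>w' m'. main_state (Suc z) (outcome I \<tau> (Suc z)) w' \<and> w' 2 = 0) w m"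
proof -
  let ?g = "current I z" and ?o = "outcome I \<tau>"
  let ?G = "(indeg I ?g + 1) * (16 * l + 25)"
  let ?Q = "\<lambda>w' (m' :: bool list). main_state (Suc z) (?o (Suc z)) w' \<and> w' 2 = 0"
  let ?C7 = "Block [Arith Add c_time c_time (v_one base), Const c_flux 0]"
  let ?C6 = "Seq (If_Less (v_zero base) (v_deg base) main_flux (Block [])) ?C7"
  let ?C5 = "Seq (If_Less (v_zero base) c_u (Block main_output) (Block [])) ?C6"
  let ?C4 = "Seq (Block main_output_test) ?C5"
  let ?C3 = "Seq (Block main_difference) ?C4"
  let ?C2 = "Seq (gather base) ?C3"
  let ?C1 = "Seq (Block (prepare base)) ?C2"
  have c: "8 \<le> base" "base + 23 \<le> 40" by simp_all
  have r2: "phase_run I z \<le> 2" using phase_run_le z by simp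
  have "sat I J main_body (11 + (6 + (?G + (12 + (5 + (5 + ((13 * l + 5 + 2) + 2))))))) ?Q w m"
    unfolding main_body_def
  proof (rule sat_SeqR[OF locate_sat[OF J s X z] _ order.refl])
    fix w1 m1 assume J1: "J w1 m1" and "m1 = m \<and> main_state z (?o z) w1 \<and> w1 2 = 0 \<and>
      w1 10 = of_bool (odd (z div N)) \<and> w1 21 = phase_run I z \<and> w1 22 = ?g"
    then have 1: "m1 = m" "main_state z (?o z) w1" "w1 2 = 0" "w1 10 = of_bool (odd (z div N))"
      "w1 21 = phase_run I z" "w1 22 = ?g" by simp_all
    have g1: "w1 (v_reg base) = ?g" using 1 by simp
    show "sat I J ?C1
       (6 + (?G + (12 + (5 + (5 + ((13 * l + 5 + 2) + 2)))))) ?Q w1 m1"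
    proof (rule sat_SeqR[OF prepare_sat[OF c main_state_consts[OF 1(2)] g1 current_less J1] _ order.refl])
      fix w2 m2 assume J2: "J w2 m2" and "m2 = m1 \<and> (\<forall>x<base + 8. w2 x = w1 x) \<and>
        w2 (v_layer base) = ?g div n \<and> w2 (v_vert base) = ?g mod n \<and> w2 (v_deg base) = indeg I ?g"
      then have 2: "m2 = m" "\<forall>x<25. w2 x = w1 x" "w2 (v_layer base) = ?g div n" "w2 (v_vert base) = ?g mod n" "w2 (v_deg base) = indeg I ?g"
        using 1 by simp_all
      have s2: "main_state z (?o z) w2" using main_state_frame[OF 1(2)] 2(2) by simp
      have h2: "w2 (v_reg base) = ?g" "w2 (v_run base) = phase_run I z" "w2 2 = 0" using 2(2) 1 by simp_all
      have i2: "idle I \<tau> z m2" using J_idle[OF J2 h2(3)] s2 by (simp add: main_state_def)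
      show "sat I J ?C2
       (?G + (12 + (5 + (5 + ((13 * l + 5 + 2) + 2))))) ?Q w2 m2"
      proof (rule sat_SeqR[OF gather_sat[OF c main_state_consts[OF s2] h2(1) current_less 2(3-5) h2(2) r2 idle_length[OF i2] J2] _ order.refl])
        fix w3 m3 assume J3: "J w3 m3" and "m3 = m2 \<and> (\<forall>x<base + 11. w3 x = w2 x) \<and>
          w3 (v_res base) = reg I m2 ?g mod q \<and> w3 (v_sum base) = increment I (phase_run I z) (reg I m2) ?g"
        then have 3: "m3 = m" "\<forall>x<28. w3 x = w2 x" "w3 35 = reg I m3 ?g mod q" "w3 31 = increment I (phase_run I z) (reg I m3) ?g"
          using 2 by simp_all
        have s3: "main_state z (?o z) w3" using main_state_frame[OF s2] 3(2) by simp
        have h3: "w3 2 = 0" "w3 10 = of_bool (odd (z div N))" using 3(2) 2(2) 1 by simp_all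
        show "sat I J ?C3
         (12 + (5 + (5 + ((13 * l + 5 + 2) + 2)))) ?Q w3 m3"
        proof (rule sat_SeqR[OF difference_sat[OF J3 s3 h3(1) z h3(2) 3(3,4)] _ order.refl])
          fix w4 m4 assume J4: "J w4 m4" and 4: "m4 = m3 \<and> (\<forall>v\<ge>17. w4 v = w3 v) \<and> main_state z (?o z) w4 \<and> w4 2 = 0 \<and>
             w4 13 = moved z m3 mod q \<and> w4 14 = of_bool (even (z div N)) \<and>
             w4 5 = moved z m3 mod q + q - reg I m3 ?g mod q \<and>
             w4 7 = (if odd (z div N) then q else moved z m3 mod q + q - reg I m3 ?g mod q)"
          have 4: "m4 = m" "\<forall>v\<ge>17. w4 v = w3 v" "main_state z (?o z) w4" "w4 2 = 0"
             "w4 13 = moved z m4 mod q" "w4 14 = of_bool (even (z div N))"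
             "w4 5 = moved z m4 mod q + q - reg I m4 ?g mod q"
             "w4 7 = (if odd (z div N) then q else moved z m4 mod q + q - reg I m4 ?g mod q)"
            using 4 3(1) by simp_all
          have h4: "w4 22 = ?g" "w4 27 = indeg I ?g" using 4(2) 3(2) 2(2,5) 1 by simp_all
          show "sat I J ?C4
           (5 + (5 + ((13 * l + 5 + 2) + 2))) ?Q w4 m4"
          proof (rule sat_SeqR[OF output_test_sat[OF J4 4(3,4,6) h4(1) current_less] _ order.refl])
            fix w5 m5 assume J5: "J w5 m5" and "m5 = m4 \<and> (\<forall>v. v \<noteq> 15 \<and> v \<noteq> 16 \<longrightarrow> w5 v = w4 v) \<and>
              w5 15 = of_bool (?g = target I \<and> even (z div N))"
            then have 5: "m5 = m4" "\<And>v. v \<noteq> 15 \<Longrightarrow> v \<noteq> 16 \<Longrightarrow> w5 v = w4 v"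
              "w5 15 = of_bool (?g = target I \<and> even (z div N))" by simp_all
            have s5: "main_state z (?o z) w5" using 4(3) by (simp add: main_state_def 5(2))
            have h5: "w5 2 = 0" "w5 13 = moved z m5 mod q" using 4 5 by simp_all
            show "sat I J 
             ?C5
             (5 + ((13 * l + 5 + 2) + 2)) ?Q w5 m5"
            proof (rule sat_SeqR[OF output_sat[OF J5 s5 h5(1) z h5(2) 5(3)] _ order.refl])
              fix w6 m6 assume J6: "J w6 m6" and "m6 = m5 \<and> (\<forall>v. v \<noteq> 9 \<and> v \<noteq> 13 \<longrightarrow> w6 v = w5 v) \<and>
                main_state z (?o (Suc z)) w6"
              then have 6: "m6 = m4" "\<And>v. v \<noteq> 9 \<Longrightarrow> v \<noteq> 13 \<Longrightarrow> w6 v = w5 v" "main_state z (?o (Suc z)) w6"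
                using 5(1) by simp_all
              have h6: "w6 2 = 0" "w6 22 = ?g" "w6 27 = indeg I ?g"
                "w6 5 = moved z m6 mod q + q - reg I m6 ?g mod q"
                "w6 7 = (if odd (z div N) then q else moved z m6 mod q + q - reg I m6 ?g mod q)"
                using 4 h4 by (simp_all add: 5(2) 6(1,2))
              have i6: "idle I \<tau> z m6" using J_idle[OF J6 h6(1)] 6(3) by (simp add: main_state_def)
              let ?P = "\<lambda>w' m'. main_state z (?o (Suc z)) w' \<and> idle I \<tau> (Suc z) m' \<and>
                 recoverable I \<tau> (Suc z) (w' 2) (w' 3) (w' 4) (w' 5) (w' 6) (w' 7) m'"
              have "sat I J (If_Less (v_zero base) (v_deg base) main_flux (Block [])) (13 * l + 5 + 2) ?P w6 m6"
              proof (rule sat_If)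
                show "J w6 m6" by (rule J6)
                assume "w6 (v_zero base) < w6 (v_deg base)"
                then have "0 < indeg I ?g" using h6(3) 6(3) by (simp add: main_state_def)
                from flux_sat[OF J6 6(3) h6(1,2) l z h6(4,5) this]
                show "sat I J main_flux (13 * l + 5) ?P w6 m6" .
              next
                assume "\<not> w6 (v_zero base) < w6 (v_deg base)"
                then have "indeg I ?g = 0" using h6(3) 6(3) by (simp add: main_state_def)
                with idle_Suc_indeg_0[OF i6 z] J6 6(3) h6(1)
                show "sat I J (Block []) (13 * l + 5) ?P w6 m6" by (intro sat_Nil) simp_all
              qed
              then show "sat I J ?C6 ((13 * l + 5 + 2) + 2) ?Q w6 m6"
                by (rule sat_SeqR[OF _ _ order.refl]) (use tick_sat z in blast)
            qed
          qed
        qed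
      qed
    qed
  qed
  then show ?thesis
    by (rule sat_conseq) (simp_all add: algebra_simps)
qed

text \<open>Charging each step by its own in-degree, rather than by the maximum, is what later
  produces the number of arcs.\<close>

definition loop_time :: nat where
  "loop_time = (\<Sum>k<4 * N. (indeg I (current I (4 * N - Suc k)) + 1) * (29 * l + 75) + 2) + 2"

lemma loop_sat:
  assumes J: "J w m" and s: "main_state 0 0 w" and X: "w 2 = 0" and l: "0 < l"
  shows "sat I J (While_Less c_time c_end main_body) loop_time
    (\<lambda>w' m'. w' 9 = outcome I \<tau> (4 * N) \<and> idle I \<tau> (4 * N) m') w m"
proof -
  define Inv where "Inv = (\<lambda>k w (m :: bool list). k \<le> 4 * N \<and> main_state (4 * N - k) (outcome I \<tau> (4 * N - k)) w \<and> w 2 = 0)"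
  show ?thesis unfolding loop_time_def
  proof (rule sat_While[where Inv = Inv])
    fix k w m assume J: "J w m" and inv: "Inv (Suc k) w m"
    define z where "z = 4 * N - Suc k"
    have z: "z < 4 * N" "Suc z = 4 * N - k" "main_state z (outcome I \<tau> z) w" "w 2 = 0" "k \<le> 4 * N"
      using inv by (auto simp: Inv_def z_def)
    have "w c_time < w c_end" using z by (simp add: main_state_def)
    moreover have "sat I J main_body ((indeg I (current I z) + 1) * (29 * l + 75)) (Inv k) w m"
      by (rule sat_conseq[OF body_sat[OF J z(3,4,1) l] order.refl]) (use z(2,5) in \<open>simp add: Inv_def\<close>)
    ultimately show "w c_time < w c_end \<and> sat I J main_body
       ((indeg I (current I (4 * N - Suc k)) + 1) * (29 * l + 75)) (Inv k) w m" by (simp add: z_def)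
  next
    fix w m assume J: "J w m" and inv: "Inv 0 w m"
    then have "main_state (4 * N) (outcome I \<tau> (4 * N)) w" "w 2 = 0" by (simp_all add: Inv_def)
    with J_idle[OF J] show "\<not> w c_time < w c_end \<and> w 9 = outcome I \<tau> (4 * N) \<and> idle I \<tau> (4 * N) m"
      by (simp add: main_state_def)
  next
    show "Inv (4 * N) w m" using s X by (simp add: Inv_def outcome_def)
  qed (rule J)
qed

lemma idle_initial: "length \<tau> = N * l \<Longrightarrow> idle I \<tau> 0 \<tau>"
  by (simp add: idle_def front_def)

text \<open>At time \<open>4 * N\<close> the front is back at 0, so no register is shifted.\<close>

lemma idle_final: "idle I \<tau> (4 * N) m \<Longrightarrow> length \<tau> = N * l \<Longrightarrow> m = \<tau>"
  by (rule reg_ext[of _ I]) (use N_pos in \<open>auto simp: idle_def front_def\<close>)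

definition main_time :: nat where
  "main_time = 22 + (if 0 < path_len I * l then loop_time else 0)"

lemma main_sat:
  assumes len: "length \<tau> = N * l"
  shows "sat I J main_com main_time
    (\<lambda>w' m'. w' 9 = (if 0 < path_len I * l then outcome I \<tau> (4 * N) else of_bool (src I = dst I) mod q) \<and> m' = \<tau>)
    (\<lambda>_. 0) \<tau>" (is "sat I J _ _ ?Q _ _")
proof -
  let ?t = "if 0 < path_len I * l then loop_time else 0"
  have J0: "J (\<lambda>_. 0) \<tau>" using idle_initial[OF len] by (simp add: J_def)
  have i: "idle I \<tau> 0 \<tau>" by (rule idle_initial[OF len])
  have Tn: "path_len I * n + n = N" "path_len I * l \<le> N * l" "n + path_len I * n = N"
    using mult_le_mono[of "path_len I" "path_len I + 1" 1 n] n_pos by (simp_all add: nregs_def)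
  have tB: "path_len I * n + dst I \<le> B" "path_len I * n \<le> B" using target_less big by (simp_all add: target_def)
  have B: "n \<le> B" "l \<le> B" "q \<le> B" "src I \<le> B" "dst I \<le> B" "Suc 0 \<le> B" "path_len I \<le> B" "Suc (path_len I) \<le> B" "N \<le> B"
     "N + N \<le> B" "4 * N \<le> B" "path_len I * l \<le> B" "N + N + (N + N) \<le> B"
    using n_le_B src_less dst_less Tn big by - linarith+
  have "sat I J main_com (6 + (9 + (7 + ?t))) ?Q (\<lambda>_. 0) \<tau>"
    unfolding main_com_def
  proof (rule sat_SeqR[where ta = 6 and tb = "9 + (7 + ?t)"
        and P = "\<lambda>w m. m = \<tau> \<and> (\<forall>v < 17. w v = 0) \<and> w 17 = n \<and> w 18 = l \<and> w 19 = q \<and> w 20 = src I \<and> w 23 = 1 \<and> w 24 = 0"])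
    show "sat I J (Block (load_params base)) 6 (\<lambda>w m. m = \<tau> \<and> (\<forall>v < 17. w v = 0) \<and> w 17 = n \<and> w 18 = l \<and> w 19 = q \<and> w 20 = src I \<and> w 23 = 1 \<and> w 24 = 0) (\<lambda>_. 0) \<tau>"
      by (rule sat_BlockI[OF J0]) (simp_all add: load_params_def B i)
  next
    fix w m assume J1: "J w m" and "m = \<tau> \<and> (\<forall>v < 17. w v = 0) \<and> w 17 = n \<and> w 18 = l \<and> w 19 = q \<and> w 20 = src I \<and> w 23 = 1 \<and> w 24 = 0"
    then have w: "m = \<tau>" "\<And>v. v < 17 \<Longrightarrow> w v = 0" "w 17 = n" "w 18 = l" "w 19 = q" "w 20 = src I" "w 23 = 1" "w 24 = 0"
      by simp_all
    show "sat I J (Seq (Block main_init) (If_Less (v_zero base) c_u (While_Less c_time c_end main_body) (Block main_trivial)))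
       (9 + (7 + ?t)) ?Q w m"
    proof (rule sat_SeqR[where ta = 9 and tb = "7 + ?t" and P = "\<lambda>w m. m = \<tau> \<and> main_state 0 0 w \<and> w 2 = 0 \<and> w 14 = dst I \<and> w 15 = path_len I * l"])
      show "sat I J (Block main_init) 9 (\<lambda>w m. m = \<tau> \<and> main_state 0 0 w \<and> w 2 = 0 \<and> w 14 = dst I \<and> w 15 = path_len I * l) w m"
        using [[linarith_split_limit = 0]]
        by (rule sat_BlockI[OF J1]) (simp_all add: main_init_def B tB i w main_state_def target_def Tn)
    next
      fix w m assume J2: "J w m" and *: "m = \<tau> \<and> main_state 0 0 w \<and> w 2 = 0 \<and> w 14 = dst I \<and> w 15 = path_len I * l"
      have "sat I J (If_Less (v_zero base) c_u (While_Less c_time c_end main_body) (Block main_trivial)) (5 + ?t + 2) ?Q w m"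
      proof (rule sat_If)
        show "J w m" by (rule J2)
        assume "w (v_zero base) < w c_u"
        then have p: "0 < path_len I * l" using * by (simp add: main_state_def)
        then have "0 < l" by simp
        with * have "sat I J (While_Less c_time c_end main_body) loop_time
          (\<lambda>w' m'. w' 9 = outcome I \<tau> (4 * N) \<and> idle I \<tau> (4 * N) m') w m" by (intro loop_sat[OF J2]) auto
        then show "sat I J (While_Less c_time c_end main_body) (5 + ?t) ?Q w m"
          by (rule sat_conseq) (use p idle_final len in auto)
      next
        assume "\<not> w (v_zero base) < w c_u"
        then have p: "path_len I * l = 0" using * by (simp add: main_state_def)
        have w: "w 0 = 0" "w 2 = 0" "w 20 = src I" "w 14 = dst I" "w 23 = 1" "w 19 = q" "m = \<tau>"
          using * by (simp_all add: main_state_def)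
        have b: "src I - dst I \<le> B" "dst I - src I \<le> B" "src I - dst I + (dst I - src I) \<le> B" "of_bool P \<le> B" "of_bool P mod q \<le> B" for P
          using B(4,5,6) mod_less_eq_dividend[of "of_bool P" q] by (auto intro: order.trans)
        have e: "1 - (src I - dst I + (dst I - src I)) = of_bool (src I = dst I)" by auto
        show "sat I J (Block main_trivial) (5 + ?t) ?Q w m"
          using [[linarith_split_limit = 0]]
          by (rule sat_BlockI[OF J2]) (simp_all add: main_trivial_def b e i w p del: One_nat_def)
      qed
      then show "sat I J (If_Less (v_zero base) c_u (While_Less c_time c_end main_body) (Block main_trivial)) (7 + ?t) ?Q w m"
        by (rule sat_conseq) auto
    qed simp
  qed simp
  then show ?thesis unfolding main_time_def by (rule sat_conseq) auto
qed

end

section \<open>The query routine\<close>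

text \<open>The work cell \<open>x\<close> of the paused computation is cell \<open>x + 2\<close> here.\<close>

abbreviation (input) "k_answer \<equiv> 0 :: nat"
abbreviation (input) "k_index \<equiv> 1 :: nat"
abbreviation (input) "k_bit \<equiv> 42 :: nat"
abbreviation (input) "k_regs \<equiv> 43 :: nat"
abbreviation (input) "k_front \<equiv> 44 :: nat"
abbreviation (input) "k_diff \<equiv> 45 :: nat"
abbreviation (input) "k_pos \<equiv> 46 :: nat"
abbreviation (input) "k_acc \<equiv> 47 :: nat"
abbreviation (input) "k_cur \<equiv> 48 :: nat"
abbreviation (input) "k_end \<equiv> 49 :: nat"
abbreviation (input) "k_x \<equiv> 50 :: nat"
abbreviation (input) "k_y \<equiv> 51 :: nat"
abbreviation (input) "k_u \<equiv> 52 :: nat"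
abbreviation (input) "k_digit \<equiv> 53 :: nat"
abbreviation (input) "k_read \<equiv> 54 :: nat"
abbreviation (input) "k_two \<equiv> 55 :: nat"
abbreviation (input) "k_v \<equiv> 56 :: nat"
abbreviation (input) "k_w \<equiv> 57 :: nat"
abbreviation (input) "qbase \<equiv> 60 :: nat"

definition query_init :: "instr list" where
  "query_init =
    [Param k_v Path_Len,
     Arith Add k_regs k_v (v_one qbase),
     Arith Mul k_regs k_regs (v_num qbase),
     Arith Div (v_reg qbase) k_index (v_bits qbase),
     Arith Mod k_bit k_index (v_bits qbase),
     Arith Div k_v (c_time + 2) k_regs,
     Arith Mod k_w (c_time + 2) k_regs,
     Const k_two 2,
     Arith Mod k_y k_v k_two,
     Arith Div (v_run qbase) k_v k_two,
     Arith Sub k_x k_regs k_w,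
     Arith Mul k_x k_x k_y,
     Arith Sub k_u (v_one qbase) k_y,
     Arith Mul k_u k_u k_w,
     Arith Add k_front k_x k_u]"

text \<open>\<open>k_x\<close> is the distance between announced and queried register, both counted
  from 1; it is 0 iff the queried register is being written.\<close>

definition query_flux_test :: "instr list" where
  "query_flux_test =
    [Arith Add k_v (v_reg qbase) (v_one qbase),
     Arith Sub k_x (c_flux + 2) k_v,
     Arith Sub k_y k_v (c_flux + 2),
     Arith Add k_x k_x k_y]"

definition query_flux :: "instr list" where
  "query_flux =
    [Arith Add k_diff (c_diff + 2) (v_zero qbase),
     Arith Add k_pos (c_pos + 2) (v_zero qbase)]"

definition query_unshifted :: "instr list" where
  "query_unshifted =
    [Arith Add k_diff (v_mod qbase) (v_zero qbase),
     Arith Add k_pos (v_bits qbase) (v_zero qbase)]"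

text \<open>\<open>k_v\<close> becomes the residue of the original, and \<open>k_diff\<close> the
  excess of the present residue over it, with offset \<open>q\<close>. No carry is pending, so
  \<open>k_pos\<close> is set to \<open>l\<close>, a position that the scan never reaches.\<close>

definition query_shifted :: "instr list" where
  "query_shifted =
    [Arith Sub k_v (v_mod qbase) (v_sum qbase),
     Arith Add k_v k_v (v_res qbase),
     Arith Mod k_v k_v (v_mod qbase),
     Arith Add k_diff (v_res qbase) (v_mod qbase),
     Arith Sub k_diff k_diff k_v,
     Arith Add k_pos (v_bits qbase) (v_zero qbase)]"

text \<open>The accumulator carries the offset \<open>2 * q\<close>, so
  \<open>3 * q - k_diff\<close> stands for the initial carry \<open>q - k_diff\<close>.\<close>

definition query_scan_init :: "instr list" where
  "query_scan_init =
    [Arith Add k_acc (v_mod qbase) (v_mod qbase),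
     Arith Add k_acc k_acc (v_mod qbase),
     Arith Sub k_acc k_acc k_diff,
     Const k_cur 0,
     Arith Add k_end k_bit (v_one qbase),
     Const k_two 2]"

definition query_digit :: "instr list" where
  "query_digit =
    [Arith Mul k_v (v_reg qbase) (v_bits qbase),
     Arith Add k_v k_v k_cur,
     Cat_Read k_read k_v,
     Arith Add k_digit k_read (v_mod qbase),
     Arith Add k_digit k_digit (v_mod qbase),
     Arith Sub k_x k_cur k_pos,
     Arith Sub k_y k_pos k_cur,
     Arith Add k_x k_x k_y]"

definition query_special_digit :: com where
  "query_special_digit =
    If_Less (v_zero qbase) k_x (Block [])
      (If_Less (c_pos + 2) (c_pos' + 2)
        (Block [Arith Add k_digit (c_digit + 2) (v_zero qbase)])
        (Block [Arith Add k_digit k_read (c_carry + 2),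
                Arith Add k_digit k_digit (v_mod qbase)]))"

text \<open>Accumulator and digit both have the offset \<open>2 * q\<close>, which halving their sum
  restores. Every round overwrites the answer, and the last round is that of the queried
  bit.\<close>

definition query_carry :: "instr list" where
  "query_carry =
    [Arith Add k_acc k_acc k_digit,
     Arith Mod k_answer k_acc k_two,
     Arith Div k_acc k_acc k_two,
     Arith Add k_cur k_cur (v_one qbase)]"

definition query_scan :: com where
  "query_scan =
    Seq (Block query_scan_init)
        (While_Less k_cur k_end
          (Seq (Block query_digit) (Seq query_special_digit (Block query_carry))))"

definition query_select :: com where
  "query_select =
    Seq (Block query_flux_test)
        (If_Less (v_zero qbase) k_x
          (If_Less (v_reg qbase) k_front (Block query_shifted) (Block query_unshifted))
          (Block query_flux))"

text \<open>These are cells 40 and above of the paused computation, all of which are 0 there;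
  clearing them therefore restores them.\<close>

definition query_clear :: "instr list" where
  "query_clear = map (\<lambda>x. Const x 0) [42..<83]"

text \<open>The direct read in the last branch is correct because a register without in-neighbours
  is never written, and it keeps the time constant when the maximal in-degree is 0.\<close>

definition query_com :: com where
  "query_com =
    Seq (Block (load_params qbase))
   (Seq (Block query_init)
   (Seq (Block (prepare qbase))
   (Seq (If_Less (v_zero qbase) (v_deg qbase)
          (Seq (gather qbase) (Seq query_select query_scan))
          (Block [Cat_Read k_answer k_index]))
        (Block query_clear))))"

section \<open>Reconstructing an original bit from digits with pending carries\<close>

context monitored
begin

text \<open>A register that is not announced is in the state indicated by the front, even while
  another one is being written. If it is shifted, so are all smaller ones, in particular its
  in-neighbours.\<close>

lemma recoverable_regs:
  assumes "recoverable I \<tau> z X p p' c s d m" "X \<noteq> Suc g" "g < N"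
  shows "g < front I z \<Longrightarrow> g' \<le> g \<Longrightarrow> reg I m g' = S \<tau> (phase_run I z) g'"
    and "\<not> g < front I z \<Longrightarrow> reg I m g = reg I \<tau> g"
proof -
  show "reg I m g' = S \<tau> (phase_run I z) g'" if "g < front I z" "g' \<le> g"
  proof (cases "X = 0")
    case True
    then show ?thesis using assms that by (simp add: idle_def)
  next
    case False
    then have f: "front I z = X - 1 \<or> front I z = X" "\<forall>g < X - 1. reg I m g = S \<tau> (phase_run I z) g"
      using assms(1) by (auto simp: recoverable_def)
    then have "g' < X - 1" using that assms(2) False by linarith
    then show ?thesis using f by blast
  qed
  show "reg I m g = reg I \<tau> g" if "\<not> g < front I z"
  proof (cases "X = 0")
    case True
    then show ?thesis using assms that by (simp add: idle_def)
  next
    case False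
    then have f: "front I z = X - 1 \<or> front I z = X" "\<forall>g < N. X \<le> g \<longrightarrow> reg I m g = reg I \<tau> g"
      using assms(1) by (auto simp: recoverable_def)
    then have "X \<le> g" using that assms(2) False by linarith
    then show ?thesis using f assms(3) by blast
  qed
qed

text \<open>
  Digits and differences carry offsets, as in \<open>virtual\<close>. Every register under query is the
  number with digits \<open>digit k - 2 q\<close>, minus \<open>d - q\<close>.
\<close>

definition digit :: "bool list \<Rightarrow> nat \<Rightarrow> nat \<Rightarrow> nat \<Rightarrow> nat \<Rightarrow> nat \<Rightarrow> nat \<Rightarrow> nat \<Rightarrow> nat" where
  "digit m g P p p' c s k =
     (if k = P then if p < p' then s else of_bool (m ! (g * l + k)) + c + q
      else of_bool (m ! (g * l + k)) + q + q)"

definition recovers where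
  "recovers \<tau> m g p p' c s d P \<longleftrightarrow> d \<le> 2 * q \<and>
     (P < l \<longrightarrow> P = p \<and> c \<le> 2 * q \<and> (p < p' \<longrightarrow> s \<le> 3 * q + 1)) \<and>
     2 ^ l dvd (\<Sum>k<l. (int (digit m g P p p' c s k) - 2 * int q) * 2 ^ k) - (int d - int q) - int (reg I \<tau> g)"

lemma reg_int_sum:
  assumes "length m = N * l" "g < N"
  shows "int (reg I m g) = (\<Sum>k<l. of_bool (m ! (g * l + k)) * 2 ^ k)"
  unfolding reg_eq_sum[OF assms] by simp

text \<open>Replacing the digit at position \<open>p\<close> by bit plus carry, or by
  \<open>s\<close>, yields exactly the number \<open>virtual\<close>.\<close>

lemma recovers_flux:
  assumes m: "length m = N * l" "g < N" and f: "in_flux I m g p p' c s d (reg I \<tau> g)"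
  shows "recovers \<tau> m g p p' c s d p"
proof -
  have "(\<Sum>k<l. (int (digit m g p p p' c s k) - 2 * int q) * 2 ^ k) = virtual I m g p p' c s"
  proof (cases "p < l")
    case True
    define r where "r = (\<Sum>k\<in>{..<l} - {p}. of_bool (m ! (g * l + k)) * (2 :: int) ^ k)"
    have "(\<Sum>k<l. (int (digit m g p p p' c s k) - 2 * int q) * 2 ^ k) =
       (int (digit m g p p p' c s p) - 2 * int q) * 2 ^ p + r"
      using True unfolding r_def by (subst sum.remove[of _ p]) (auto simp: digit_def intro!: sum.cong)
    moreover have "int (reg I m g) = of_bool (m ! (g * l + p)) * 2 ^ p + r"
      using True unfolding r_def by (subst reg_int_sum[OF m], subst sum.remove[of _ p]) auto
    moreover have "virtual I m g p p' c s =
       int (reg I m g) + (int (digit m g p p p' c s p) - 2 * int q - of_bool (m ! (g * l + p))) * 2 ^ p"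
      using True f by (auto simp: virtual_def digit_def in_flux_def)
    ultimately show ?thesis by (simp only: left_diff_distrib)
  next
    case False
    then show ?thesis using reg_int_sum[OF m] by (auto simp: virtual_def digit_def intro!: sum.cong)
  qed
  then show ?thesis using f by (auto simp: recovers_def in_flux_def)
qed

lemma recovers_still:
  assumes m: "length m = N * l" "g < N" and d: "d \<le> 2 * q" "int (reg I m g) - (int d - int q) = int (reg I \<tau> g)"
  shows "recovers \<tau> m g p p' c s d l"
proof -
  have "(\<Sum>k<l. (int (digit m g l p p' c s k) - 2 * int q) * 2 ^ k) = int (reg I m g)"
    unfolding reg_int_sum[OF m] by (auto simp: digit_def intro!: sum.cong)
  then show ?thesis using d by (simp add: recovers_def)
qed

lemma recovers_shifted:
  assumes rec: "recoverable I \<tau> z X p p' c s d' m" and X: "X \<noteq> Suc g" and g: "g < N" "g < front I z"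
    and d: "r = reg I m g mod q" "a = increment I (phase_run I z) (reg I m) g" "d = r + q - (q - a + r) mod q"
  shows "recovers \<tau> m g p p' c s d l"
proof (rule recovers_still[OF _ g(1)])
  note sh = recoverable_regs(1)[OF rec X g]
  have "shift I (reg I m g) (q - a) = reg I \<tau> g" unfolding d(2)
    by (rule unshift_increment) (use sh pred_reg_less_N[OF g(1)] in \<open>auto intro: less_imp_le\<close>)
  then have "int (reg I \<tau> g) = int (reg I m g) - int r + int ((r + (q - a)) mod q)"
    unfolding d(1) using int_shift by metis
  moreover have "(q - a + r) mod q < q" "r < q" using q_pos d(1) by simp_all
  moreover have "(r + (q - a)) mod q = (q - a + r) mod q" by (simp only: add.commute)
  ultimately show "d \<le> 2 * q" "int (reg I m g) - (int d - int q) = int (reg I \<tau> g)"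
    unfolding d(3) by linarith+
qed (use rec in \<open>auto simp: recoverable_def\<close>)

lemma recovers_unshifted:
  assumes rec: "recoverable I \<tau> z X p p' c s d' m" and X: "X \<noteq> Suc g" and g: "g < N" "\<not> g < front I z"
  shows "recovers \<tau> m g p p' c s q l"
  by (rule recovers_still[OF _ g(1)]) (use rec recoverable_regs(2)[OF rec X g] in \<open>auto simp: recoverable_def\<close>)

text \<open>A base-two numeral with arbitrary integer digits \<open>D\<close>, less
  \<open>e\<close>; its quotient by \<open>2 ^ k\<close> is the carry into position
  \<open>k\<close>.\<close>

definition partial_sum where
  "partial_sum D e k = (\<Sum>i<k. D i * 2 ^ i) - (e :: int)" for D :: "nat \<Rightarrow> int"

lemma partial_sum_Suc: "partial_sum D e (Suc k) = partial_sum D e k + D k * 2 ^ k"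
  by (simp add: partial_sum_def)

lemma partial_sum_div: "partial_sum D e (Suc k) div 2 ^ k = partial_sum D e k div 2 ^ k + D k"
  by (simp add: partial_sum_Suc)

lemma partial_sum_div_Suc:
  "partial_sum D e (Suc k) div 2 ^ Suc k = (partial_sum D e k div 2 ^ k + D k) div 2"
  unfolding power_Suc2 by (subst zdiv_zmult2_eq) (simp_all add: partial_sum_div)

text \<open>Digits beyond position \<open>k\<close> contribute multiples of
  \<open>2 ^ Suc k\<close>, so bit \<open>k\<close> is settled below them: it is the parity of digit
  plus carry. Floor division makes this correct for negative carries and oversized digits
  too.\<close>

lemma bit_partial_sum:
  assumes "2 ^ t dvd partial_sum D e t - int x" "k < t"
  shows "odd (partial_sum D e k div 2 ^ k + D k) \<longleftrightarrow> bit x k"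
proof -
  have "2 ^ Suc k dvd partial_sum D e t - partial_sum D e (Suc k)"
    using Suc_leI[OF assms(2)]
  proof (induction t rule: dec_induct)
    case (step i)
    have "(2::int) ^ Suc k dvd 2 ^ i" using step(1) by (rule le_imp_power_dvd)
    then have "2 ^ Suc k dvd D i * 2 ^ i" by (rule dvd_mult)
    with step.IH have "2 ^ Suc k dvd (partial_sum D e i - partial_sum D e (Suc k)) + D i * 2 ^ i"
      by (rule dvd_add)
    moreover have "partial_sum D e (Suc i) - partial_sum D e (Suc k) =
      (partial_sum D e i - partial_sum D e (Suc k)) + D i * 2 ^ i" unfolding partial_sum_Suc[of D e i] by simp
    ultimately show ?case by (simp only:)
  qed simp
  moreover have "2 ^ Suc k dvd partial_sum D e t - int x"
    using le_imp_power_dvd[OF Suc_leI[OF assms(2)]] assms(1) by (rule dvd_trans)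
  ultimately have "2 ^ Suc k dvd (partial_sum D e t - int x) - (partial_sum D e t - partial_sum D e (Suc k))"
    using dvd_diff by blast
  then obtain h where "partial_sum D e (Suc k) - int x = 2 ^ Suc k * h" by (auto elim!: dvdE)
  then have "partial_sum D e (Suc k) = int x + (2 * h) * 2 ^ k" by (simp add: algebra_simps)
  then have "partial_sum D e (Suc k) div 2 ^ k = int x div 2 ^ k + 2 * h" by (simp only: div_mult_self1) simp
  then have "odd (partial_sum D e k div 2 ^ k + D k) \<longleftrightarrow> odd (int x div 2 ^ k)" by (simp add: partial_sum_div)
  also have "int x div 2 ^ k = int (x div 2 ^ k)" by (simp add: zdiv_int)
  finally show ?thesis by (simp add: bit_iff_odd)
qed

end

section \<open>Verification of the query routine\<close>

locale query_run =
  fixes I :: problem and \<tau> :: "bool list" and B :: nat and v :: "nat \<Rightarrow> nat" and m :: "bool list" and j :: nat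
  assumes well_formed: "well_formed I"
    and bound: "8 * (nregs I * reg_bits I) + 8 * nregs I + 8 * reg_bits I + 8 * path_len I + 8 * modulus I + 16 \<le> B"
    and length_\<tau>: "length \<tau> = nregs I * reg_bits I"
    and rec: "recoverable I \<tau> (v c_time) (v c_flux) (v c_pos) (v c_pos') (v c_carry) (v c_digit) (v c_diff) m"
    and v_le: "v x \<le> B" and v_0: "40 \<le> x \<Longrightarrow> v x = 0"
    and j: "j < nregs I * reg_bits I"
begin

text \<open>A query is not itself interrupted, so there is nothing to monitor but the size of the
  cells; 83 is \<open>qbase + 23\<close>.\<close>

sublocale monitored I B 83 0 "\<lambda>_ _. True"
  by unfold_locales (use well_formed bound in auto)

definition g :: nat where "g = j div l"
definition k :: nat where "k = j mod l"

lemma l_pos: "0 < l" and g_less: "g < N" and k_less: "k < l" and j_eq: "g * l + k = j"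
proof -
  show l: "0 < l" using j by (cases l) auto
  show "g < N" unfolding g_def by (rule less_mult_imp_div_less) (use j in simp)
  show "k < l" "g * l + k = j" using l by (simp_all add: g_def k_def)
qed

lemma length_m: "length m = N * l" and time_le: "v 0 \<le> 4 * N"
  using rec by (auto simp: recoverable_def)

lemma answer_bit: "\<tau> ! j = bit (reg I \<tau> g) k"
  using bit_reg[OF length_\<tau> g_less k_less] by (simp add: j_eq)

definition answer :: nat where "answer = of_bool (\<tau> ! j)"

definition paused :: "(nat \<Rightarrow> nat) \<Rightarrow> bool" where
  "paused w \<longleftrightarrow> w 1 = j \<and> (\<forall>x < 40. w (x + 2) = v x)"

lemma paused_cells: "paused w \<Longrightarrow> w (Suc 0) = j \<and> w 2 = v 0 \<and> w 4 = v 2 \<and> w 5 = v 3 \<and> w 6 = v 4 \<and> w 7 = v 5 \<and> w 8 = v 6 \<and> w 9 = v 7"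
proof -
  assume p: "paused w"
  then have *: "\<forall>x < 40. w (x + 2) = v x" and "w 1 = j" by (simp_all add: paused_def)
  have "w 2 = v 0" using *[rule_format, of 0] by (simp add: numeral_2_eq_2)
  then show ?thesis using \<open>w 1 = j\<close> *[rule_format, of 2] *[rule_format, of 3] *[rule_format, of 4]
    *[rule_format, of 5] *[rule_format, of 6] *[rule_format, of 7] by simp
qed

lemma paused_frame: "paused w \<Longrightarrow> (\<And>x. 1 \<le> x \<Longrightarrow> x < 42 \<Longrightarrow> w' x = w x) \<Longrightarrow> paused w'"
  by (simp add: paused_def)

lemma paused_upd: "paused w \<Longrightarrow> x = 0 \<or> 42 \<le> x \<Longrightarrow> paused (w(x := a))"
  by (erule paused_frame) auto

definition located :: "(nat \<Rightarrow> nat) \<Rightarrow> bool" where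
  "located w \<longleftrightarrow> paused w \<and> consts_ok qbase w \<and> w 65 = g \<and> w 42 = k"

lemma located_cells:
  "located w \<Longrightarrow> w 60 = n \<and> w 61 = l \<and> w 62 = q \<and> w 63 = src I \<and> w 66 = 1 \<and> w 67 = 0 \<and> w 65 = g \<and> w 42 = k"
  by (simp add: located_def consts_ok_def)

lemma located_frame: "located w \<Longrightarrow> (\<And>x. 1 \<le> x \<Longrightarrow> x < 43 \<or> 60 \<le> x \<and> x < 68 \<Longrightarrow> w' x = w x) \<Longrightarrow> located w'"
  by (auto simp: located_def consts_ok_def intro: paused_frame)

lemma located_upd: "located w \<Longrightarrow> x = 0 \<or> 43 \<le> x \<and> x < 60 \<or> 68 \<le> x \<Longrightarrow> located (w(x := a))"
  by (erule located_frame) auto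

lemma query_init_sat:
  assumes J: "J w m" and p: "paused w" and c: "consts_ok qbase w"
  shows "sat I J (Block query_init) 15 (\<lambda>w' m'. m' = m \<and> located w' \<and>
     w' k_front = front I (v 0) \<and> w' (v_run qbase) = phase_run I (v 0)) w m"
proof -
  define z where "z = v 0"
  have [simp]: "w 60 = n" "w 61 = l" "w 62 = q" "w 63 = src I" "w 66 = 1" "w 67 = 0"
    using c by (simp_all add: consts_ok_def)
  have [simp]: "w (Suc 0) = j" "w 2 = z" using paused_cells[OF p] by (simp_all add: z_def)
  then have [simp]: "w (Suc (Suc 0)) = z" by (simp add: numeral_2_eq_2)
  have g: "j div l = g" "j mod l = k" by (simp_all add: g_def k_def)
  have mN: "z mod N < N" using N_pos by simp
  have zB: "z \<le> 4 * N" using time_le by (simp add: z_def)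
  have NB: "N \<le> B" "2 \<le> B" "Suc 0 \<le> B" "path_len I \<le> B" "Suc (path_len I) \<le> B" "g \<le> B" "k \<le> B" "N - z mod N \<le> B" "z mod N \<le> B"
    using big mN g_less k_less by - linarith+
  have wB: "z div N \<le> B" "z div N div 2 \<le> B"
    using zB big div_le_dividend[of z N] div_le_dividend[of "z div N" 2] by - linarith+
  have N: "n + path_len I * n = N" by (simp add: nregs_def)
  show ?thesis
  proof (cases "odd (z div N)")
    case True
    have m2: "z div N mod 2 = 1" using True by (simp add: odd_iff_mod_2_eq_one)
    show ?thesis
      using [[linarith_split_limit = 0]]
      by (rule sat_BlockI[OF J]) (simp_all add: query_init_def N g NB wB m2 phase_run_def front_def True located_def consts_ok_def paused_upd p z_def[symmetric])
  next
    case False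
    have m2: "z div N mod 2 = 0" using False by (simp add: even_iff_mod_2_eq_zero)
    show ?thesis
      using [[linarith_split_limit = 0]]
      by (rule sat_BlockI[OF J]) (simp_all add: query_init_def N g NB wB m2 phase_run_def front_def False located_def consts_ok_def paused_upd p z_def[symmetric])
  qed
qed

abbreviation "recov \<equiv> recovers \<tau> m g (v c_pos) (v c_pos') (v c_carry) (v c_digit)"

lemma query_select_sat:
  assumes J: "J w m" and s: "located w" and w: "w k_front = front I (v 0)" "w 78 = reg I m g mod q"
      "w 74 = increment I (phase_run I (v 0)) (reg I m) g"
  shows "sat I J query_select 14 (\<lambda>w' m'. m' = m \<and> located w' \<and> recov (w' k_diff) (w' k_pos)) w m"
    (is "sat I J _ _ ?Q w m")
proof -
  define r where "r = reg I m g mod q"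
  define a where "a = increment I (phase_run I (v 0)) (reg I m) g"
  have r: "r < q" and a: "a < q" using q_pos increment_less by (simp_all add: r_def a_def)
  have vB: "v 2 - Suc g \<le> B" "Suc g - v 2 \<le> B" "Suc g \<le> B" "v 3 \<le> B" "v 7 \<le> B" "v 2 - Suc g + (Suc g - v 2) \<le> B"
  proof -
    have "v 2 \<le> N" using rec by (auto simp: recoverable_def split: if_splits)
    then show "v 2 - Suc g \<le> B" "Suc g - v 2 \<le> B" "Suc g \<le> B" "v 2 - Suc g + (Suc g - v 2) \<le> B" using g_less big by - linarith+
  qed (simp_all add: v_le)
  have fin: "sat I J (If_Less (v_zero qbase) k_x
          (If_Less (v_reg qbase) k_front (Block query_shifted) (Block query_unshifted))
          (Block query_flux)) 10 ?Q w1 m"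
    if J1: "J w1 m" and s1: "located w1" and w1: "w1 k_front = front I (v 0)" "w1 78 = r" "w1 74 = a"
      "w1 k_x = v 2 - Suc g + (Suc g - v 2)" for w1
  proof -
    note lc = located_cells[OF s1]
    have pc: "w1 9 = v 7" "w1 5 = v 3" using s1 paused_cells by (simp_all add: located_def)
    have qB: "8 * q + 16 \<le> B" "l \<le> B" using big by - linarith+
    have y: "y mod q < q" for y using q_pos by simp
    have b: "q - a \<le> B" "q - a + r \<le> B" "y mod q \<le> B" "r + q \<le> B" "r + q - y' \<le> B" "q \<le> B" for y y'
      using qB r y[of y] by - linarith+
    have "sat I J (If_Less (v_zero qbase) k_x
          (If_Less (v_reg qbase) k_front (Block query_shifted) (Block query_unshifted))
          (Block query_flux)) ((6 + 2) + 2) ?Q w1 m"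
    proof (rule sat_If)
      show "J w1 m" by (rule J1)
    next
      assume "w1 (v_zero qbase) < w1 k_x"
      then have X: "v 2 \<noteq> Suc g" using lc w1(4) by auto
      show "sat I J (If_Less (v_reg qbase) k_front (Block query_shifted) (Block query_unshifted)) (6 + 2) ?Q w1 m"
      proof (rule sat_If)
        show "J w1 m" by (rule J1)
      next
        assume "w1 (v_reg qbase) < w1 k_front"
        then have f: "g < front I (v 0)" using lc w1(1) by simp
        have R: "recov (r + q - (q - a + r) mod q) l"
          by (rule recovers_shifted[OF rec X g_less f r_def a_def refl])
        show "sat I J (Block query_shifted) 6 ?Q w1 m"
          using [[linarith_split_limit = 0]]
          by (rule sat_BlockI[OF J1]) (simp_all add: query_shifted_def lc w1 b qB located_upd s1 R)
      next
        assume "\<not> w1 (v_reg qbase) < w1 k_front"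
        then have f: "\<not> g < front I (v 0)" using lc w1(1) by simp
        have R: "recov q l" by (rule recovers_unshifted[OF rec X g_less f])
        show "sat I J (Block query_unshifted) 6 ?Q w1 m"
          by (rule sat_BlockI[OF J1]) (simp_all add: query_unshifted_def lc b qB located_upd s1 R)
      qed
    next
      assume "\<not> w1 (v_zero qbase) < w1 k_x"
      then have X: "v 2 = Suc g" using lc w1(4) by auto
      then have "in_flux I m g (v 3) (v 4) (v 5) (v 6) (v 7) (reg I \<tau> g)" using rec by (simp add: recoverable_def)
      then have R: "recov (v 7) (v 3)" by (rule recovers_flux[OF length_m g_less])
      show "sat I J (Block query_flux) (6 + 2) ?Q w1 m"
        by (rule sat_BlockI[OF J1]) (simp_all add: query_flux_def lc pc v_le located_upd s1 R)
    qed
    then show ?thesis by simp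
  qed
  have pc: "w 4 = v 2" using s paused_cells by (simp add: located_def)
  show ?thesis unfolding query_select_def
  proof (rule sat_SeqI[where ta = 4 and tb = 10])
    show "sat I J (Block query_flux_test) 4 (\<lambda>w m. J w m \<longrightarrow> sat I J (If_Less (v_zero qbase) k_x
          (If_Less (v_reg qbase) k_front (Block query_shifted) (Block query_unshifted))
          (Block query_flux)) 10 ?Q w m) w m"
      supply [[linarith_split_limit = 0]]
      apply (rule sat_BlockI[OF J])
       apply (simp add: query_flux_test_def located_cells[OF s] pc vB)
       apply (intro impI)
       apply (rule fin[simplified])
            apply assumption
           apply (simp_all add: located_upd s w r_def a_def query_flux_test_def)
      done
  qed simp
qed

definition digits :: "nat \<Rightarrow> nat \<Rightarrow> int" where
  "digits P i = int (digit m g P (v c_pos) (v c_pos') (v c_carry) (v c_digit) i) - 2 * int q"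

text \<open>\<open>r\<close> counts the bits still to come. The bound \<open>3 * q\<close>
  reproduces itself: with a digit of at most \<open>3 * q + 1\<close>, the halved sum is again at
  most \<open>3 * q\<close>.\<close>

definition scan_state where
  "scan_state P d r w m' \<longleftrightarrow> m' = m \<and> located w \<and> w k_pos = P \<and> r \<le> Suc k \<and> w k_cur = Suc k - r \<and> w k_end = Suc k \<and>
     w k_two = 2 \<and> w k_acc \<le> 3 * q \<and>
     int (w k_acc) = partial_sum (digits P) (int d - int q) (Suc k - r) div 2 ^ (Suc k - r) + 2 * int q \<and>
     (r \<le> k \<longrightarrow> w k_answer = of_bool (bit (reg I \<tau> g) (k - r)))"

lemma query_body_sat:
  assumes J: "J w m'" and s: "scan_state P d (Suc r) w m'" and R: "recov d P"
  shows "sat I J (Seq (Block query_digit) (Seq query_special_digit (Block query_carry))) 18 (scan_state P d r) w m'"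
proof -
  define i where "i = k - r"
  have i: "i < l" "Suc k - Suc r = i" "Suc k - r = Suc i" "r \<le> k" using s k_less by (auto simp: scan_state_def i_def)
  have [simp]: "m' = m" and s1: "located w" using s by (auto simp: scan_state_def)
  note lc = located_cells[OF s1]
  define \<beta> :: nat where "\<beta> = of_bool (m ! (g * l + i))"
  define A where "A = partial_sum (digits P) (int d - int q) i div 2 ^ i"
  define acc where "acc = w k_acc"
  define D where "D = digit m g P (v c_pos) (v c_pos') (v c_carry) (v c_digit) i"
  have c: "w 46 = P" "w 48 = i" "w 49 = Suc k" "w 55 = 2" "w 47 = acc" "acc \<le> 3 * q" "int acc = A + 2 * int q"
    using s i by (auto simp: scan_state_def A_def acc_def)
  have pc: "w 5 = v 3" "w 6 = v 4" "w 7 = v 5" "w 8 = v 6" using s1 paused_cells by (simp_all add: located_def)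
  have a: "g * l + i < N * l" by (rule address_less[OF g_less i(1)])
  have \<beta>: "\<beta> \<le> 1" by (simp add: \<beta>_def)
  have bit: "of_bool (g * l + i < length m \<and> m ! (g * l + i)) = \<beta>" using a length_m by (simp add: \<beta>_def)
  have PB: "P \<le> B"
    using R k_less v_le[of 3] s J by (auto simp: scan_state_def J_def)
  have b: "g * l \<le> B" "g * l + i \<le> B" "\<beta> \<le> B" "\<beta> + q \<le> B" "\<beta> + q + q \<le> B" "i - P \<le> B" "P - i \<le> B" "i - P + (P - i) \<le> B"
    using a \<beta> big i(1) PB by - linarith+
  have DB: "D \<le> 3 * q + 1" and D: "D = (if i = P then if v 3 < v 4 then v 6 else \<beta> + v 5 + q else \<beta> + q + q)"
  proof -
    show D: "D = (if i = P then if v 3 < v 4 then v 6 else \<beta> + v 5 + q else \<beta> + q + q)"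
      by (simp add: D_def digit_def \<beta>_def)
    have "i = P \<Longrightarrow> v 5 \<le> 2 * q \<and> (v 3 < v 4 \<longrightarrow> v 6 \<le> 3 * q + 1)" using R i(1) by (auto simp: recovers_def)
    then show "D \<le> 3 * q + 1" unfolding D using \<beta> q_pos by auto
  qed
  have dg: "digits P i = int D - 2 * int q" by (simp add: digits_def D_def)
  have accD: "int (acc + D) = (A + digits P i) + 2 * (2 * int q)" using c(7) dg by simp
  have carry: "sat I J (Block query_carry) 4 (scan_state P d r) w2 m"
    if J2: "J w2 m" and s2: "located w2" and w2: "w2 47 = acc" "w2 53 = D" "w2 46 = P" "w2 48 = i" "w2 49 = Suc k" "w2 55 = 2" for w2
  proof -
    note lc2 = located_cells[OF s2]
    have b2: "acc + D \<le> B" "(acc + D) div 2 \<le> B" "(acc + D) mod 2 \<le> B" "Suc i \<le> B" "Suc 0 \<le> B"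
      using c(6) DB big i(1) by - linarith+
    have acc': "(acc + D) div 2 \<le> 3 * q" using c(6) DB by linarith
    have "int ((acc + D) div 2) = (A + digits P i + 2 * (2 * int q)) div 2" unfolding accD[symmetric] by simp
    then have A': "int ((acc + D) div 2) = partial_sum (digits P) (int d - int q) (Suc i) div 2 ^ Suc i + 2 * int q"
      unfolding partial_sum_div_Suc A_def by simp
    have "odd (acc + D) \<longleftrightarrow> odd (int (acc + D))" by simp
    \<comment> \<open>The joint offset \<open>4 * q\<close> is even and drops out of the
      parity.\<close>
    also have "\<dots> \<longleftrightarrow> odd (A + digits P i)" unfolding accD by simp
    also have "\<dots> \<longleftrightarrow> bit (reg I \<tau> g) i" unfolding A_def
      by (rule bit_partial_sum[OF _ i(1)]) (use R in \<open>simp add: partial_sum_def digits_def recovers_def\<close>)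
    finally have ans: "(acc + D) mod 2 = of_bool (bit (reg I \<tau> g) i)" by (simp add: mod_2_eq_odd)
    show ?thesis
      supply [[linarith_split_limit = 0]]
      apply (rule sat_BlockI[OF J2])
       apply (simp add: query_carry_def lc2 w2 b2 ans scan_state_def located_upd s2 i(3) acc' A'
          del: of_nat_add power_Suc)
       apply (use i(4) in \<open>simp add: i_def\<close>)
      apply (simp add: query_carry_def)
      done
  qed
  have special: "sat I J query_special_digit 6 (\<lambda>w2 m2. m2 = m \<and> located w2 \<and> w2 47 = acc \<and> w2 53 = D \<and> w2 46 = P \<and> w2 48 = i \<and> w2 49 = Suc k \<and> w2 55 = 2) w1 m"
    (is "sat I J _ _ ?Q w1 m")
    if J1: "J w1 m" and s2: "located w1" and w1: "w1 47 = acc" "w1 53 = \<beta> + q + q" "w1 54 = \<beta>" "w1 46 = P" "w1 48 = i" "w1 49 = Suc k" "w1 55 = 2"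
      "w1 50 = i - P + (P - i)" for w1
  proof -
    note lc1 = located_cells[OF s2]
    have pc1: "w1 5 = v 3" "w1 6 = v 4" "w1 7 = v 5" "w1 8 = v 6" using s2 paused_cells by (simp_all add: located_def)
    have "sat I J query_special_digit ((2 + 2) + 2) ?Q w1 m"
      unfolding query_special_digit_def
    proof (rule sat_If)
      show "J w1 m" by (rule J1)
    next
      assume "w1 (v_zero qbase) < w1 k_x"
      then have "i \<noteq> P" using lc1 w1(8) by auto
      then show "sat I J (Block []) (2 + 2) ?Q w1 m" using w1 s2 J1 by (intro sat_Nil) (simp_all add: D)
    next
      assume "\<not> w1 (v_zero qbase) < w1 k_x"
      then have iP: "i = P" using lc1 w1(8) by auto
      show "sat I J (If_Less (c_pos + 2) (c_pos' + 2)
        (Block [Arith Add k_digit (c_digit + 2) (v_zero qbase)])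
        (Block [Arith Add k_digit k_read (c_carry + 2), Arith Add k_digit k_digit (v_mod qbase)])) (2 + 2) ?Q w1 m"
      proof (rule sat_If)
        show "J w1 m" by (rule J1)
      next
        assume "w1 (c_pos + 2) < w1 (c_pos' + 2)"
        then have "v 3 < v 4" using pc1 by simp
        then have D': "D = v 6" using iP by (simp add: D)
        have "D \<le> B" using DB big by linarith
        then show "sat I J (Block [Arith Add k_digit (c_digit + 2) (v_zero qbase)]) 2 ?Q w1 m"
          by (intro sat_BlockI[OF J1]) (simp_all add: lc1 pc1 w1 D' located_upd s2 v_le)
      next
        assume "\<not> w1 (c_pos + 2) < w1 (c_pos' + 2)"
        then have "\<not> v 3 < v 4" using pc1 by simp
        then have D': "D = \<beta> + v 5 + q" using iP by (simp add: D)
        then have "\<beta> + v 5 + q \<le> B" "\<beta> + v 5 \<le> B" using DB big by - linarith+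
        then show "sat I J (Block [Arith Add k_digit k_read (c_carry + 2), Arith Add k_digit k_digit (v_mod qbase)]) 2 ?Q w1 m"
          by (intro sat_BlockI[OF J1]) (simp_all add: lc1 pc1 w1 D' located_upd s2)
      qed
    qed
    then show ?thesis by simp
  qed
  show ?thesis
  proof (rule sat_SeqI[where ta = 8 and tb = 10])
    have "sat I J (Seq query_special_digit (Block query_carry)) 10 (scan_state P d r) w1 m"
      if "J w1 m" "located w1" "w1 47 = acc" "w1 53 = \<beta> + q + q" "w1 54 = \<beta>" "w1 46 = P" "w1 48 = i" "w1 49 = Suc k" "w1 55 = 2"
      "w1 50 = i - P + (P - i)" for w1
      by (rule sat_SeqR[OF special[OF that], where tb = 4]) (use carry in auto)
    note fin = this
    show "sat I J (Block query_digit) 8 (\<lambda>w m. J w m \<longrightarrow>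
       sat I J (Seq query_special_digit (Block query_carry)) 10 (scan_state P d r) w m) w m'"
      supply [[linarith_split_limit = 0]]
      apply (rule sat_BlockI[OF J])
       apply (simp add: query_digit_def lc c b bit)
       apply (intro impI)
       apply (rule fin)
                apply assumption
               apply (simp_all add: located_upd s1 c query_digit_def)
      done
  qed simp
qed

lemma query_scan_sat:
  assumes J: "J w m" and s: "located w" and R: "recov (w k_diff) (w k_pos)"
  shows "sat I J query_scan (20 * l + 8) (\<lambda>w' m'. m' = m \<and> paused w' \<and> w' 0 = answer) w m"
    (is "sat I J _ _ ?Q w m")
proof -
  let ?W = "While_Less k_cur k_end (Seq (Block query_digit) (Seq query_special_digit (Block query_carry)))"
  define d where "d = w k_diff"
  define P where "P = w k_pos"
  have d: "w 45 = d" "w 46 = P" "d \<le> 2 * q" using R by (simp_all add: d_def P_def recovers_def)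
  have R': "recov d P" using R by (simp add: d_def P_def)
  note lc = located_cells[OF s]
  have loop: "sat I J ?W (20 * l + 2) ?Q w1 m"
    if J1: "J w1 m" and s1: "scan_state P d (Suc k) w1 m" for w1
  proof -
    have "sat I J ?W ((\<Sum>i<Suc k. 18 + 2) + 2) ?Q w1 m"
    proof (rule sat_While[where Inv = "scan_state P d" and tb = "\<lambda>_. 18"])
      fix r w2 m2 assume *: "J w2 m2" "scan_state P d (Suc r) w2 m2"
      have "w2 k_cur < w2 k_end" using *(2) by (auto simp: scan_state_def)
      with query_body_sat[OF * R']
      show "w2 k_cur < w2 k_end \<and> sat I J (Seq (Block query_digit) (Seq query_special_digit (Block query_carry))) 18 (scan_state P d r) w2 m2"
        by blast
    next
      fix w2 m2 assume "J w2 m2" "scan_state P d 0 w2 m2"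
      then show "\<not> w2 k_cur < w2 k_end \<and> ?Q w2 m2" by (simp add: scan_state_def answer_def answer_bit located_def)
    qed (use that in auto)
    then show ?thesis by (rule sat_conseq) (use k_less in auto)
  qed
  have b: "q + q \<le> B" "q + q + q \<le> B" "q + q + q - d \<le> B" "Suc k \<le> B" "2 \<le> B" using big k_less by - linarith+
  have b3: "q + q + q - d \<le> 3 * q" by simp
  have e: "int (q + q + q - d) = partial_sum (digits P) (int d - int q) 0 div 2 ^ 0 + 2 * int q"
    using d(3) by (simp add: partial_sum_def of_nat_diff)
  show ?thesis unfolding query_scan_def
  proof (rule sat_SeqI[where ta = 6 and tb = "20 * l + 2"])
    show "sat I J (Block query_scan_init) 6 (\<lambda>w m. J w m \<longrightarrow>
      sat I J ?W (20 * l + 2) ?Q w m) w m"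
      supply [[linarith_split_limit = 0]]
      apply (rule sat_BlockI[OF J])
       apply (simp add: query_scan_init_def lc d b)
       apply (intro impI)
       apply (rule sat_conseq[OF loop])
          apply assumption
         apply (insert e)
         apply (simp add: scan_state_def located_upd s d b3)
        apply simp
       apply simp
      apply (simp add: query_scan_init_def)
      done
  qed simp
qed

text \<open>An empty sum shifts by 0, and \<open>recoverable\<close> never announces such a
  register.\<close>

lemma m_bit_indeg_0: "indeg I g = 0 \<Longrightarrow> m ! j = \<tau> ! j"
proof -
  assume d: "indeg I g = 0"
  then have X: "v c_flux \<noteq> Suc g" using rec by (auto simp: recoverable_def)
  have "reg I m g = reg I \<tau> g"
    using recoverable_regs(1)[OF rec X g_less _ order.refl] recoverable_regs(2)[OF rec X g_less] shifted_indeg_0[OF d]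
    by (cases "g < front I (v c_time)") simp_all
  then show ?thesis using bit_reg[OF length_m g_less k_less] by (simp add: j_eq answer_bit)
qed

lemma wp_clear:
  assumes "\<And>x. x \<in> set xs \<Longrightarrow> x < 83" "Q (\<lambda>x. if x \<in> set xs then 0 else w x) m"
  shows "wp (map (\<lambda>x. Const x 0) xs) Q w m"
  using assms
proof (induction xs arbitrary: w)
  case (Cons a xs)
  have "(\<lambda>x. if x \<in> set xs then 0 else (w(a := 0)) x) = (\<lambda>x. if x \<in> set (a # xs) then 0 else w x)" by auto
  then show ?case using Cons by (simp add:)
qed simp

lemma query_clear_sat:
  assumes J: "J w m" and p: "paused w" and a: "w 0 = answer"
  shows "sat I J (Block query_clear) 41 (\<lambda>w' m'. m' = m \<and> (\<forall>x. w' (x + 2) = v x) \<and> w' 0 = answer) w m"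
proof (rule sat_BlockI[OF J])
  define xs :: "nat list" where "xs = [42..<83]"
  have xs: "x \<in> set xs \<longleftrightarrow> 42 \<le> x \<and> x < 83" for x unfolding xs_def set_upt by simp
  let ?w = "\<lambda>x. if x \<in> set xs then 0 else w x"
  have "?w (x + 2) = v x" for x
  proof (cases "x < 40")
    case True
    then show ?thesis using p by (simp add: paused_def xs)
  next
    case False
    then have "?w (x + 2) = 0" using J by (simp add: J_def xs)
    then show ?thesis using v_0[of x] False by simp
  qed
  moreover have "?w 0 = answer" using a by (simp add: xs)
  ultimately show "wp query_clear (\<lambda>w' m'. J w' m' \<longrightarrow> m' = m \<and> (\<forall>x. w' (x + 2) = v x) \<and> w' 0 = answer) w m"
    unfolding query_clear_def xs_def[symmetric] by (intro wp_clear) (simp_all add: xs)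
qed (simp add: query_clear_def)

definition query_time :: nat where
  "query_time = 70 + (if 0 < indeg I g then (indeg I g + 1) * (16 * l + 25) + 20 * l + 22 else 1)"

lemma query_sat:
  assumes J: "J w m" and p: "paused w"
  shows "sat I J query_com query_time (\<lambda>w' m'. m' = m \<and> (\<forall>x. w' (x + 2) = v x) \<and> w' 0 = answer) w m"
    (is "sat I J _ _ ?Q w m")
proof -
  let ?t = "if 0 < indeg I g then (indeg I g + 1) * (16 * l + 25) + 20 * l + 22 else 1"
  let ?C4 = "If_Less (v_zero qbase) (v_deg qbase) (Seq (gather qbase) (Seq query_select query_scan)) (Block [Cat_Read k_answer k_index])"
  let ?C3 = "Seq ?C4 (Block query_clear)"
  let ?C2 = "Seq (Block (prepare qbase)) ?C3"
  let ?C1 = "Seq (Block query_init) ?C2"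
  have c: "0 \<le> qbase" "qbase + 23 \<le> 83" by simp_all
  have B: "n \<le> B" "l \<le> B" "q \<le> B" "src I \<le> B" "Suc 0 \<le> B"
    using n_le_B src_less big by - linarith+
  have "sat I J query_com (6 + (15 + (6 + ((?t + 2) + 41)))) ?Q w m"
    unfolding query_com_def
  proof (rule sat_SeqR[where ta = 6 and P = "\<lambda>w' m'. m' = m \<and> paused w' \<and> consts_ok qbase w'", OF _ _ order.refl])
    show "sat I J (Block (load_params qbase)) 6 (\<lambda>w' m'. m' = m \<and> paused w' \<and> consts_ok qbase w') w m"
      by (rule sat_BlockI[OF J]) (simp_all add: load_params_def B consts_ok_def paused_upd p)
  next
    fix w1 m1 assume J1: "J w1 m1" and 1: "m1 = m \<and> paused w1 \<and> consts_ok qbase w1"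
    have 1: "m1 = m" "paused w1" "consts_ok qbase w1" using 1 by simp_all
    show "sat I J ?C1 (15 + (6 + ((?t + 2) + 41))) ?Q w1 m1"
    proof (rule sat_SeqR[OF query_init_sat[OF J1[unfolded 1(1)] 1(2,3), folded 1(1)] _ order.refl])
      fix w2 m2 assume J2: "J w2 m2" and 2: "m2 = m1 \<and> located w2 \<and> w2 k_front = front I (v 0) \<and> w2 (v_run qbase) = phase_run I (v 0)"
      have 2: "m2 = m" "located w2" "w2 k_front = front I (v 0)" "w2 (v_run qbase) = phase_run I (v 0)" using 1 2 by simp_all
      have cs2: "consts_ok qbase w2" "w2 (v_reg qbase) = g" using 2(2) by (simp_all add: located_def)
      show "sat I J ?C2 (6 + ((?t + 2) + 41)) ?Q w2 m2"
      proof (rule sat_SeqR[OF prepare_sat[OF c cs2 g_less J2] _ order.refl])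
        fix w3 m3 assume J3: "J w3 m3" and 3: "m3 = m2 \<and> (\<forall>x<qbase + 8. w3 x = w2 x) \<and>
          w3 (v_layer qbase) = g div n \<and> w3 (v_vert qbase) = g mod n \<and> w3 (v_deg qbase) = indeg I g"
        have 3: "m3 = m" "\<forall>x<68. w3 x = w2 x" "w3 (v_layer qbase) = g div n" "w3 (v_vert qbase) = g mod n" "w3 (v_deg qbase) = indeg I g"
          using 2(1) 3 by simp_all
        have s3: "located w3" by (rule located_frame[OF 2(2)]) (use 3(2) in auto)
        have cs3: "consts_ok qbase w3" "w3 (v_reg qbase) = g" "w3 (v_run qbase) = phase_run I (v 0)" "w3 k_front = front I (v 0)"
          using s3 2(3,4) 3(2) by (simp_all add: located_def)
        have J3': "J w3 m" using J3 3(1) by simp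
        let ?P = "\<lambda>w' m'. m' = m \<and> paused w' \<and> w' 0 = answer"
        have "sat I J ?C4 (?t + 2) ?P w3 m"
        proof (rule sat_If)
          show "J w3 m" by (rule J3')
        next
          assume "w3 (v_zero qbase) < w3 (v_deg qbase)"
          then have d: "0 < indeg I g" using 3(5) located_cells[OF s3] by simp
          have "sat I J (Seq (gather qbase) (Seq query_select query_scan)) ((indeg I g + 1) * (16 * l + 25) + (14 + (20 * l + 8))) ?P w3 m"
          proof (rule sat_SeqR[OF gather_sat[OF c cs3(1,2) g_less 3(3,4,5) cs3(3) phase_run_le[OF time_le] length_m J3'] _ order.refl])
            fix w4 m4 assume J4: "J w4 m4" and 4: "m4 = m \<and> (\<forall>x<qbase + 11. w4 x = w3 x) \<and>
              w4 (v_res qbase) = reg I m g mod q \<and> w4 (v_sum qbase) = increment I (phase_run I (v 0)) (reg I m) g"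
            have 4: "m4 = m" "\<forall>x<71. w4 x = w3 x" "w4 78 = reg I m g mod q" "w4 74 = increment I (phase_run I (v 0)) (reg I m) g"
              using 4 by simp_all
            have s4: "located w4" by (rule located_frame[OF s3]) (use 4(2) in auto)
            have f4: "w4 k_front = front I (v 0)" using 4(2) cs3(4) by simp
            have J4': "J w4 m" using J4 4(1) by simp
            show "sat I J (Seq query_select query_scan) (14 + (20 * l + 8)) ?P w4 m4"
              unfolding 4(1)
              by (rule sat_SeqR[OF query_select_sat[OF J4' s4 f4 4(3,4)] _ order.refl]) (use query_scan_sat in blast)
          qed
          then show "sat I J (Seq (gather qbase) (Seq query_select query_scan)) ?t ?P w3 m"
            by (rule sat_conseq) (use d in auto)
        next
          assume "\<not> w3 (v_zero qbase) < w3 (v_deg qbase)"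
          then have d: "indeg I g = 0" using 3(5) located_cells[OF s3] by simp
          have p3: "paused w3" using s3 by (simp add: located_def)
          have "of_bool (j < length m \<and> m ! j) = answer"
            using m_bit_indeg_0[OF d] length_m j by (simp add: answer_def)
          moreover have "answer \<le> B" using B(5) by (simp add: answer_def)
          ultimately show "sat I J (Block [Cat_Read k_answer k_index]) ?t ?P w3 m"
            using paused_cells[OF p3] by (intro sat_BlockI[OF J3']) (simp_all add: paused_upd p3 d)
        qed
        then show "sat I J ?C3 ((?t + 2) + 41) ?Q w3 m3"
          unfolding 3(1) by (rule sat_SeqR[OF _ _ order.refl]) (use query_clear_sat in blast)
      qed
    qed
  qed
  then show ?thesis unfolding query_time_def by (rule sat_conseq) auto
qed

end

section \<open>Counting paths\<close>

definition walks :: "problem \<Rightarrow> nat \<Rightarrow> nat \<Rightarrow> (nat \<times> nat) list set" where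
  "walks I i v = {p. pre_digraph.awalk (with_proj (digr I)) (src I) p v \<and> length p = i}"

context monitored
begin

lemma walks_0: "v < n \<Longrightarrow> walks I 0 v = (if v = src I then {[]} else {})"
proof -
  assume v: "v < n"
  interpret pair_fin_digraph "digr I" by (rule fin_digraph)
  have "awalk (src I) [] v \<longleftrightarrow> v = src I" unfolding awalk_Nil_iff using v vertices by blast
  moreover have "walks I 0 v = {p. p = [] \<and> awalk (src I) [] v}"
    unfolding walks_def by (rule Collect_cong) (metis length_0_conv)
  ultimately show ?thesis by simp
qed

text \<open>Paths are split at their last arc, matching the sum over in-neighbours in the
  update.\<close>

lemma walks_Suc:
  assumes v: "v < n"
  shows "walks I (Suc i) v = (\<Union>u \<in> set (in_nbrs I v). (\<lambda>p. p @ [(u, v)]) ` walks I i u)"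
proof -
  interpret pair_fin_digraph "digr I" by (rule fin_digraph)
  have snoc: "awalk (src I) (p @ [e]) v \<longleftrightarrow> awalk (src I) p (fst e) \<and> e \<in> parcs (digr I) \<and> snd e = v" for p e
    using arc_snd_in_verts by (auto simp: awalk_append_iff awalk_Cons_iff awalk_Nil_iff)
  show ?thesis
  proof (rule set_eqI)
    fix p
    show "p \<in> walks I (Suc i) v \<longleftrightarrow> p \<in> (\<Union>u \<in> set (in_nbrs I v). (\<lambda>p. p @ [(u, v)]) ` walks I i u)"
    proof (cases p rule: rev_cases)
      case (snoc p' e)
      then show ?thesis using \<open>\<And>p e. awalk (src I) (p @ [e]) v = _\<close>[of p' e] in_nbrs_set[OF v]
        by (cases e) (auto simp: walks_def image_iff)
    qed (auto simp: walks_def)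
  qed
qed

lemma walks_finite: "v < n \<Longrightarrow> finite (walks I i v)"
proof (induction i arbitrary: v)
  case (Suc i)
  have "\<forall>u \<in> set (in_nbrs I v). u < n" using in_nbrs_less[OF Suc.prems] by (auto simp: in_set_conv_nth)
  then show ?case unfolding walks_Suc[OF Suc.prems] using Suc.IH by auto
qed (simp add: walks_0)

lemma card_walks_Suc:
  assumes v: "v < n"
  shows "card (walks I (Suc i) v) = (\<Sum>e<length (in_nbrs I v). card (walks I i (in_nbrs I v ! e)))"
proof -
  have u: "u < n" if "u \<in> set (in_nbrs I v)" for u using that in_nbrs_less[OF v] by (auto simp: in_set_conv_nth)
  have "card (walks I (Suc i) v) = (\<Sum>u\<in>set (in_nbrs I v). card ((\<lambda>p. p @ [(u, v)]) ` walks I i u))"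
    unfolding walks_Suc[OF v] by (rule card_UN_disjoint) (use walks_finite u in auto)
  also have "\<dots> = (\<Sum>u\<in>set (in_nbrs I v). card (walks I i u))"
    by (intro sum.cong refl card_image) (auto simp: inj_on_def)
  also have "\<dots> = (\<Sum>e<length (in_nbrs I v). card (walks I i (in_nbrs I v ! e)))"
    using sum.reindex_bij_betw[OF bij_betw_nth[OF in_nbrs_distinct[OF v] refl refl], of "\<lambda>u. card (walks I i u)"] by simp
  finally show ?thesis .
qed

text \<open>The second summand is the virtual increment of the source register.\<close>

definition entry :: "bool list \<Rightarrow> nat \<Rightarrow> nat \<Rightarrow> nat \<Rightarrow> nat" where
  "entry \<tau> \<rho> i v = S \<tau> \<rho> (i * n + v) + of_bool (i = 0 \<and> v = src I) * \<rho>"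

text \<open>The \<open>seed\<close> terms of the sum are exactly the virtual part of
  \<open>entry\<close> in layer 0, so they need no separate treatment in the recursion.\<close>

lemma entry_Suc:
  assumes v: "v < n" and valid: "is_valid I (reg I \<tau> (Suc i * n + v))"
  shows "entry \<tau> \<rho> (Suc i) v mod q =
    (reg I \<tau> (Suc i * n + v) + (\<Sum>e<length (in_nbrs I v). entry \<tau> \<rho> i (in_nbrs I v ! e))) mod q"
proof -
  let ?g = "Suc i * n + v"
  have g: "?g div n = Suc i" "?g mod n = v" using v by (simp_all del: mult_Suc)
  have "insum I \<rho> (S \<tau> \<rho>) ?g = (\<Sum>e<length (in_nbrs I v). entry \<tau> \<rho> i (in_nbrs I v ! e))"
    unfolding insum_def indeg_def g seed_def pred_reg_def entry_def
    by (auto simp: conj_commute intro!: sum.cong)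
  then have "S \<tau> \<rho> ?g mod q = (reg I \<tau> ?g mod q + (\<Sum>e<length (in_nbrs I v). entry \<tau> \<rho> i (in_nbrs I v ! e)) mod q) mod q"
    using valid by (subst shifted_eq) (simp only: shift_mod, simp)
  then show ?thesis by (simp add: entry_def mod_add_eq)
qed

text \<open>Modulo \<open>q\<close> the update is affine. In the difference of the two runs the
  register contents cancel; what remains obeys the recursion of the path numbers and starts as the
  unit vector at the source.\<close>

lemma entry_diff:
  assumes valid: "\<And>g. g < N \<Longrightarrow> is_valid I (reg I \<tau> g)" and "i \<le> path_len I" "v < n"
  shows "entry \<tau> 1 i v mod q = (entry \<tau> 0 i v + card (walks I i v)) mod q"
  using assms(2,3)
proof (induction i arbitrary: v)
  case 0
  have "S \<tau> 1 v = S \<tau> 0 v" using 0 by (simp add: shifted_def)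
  then show ?case using 0 by (simp add: entry_def walks_0)
next
  case (Suc i)
  have "Suc i * n + v < N" unfolding nregs_def by (rule address_less) (use Suc.prems in auto)
  note val = valid[OF this]
  have v: "in_nbrs I v ! e < n" if "e < length (in_nbrs I v)" for e using in_nbrs_less[OF Suc.prems(2) that] .
  let ?r = "reg I \<tau> (Suc i * n + v)" and ?L = "{..<length (in_nbrs I v)}"
  have "(\<Sum>e\<in>?L. entry \<tau> 1 i (in_nbrs I v ! e)) mod q = (\<Sum>e\<in>?L. entry \<tau> 1 i (in_nbrs I v ! e) mod q) mod q"
    by (simp add: mod_sum_eq)
  also have "\<dots> = (\<Sum>e\<in>?L. (entry \<tau> 0 i (in_nbrs I v ! e) + card (walks I i (in_nbrs I v ! e))) mod q) mod q"
    using Suc v by simp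
  also have "\<dots> = ((\<Sum>e\<in>?L. entry \<tau> 0 i (in_nbrs I v ! e)) + card (walks I (Suc i) v)) mod q"
    by (simp add: mod_sum_eq sum.distrib card_walks_Suc[OF Suc.prems(2)])
  finally have sum: "(\<Sum>e\<in>?L. entry \<tau> 1 i (in_nbrs I v ! e)) mod q =
    ((\<Sum>e\<in>?L. entry \<tau> 0 i (in_nbrs I v ! e)) + card (walks I (Suc i) v)) mod q" .
  have "entry \<tau> 1 (Suc i) v mod q = (?r + ((\<Sum>e\<in>?L. entry \<tau> 0 i (in_nbrs I v ! e)) + card (walks I (Suc i) v))) mod q"
    unfolding entry_Suc[OF Suc.prems(2) val] using sum by (metis mod_add_right_eq)
  also have "\<dots> = ((?r + (\<Sum>e\<in>?L. entry \<tau> 0 i (in_nbrs I v ! e))) mod q + card (walks I (Suc i) v)) mod q"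
    by (simp only: mod_add_left_eq add.assoc)
  also have "\<dots> = (entry \<tau> 0 (Suc i) v + card (walks I (Suc i) v)) mod q"
    unfolding entry_Suc[OF Suc.prems(2) val, symmetric] by (rule mod_add_left_eq)
  finally show ?case .
qed

section \<open>Sizes\<close>

lemma num_arcs_eq: "num_arcs I = (\<Sum>v<n. length (in_nbrs I v))"
proof -
  interpret pair_fin_digraph "digr I" by (rule fin_digraph)
  have "v < n" if "(u, v) \<in> parcs (digr I)" for u v using in_arcsD2[OF that] vertices by simp
  then have "parcs (digr I) = prod.swap ` (SIGMA v:{..<n}. set (in_nbrs I v))"
    using in_nbrs_set by (force simp: image_iff)
  then have "num_arcs I = card (SIGMA v:{..<n}. set (in_nbrs I v))"
    unfolding num_arcs_def by (simp add: card_image inj_on_def)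
  also have "\<dots> = (\<Sum>v<n. length (in_nbrs I v))"
    using in_nbrs_distinct by (simp add: distinct_card)
  finally show ?thesis .
qed

lemma sum_groups:
  fixes f :: "nat \<Rightarrow> nat"
  shows "sum f {..<a * c} = (\<Sum>i<a. \<Sum>u<c. f (i * c + u))"
proof -
  have "sum f {..<a * c} = (\<Sum>i<a. sum f {i * c..<i * c + c})" by (rule sum.nat_group[symmetric])
  also have "\<dots> = (\<Sum>i<a. \<Sum>u<c. f (i * c + u))"
    using sum.shift_bounds_nat_ivl[of f 0 "_ * c" c] by (simp add: atLeast0LessThan add.commute)
  finally show ?thesis .
qed

text \<open>Layer 0 receives nothing, and every other layer counts each arc once.\<close>

lemma sum_indeg: "(\<Sum>g<N. indeg I g) = path_len I * num_arcs I"
proof -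
  have "(\<Sum>u<n. indeg I (i * n + u)) = (if i = 0 then 0 else num_arcs I)" for i
  proof (cases i)
    case (Suc i')
    have "indeg I (i * n + u) = length (in_nbrs I u)" if "u < n" for u
    proof -
      have "(i * n + u) mod n = u" using that by simp
      moreover have "\<not> i * n + u < n" by (simp add: Suc)
      ultimately show ?thesis by (simp only: indeg_def if_False)
    qed
    then show ?thesis using Suc by (simp add: num_arcs_eq)
  qed (simp add: indeg_def)
  then have "(\<Sum>g<N. indeg I g) = (\<Sum>i<Suc (path_len I). if i = 0 then 0 else num_arcs I)"
    unfolding nregs_def sum_groups by simp
  also have "\<dots> = path_len I * num_arcs I" by (subst sum.lessThan_Suc_shift) simp
  finally show ?thesis .
qed

text \<open>Each of the four phases visits every register once, the odd ones in reverse.\<close>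

lemma sum_current:
  fixes f :: "nat \<Rightarrow> nat"
  shows "(\<Sum>z<4 * N. f (current I z)) = 4 * (\<Sum>g<N. f g)"
proof -
  have "(\<Sum>w<N. f (current I (p * N + w))) = (\<Sum>g<N. f g)" for p
  proof -
    have c: "current I (p * N + w) = (if odd p then N - Suc w else w)" if "w < N" for w
      using that by (simp add: current_def)
    show ?thesis
    proof (cases "odd p")
      case True
      then have "(\<Sum>w<N. f (current I (p * N + w))) = (\<Sum>w<N. f (N - Suc w))" using c by simp
      then show ?thesis by (simp add: sum.nat_diff_reindex)
    qed (use c in simp)
  qed
  then show ?thesis unfolding sum_groups by simp
qed

lemma in_degree_eq: "v < n \<Longrightarrow> in_degree (with_proj (digr I)) v = length (in_nbrs I v)"
proof -
  assume v: "v < n"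
  have "in_arcs (with_proj (digr I)) v = (\<lambda>u. (u, v)) ` set (in_nbrs I v)"
    using in_nbrs_set[OF v] by (auto simp: in_arcs_def)
  then have "in_degree (with_proj (digr I)) v = card (set (in_nbrs I v))"
    unfolding in_degree_def by (simp add: card_image inj_on_def)
  then show ?thesis using distinct_card[OF in_nbrs_distinct[OF v]] by simp
qed

lemma indeg_le_max: "indeg I g \<le> max_in_degree I"
proof -
  have "length (in_nbrs I v) \<le> max_in_degree I" if "v < n" for v
    unfolding max_in_degree_def vertices by (rule Max_ge) (use that in_degree_eq in force)+
  then show ?thesis using n_pos by (simp add: indeg_def)
qed

end

section \<open>Running times in terms of arcs, vertices and degrees\<close>

context main_run
begin

lemma loop_time_eq: "loop_time = 4 * ((path_len I * num_arcs I + N) * (29 * l + 75)) + 8 * N + 2"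
proof -
  let ?f = "\<lambda>g. (indeg I g + 1) * (29 * l + 75) + 2"
  have "(\<Sum>k<4 * N. ?f (current I (4 * N - Suc k))) = (\<Sum>z<4 * N. ?f (current I z))"
    by (rule sum.nat_diff_reindex)
  also have "\<dots> = 4 * (\<Sum>g<N. ?f g)" by (rule sum_current)
  also have "(\<Sum>g<N. ?f g) = ((\<Sum>g<N. indeg I g) + N) * (29 * l + 75) + 2 * N"
    unfolding sum.distrib sum_distrib_right[symmetric] by simp
  finally show ?thesis unfolding loop_time_def sum_indeg by simp
qed

lemma main_time_le: "main_time \<le> 1000 * (l\<^sup>2 * path_len I * (num_arcs I + n) + 1)"
proof (cases "0 < path_len I * l")
  case True
  then have T: "1 \<le> path_len I" "1 \<le> l" by simp_all
  let ?A = "path_len I * (num_arcs I + n)"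
  \<comment> \<open>As the length is positive, the additional layer at most doubles the number of
    registers.\<close>
  have "n \<le> path_len I * n" using T(1) by simp
  moreover have "N = path_len I * n + n" by (simp add: nregs_def)
  moreover have "?A = path_len I * num_arcs I + path_len I * n" by (rule distrib_left)
  ultimately have N: "N \<le> 2 * ?A" "path_len I * num_arcs I + N \<le> 2 * ?A" by linarith+
  have "?A * l \<le> ?A * l * l" using T(2) by simp
  then have Z: "?A * l \<le> l\<^sup>2 * path_len I * (num_arcs I + n)" by (simp add: power2_eq_square ac_simps)
  have Y: "(path_len I * num_arcs I + N) * (29 * l + 75) \<le> (2 * ?A) * (104 * l)"
    by (rule mult_le_mono[OF N(2)]) (use T in simp)
  have A: "?A \<le> ?A * l" using T(2) by simp
  have t: "main_time = 22 + (4 * ((path_len I * num_arcs I + N) * (29 * l + 75)) + 8 * N + 2)"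
    using True by (simp only: main_time_def loop_time_eq if_True)
  have "t \<le> 1000 * (z + 1)" if "y \<le> 2 * a * (104 * l)" "a \<le> a * l" "a * l \<le> z" "N \<le> 2 * a"
      "t = 22 + (4 * y + 8 * N + 2)" for t y a z :: nat
  proof -
    have "2 * a * (104 * l) = 208 * (a * l)" by simp
    then have "t \<le> 1000 * z + 1000" using that by linarith
    then show ?thesis by simp
  qed
  from this[OF Y A Z N(1) t] show ?thesis .
qed (auto simp: main_time_def)

end

context query_run
begin

text \<open>A positive in-degree makes the product at least \<open>l\<close>, which pays for
  scanning the register itself; otherwise the time is constant.\<close>

lemma query_time_le: "query_time \<le> 200 * (l * max_in_degree I + 1)"
proof (cases "0 < indeg I g")
  case True
  let ?d = "max_in_degree I"
  have d: "indeg I g \<le> ?d" by (rule indeg_le_max)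
  with True have d1: "1 \<le> ?d" by linarith
  have "(indeg I g + 1) * (16 * l + 25) \<le> (2 * ?d) * (41 * l)"
    by (rule mult_le_mono) (use d d1 l_pos in linarith)+
  moreover have "l \<le> l * ?d" using d1 by simp
  ultimately show ?thesis using True by (simp add: query_time_def algebra_simps)
qed (simp add: query_time_def)

end

section \<open>The algorithm\<close>

definition path_counter :: algorithm where
  "path_counter = \<lparr>main_prog = compile 0 main_com @ [Halt c_out],
     query_prog = compile 0 query_com @ [Halt k_answer]\<rparr>"

text \<open>The constant \<open>com_size main_com\<close> covers the program counter that is handed
  to a query.\<close>

definition cell_bound :: "problem \<Rightarrow> nat" where
  "cell_bound I = 8 * (nregs I * reg_bits I) + 8 * nregs I + 8 * reg_bits I + 8 * path_len I +
     8 * modulus I + 17 + com_size main_com"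

text \<open>A halted configuration no longer changes, so the monitored condition holds at all times,
  also after the halt.\<close>

lemma sat_run:
  assumes "sat I J C t Q w m"
  obtains k w' m' where "k \<le> t"
    "run I (compile 0 C @ [Halt x]) k (conf 0 w m) = conf (com_size C) w' m'"
    "halted_with (compile 0 C @ [Halt x]) (conf (com_size C) w' m') (w' x)" "Q w' m'"
    "\<And>j. holds J (run I (compile 0 C @ [Halt x]) j (conf 0 w m))"
proof -
  let ?P = "compile 0 C @ [Halt x]" and ?c = "conf 0 w m"
  have P: "?P = [] @ compile 0 C @ [Halt x]" by simp
  from satE[OF assms P, of "com_size C"] obtain k w' m' where
    *: "k \<le> t" "run I ?P k ?c = conf (com_size C) w' m'" "Q w' m'"
    "\<And>j. j \<le> k \<Longrightarrow> holds J (run I ?P j ?c)" by auto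
  let ?h = "conf (com_size C) w' m'"
  have st: "step I ?P ?h = ?h" by (simp add: step_def nth_append)
  have "run I ?P i ?h = ?h" for i by (induction i) (simp_all add: run_Suc st)
  then have "run I ?P j ?c = ?h" if "k \<le> j" for j using run_add[of I ?P k "j - k" ?c] *(2) that by simp
  then have J: "holds J (run I ?P j ?c)" for j
    using *(4)[of j] *(4)[of k] *(2) by (cases "j \<le> k") auto
  show ?thesis by (rule that[OF *(1,2) _ *(3) J]) (simp add: halted_with_def nth_append)
qed

lemma work_space_le:
  assumes "\<forall>x. work c x \<le> B" "\<forall>x \<ge> K. work c x = 0" "K \<le> K'"
  shows "work_space c \<le> K' * floorlog 2 B"
proof -
  have s: "{x. work c x \<noteq> 0} \<subseteq> {..<K}" using assms(2) not_less by auto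
  have "work_space c \<le> (\<Sum>x | work c x \<noteq> 0. floorlog 2 B)"
    unfolding work_space_def using assms(1) by (intro sum_mono floorlog_mono) blast
  also have "\<dots> = card {x. work c x \<noteq> 0} * floorlog 2 B" by simp
  also have "\<dots> \<le> K' * floorlog 2 B"
    using card_mono[OF _ s] assms(3) by (intro mult_le_mono1) simp
  finally show ?thesis .
qed

text \<open>The cell bound is at most cubic in the numbers of the input,
  \<open>nregs I * reg_bits I\<close> being a product of three of them.\<close>

lemma cell_bound_log_space: "(\<lambda>I. a * floorlog 2 (cell_bound I)) \<in> log_space"
proof -
  \<comment> \<open>57 collects the five coefficients 8 and the summand 17 of
    \<open>cell_bound\<close>.\<close>
  define c :: nat where "c = 57 + com_size main_com"
  have "real (a * floorlog 2 (cell_bound I)) \<le> real a * (log 2 (real c) + 4) *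
      log 2 (real (num_verts I + path_len I + reg_bits I + modulus I + 2))" for I
  proof -
    define M where "M = num_verts I + path_len I + reg_bits I + modulus I + 2"
    have M1: "1 \<le> M ^ 3" "1 \<le> M" "2 \<le> M" by (simp_all add: M_def)
    have "path_len I + 1 \<le> M" "num_verts I \<le> M" "reg_bits I \<le> M" "modulus I \<le> M" "path_len I \<le> M" by (simp_all add: M_def)
    then have *: "nregs I \<le> M * M" "nregs I * reg_bits I \<le> M * M * M"
      unfolding nregs_def by (simp_all only: mult_le_mono)
    have MM: "M \<le> M ^ 3" "M * M \<le> M ^ 3" "M * M * M = M ^ 3" using M1(2)
      by (simp_all add: power3_eq_cube)
    have "com_size main_com \<le> com_size main_com * M ^ 3" using M1(1) by simp
    moreover have "8 * (nregs I * reg_bits I) + 8 * nregs I + 8 * reg_bits I + 8 * path_len I +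
       8 * modulus I + 17 \<le> 57 * M ^ 3"
      using * MM M1(1) \<open>reg_bits I \<le> M\<close> \<open>modulus I \<le> M\<close> \<open>path_len I \<le> M\<close> by linarith
    ultimately have "cell_bound I \<le> 57 * M ^ 3 + com_size main_com * M ^ 3"
      unfolding cell_bound_def by linarith
    then have b: "cell_bound I \<le> c * M ^ 3" by (simp add: c_def add_mult_distrib)
    have c1: "1 \<le> c" by (simp add: c_def)
    have lM: "1 \<le> log 2 (real M)" using M1(3) by (simp add: le_log_iff)
    have lc: "0 \<le> log 2 (real c)" using c1 by simp
    have pos: "0 < cell_bound I" by (simp add: cell_bound_def)
    have "real (floorlog 2 (cell_bound I)) \<le> log 2 (real (cell_bound I)) + 1"
      using pos by (simp add: floorlog_def)
    also have "log 2 (real (cell_bound I)) \<le> log 2 (real (c * M ^ 3))"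
    proof -
      have "0 < c * M ^ 3" using c1 M1 by simp
      then show ?thesis using pos b by (simp only: log_le_cancel_iff of_nat_le_iff of_nat_0_less_iff)
    qed
    also have "log 2 (real (c * M ^ 3)) = log 2 (real c) + 3 * log 2 (real M)"
      using c1 M1(2) by (simp add: log_mult log_nat_power)
    \<comment> \<open>\<open>M\<close> is at least 2, so its logarithm is at least 1 and absorbs the
      additive constants.\<close>
    also have "log 2 (real c) + 3 * log 2 (real M) + 1 \<le> (log 2 (real c) + 4) * log 2 (real M)"
      using mult_left_mono[OF lM lc] lM by (simp add: algebra_simps)
    finally have "real (floorlog 2 (cell_bound I)) \<le> (log 2 (real c) + 4) * log 2 (real M)" by simp
    then have "real a * real (floorlog 2 (cell_bound I)) \<le> real a * ((log 2 (real c) + 4) * log 2 (real M))"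
      by (intro mult_left_mono) auto
    then show ?thesis by (simp add: M_def mult.assoc)
  qed
  then show ?thesis unfolding log_space_def by blast
qed

lemma soft_OI: "(\<And>I. well_formed I \<Longrightarrow> f I \<le> a * (g I + 1)) \<Longrightarrow> f \<in> soft_O g"
proof -
  assume *: "\<And>I. well_formed I \<Longrightarrow> f I \<le> a * (g I + 1)"
  have "real (f I) \<le> real a * real (g I + 1) * log 2 (real (num_verts I + path_len I + reg_bits I + 2)) ^ 0"
    if "well_formed I" for I
  proof -
    have "real (f I) \<le> real (a * (g I + 1))" using *[OF that] by (simp only: of_nat_le_iff)
    then show ?thesis by (simp add: algebra_simps)
  qed
  then show ?thesis unfolding soft_O_def by blast
qed

lemma tape_size_eq: "tape_size I = nregs I * reg_bits I"
  by (simp add: tape_size_def nregs_def)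

lemma main_run_cell_bound: "well_formed I \<Longrightarrow> main_run I (cell_bound I)"
  by unfold_locales (auto simp: cell_bound_def)

lemma straight_main: "straight_com main_com"
  by (simp add: main_com_def main_body_def main_flux_def gather_def scan_def load_params_def main_init_def
    main_trivial_def main_locate_def main_difference_def main_output_test_def main_output_def
    main_digit_def main_write_def prepare_def gather_before_def gather_after_def scan_body_def)

context main_run
begin

lemma outcome_num_paths:
  assumes len: "length \<tau> = N * l" and valid: "all_registers_valid I \<tau>"
  shows "(if 0 < path_len I * l then outcome I \<tau> (4 * N) else of_bool (src I = dst I) mod q) = num_paths I mod q"
proof -
  have v: "is_valid I (reg I \<tau> g)" if "g < N" for g
  proof -
    have "g div n \<le> path_len I" using that less_mult_imp_div_less[of g "path_len I + 1" n] by (simp add: nregs_def)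
    moreover have "g mod n \<in> pverts (digr I)" using n_pos vertices by simp
    ultimately have "valid_for l q (register I \<tau> (g div n) (g mod n))"
      using valid by (simp add: all_registers_valid_def)
    then show ?thesis using valid_for_iff[OF reg_less] by (simp add: register_eq_reg)
  qed
  have np: "num_paths I = card (walks I (path_len I) (dst I))" by (simp add: num_paths_def walks_def)
  show ?thesis
  proof (cases "0 < path_len I * l")
    case True
    let ?r = "\<lambda>\<rho>. S \<tau> \<rho> (target I)"
    \<comment> \<open>For positive length the target lies above layer 0, where no virtual increment
      is added.\<close>
    have e: "entry \<tau> \<rho> (path_len I) (dst I) = ?r \<rho>" for \<rho> using True by (simp add: entry_def target_def)
    have "?r 1 mod q = (?r 0 + num_paths I) mod q"
      using entry_diff[OF v order.refl dst_less] unfolding e np .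
    then have "(?r 1 mod q + (q - ?r 0 mod q)) mod q = (?r 0 + num_paths I + (q - ?r 0 mod q)) mod q"
      by (metis mod_add_left_eq)
    also have "\<dots> = (?r 0 mod q + (num_paths I + (q - ?r 0 mod q))) mod q"
      by (simp add: mod_add_left_eq add.assoc)
    also have "?r 0 mod q + (num_paths I + (q - ?r 0 mod q)) = num_paths I + q"
      using mod_less_divisor[OF q_pos, of "?r 0"] by linarith
    finally have "(?r 1 mod q + (q - ?r 0 mod q)) mod q = num_paths I mod q" by simp
    moreover have "?r 1 mod q + q - ?r 0 mod q = ?r 1 mod q + (q - ?r 0 mod q)"
      using mod_less_divisor[OF q_pos, of "?r 0"] by linarith
    moreover have "\<not> 4 * N \<le> target I" "\<not> 4 * N \<le> 2 * N + target I" using target_less by linarith+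
    ultimately show ?thesis using True by (simp add: outcome_def Let_def)
  next
    case False
    then consider "path_len I = 0" | "l = 0" by auto
    then show ?thesis
    proof cases
      case 1
      then have "num_paths I = of_bool (src I = dst I)" unfolding np by (simp add: walks_0[OF dst_less])
      then show ?thesis using 1 by simp
    next
      case 2
      \<comment> \<open>Without bits the range has a single element, and its register is valid only
        if this forms a complete block, that is, for modulus 1.\<close>
      have "1 mod q = 0" using v[OF N_pos] 2 by (simp add: is_valid_def)
      then have "q = 1" by (simp add: mod_eq_0_iff_dvd)
      then show ?thesis using 2 by simp
    qed
  qed
qed

lemma main_prog_run:
  assumes "B = cell_bound I" "length \<tau> = tape_size I"
  obtains k c a where "k \<le> main_time" "run I (main_prog path_counter) k (init_config \<tau>) = c"
    "halted_with (main_prog path_counter) c a" "cat c = \<tau>"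
    "all_registers_valid I \<tau> \<Longrightarrow> a = num_paths I mod modulus I"
    "\<And>j. holds J (run I (main_prog path_counter) j (init_config \<tau>))"
proof -
  have len: "length \<tau> = N * l" using assms(2) by (simp add: tape_size_eq)
  from sat_run[OF main_sat[OF len], of c_out] obtain k w' m' where
    *: "k \<le> main_time" "run I (main_prog path_counter) k (init_config \<tau>) = conf (com_size main_com) w' m'"
    "halted_with (main_prog path_counter) (conf (com_size main_com) w' m') (w' c_out)"
    "w' 9 = (if 0 < path_len I * l then outcome I \<tau> (4 * N) else of_bool (src I = dst I) mod q) \<and> m' = \<tau>"
    "\<And>j. holds J (run I (main_prog path_counter) j (init_config \<tau>))"
    unfolding path_counter_def init_config_def algorithm.simps by blast
  show ?thesis
    by (rule that[OF *(1,2,3) _ _ *(5)]) (use *(4) outcome_num_paths[OF len] in auto)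
qed

end

text \<open>The invariant of the main run, at an arbitrary time \<open>k\<close>, is precisely what
  the query locale assumes of the paused configuration.\<close>

lemma path_counter_answers:
  assumes wf: "well_formed I" and len: "length \<tau> = tape_size I" and j: "j < tape_size I"
    and c_def: "c = run I (main_prog path_counter) k (init_config \<tau>)"
  shows "answers_query path_counter I \<tau> c j (200 * (reg_bits I * max_in_degree I + 1))"
    and "work_space (run I (query_prog path_counter) k' (query_config j c)) \<le> 83 * floorlog 2 (cell_bound I)"
proof -
  interpret M: main_run I \<tau> "cell_bound I" by (rule main_run_cell_bound[OF wf])
  have Jc: "M.J (work c) (cat c)" unfolding c_def by (rule M.main_prog_run[OF refl len])
  interpret Q: query_run I \<tau> "cell_bound I" "work c" "cat c" j
    by unfold_locales (use Jc[unfolded M.J_def] wf len j in \<open>auto simp: cell_bound_def tape_size_eq\<close>)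
  let ?w = "\<lambda>x. if x = 0 then pc c else if x = 1 then j else work c (x - 2)"
  have pc: "pc c \<le> com_size main_com + 1"
  proof -
    have "\<forall>i \<in> set (main_prog path_counter). jump_target i \<le> length (main_prog path_counter)"
      using jump_target_compile[OF straight_main, of _ 0] by (fastforce simp: path_counter_def)
    from pc_run_le[OF this, of "init_config \<tau>" I k] show ?thesis
      by (simp add: c_def init_config_def path_counter_def)
  qed
  have jB: "j \<le> cell_bound I" using j by (simp add: cell_bound_def tape_size_eq)
  have pcB: "pc c \<le> cell_bound I" using pc by (simp add: cell_bound_def)
  have J: "Q.J ?w (cat c)" unfolding Q.J_def using Q.v_le Q.v_0 pcB jB by simp
  have p: "Q.paused ?w" by (simp add: Q.paused_def)
  from sat_run[OF Q.query_sat[OF J p], of k_answer] obtain t w' m' where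
    *: "t \<le> Q.query_time" "run I (query_prog path_counter) t (query_config j c) = conf (com_size query_com) w' m'"
    "halted_with (query_prog path_counter) (conf (com_size query_com) w' m') (w' k_answer)"
    "m' = cat c \<and> (\<forall>x. w' (x + 2) = work c x) \<and> w' 0 = Q.answer"
    "\<And>i. holds Q.J (run I (query_prog path_counter) i (query_config j c))"
    unfolding path_counter_def query_config_def algorithm.simps by blast
  show "answers_query path_counter I \<tau> c j (200 * (reg_bits I * max_in_degree I + 1))"
    unfolding answers_query_def
    using *(1-4) Q.query_time_le by (intro exI[of _ t]) (auto simp: Let_def Q.answer_def)
  show "work_space (run I (query_prog path_counter) k' (query_config j c)) \<le> 83 * floorlog 2 (cell_bound I)"
    by (rule work_space_le[of _ _ 83]) (use *(5)[of k', unfolded Q.J_def] in auto)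
qed

lemma path_counter_main:
  assumes wf: "well_formed I" and len: "length \<tau> = tape_size I"
  obtains k a where "k \<le> 1000 * ((reg_bits I)\<^sup>2 * path_len I * (num_arcs I + num_verts I) + 1)"
    "halted_with (main_prog path_counter) (run I (main_prog path_counter) k (init_config \<tau>)) a"
    "cat (run I (main_prog path_counter) k (init_config \<tau>)) = \<tau>"
    "all_registers_valid I \<tau> \<Longrightarrow> a = num_paths I mod modulus I"
    "\<And>j. work_space (run I (main_prog path_counter) j (init_config \<tau>)) \<le> 83 * floorlog 2 (cell_bound I)"
proof -
  interpret M: main_run I \<tau> "cell_bound I" by (rule main_run_cell_bound[OF wf])
  from M.main_prog_run[OF refl len] obtain k c a where
    *: "k \<le> M.main_time" "run I (main_prog path_counter) k (init_config \<tau>) = c"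
    "halted_with (main_prog path_counter) c a" "cat c = \<tau>"
    "all_registers_valid I \<tau> \<Longrightarrow> a = num_paths I mod modulus I"
    "\<And>j. holds M.J (run I (main_prog path_counter) j (init_config \<tau>))"
    by blast
  have "work_space (run I (main_prog path_counter) j (init_config \<tau>)) \<le> 83 * floorlog 2 (cell_bound I)" for j
    by (rule work_space_le[of _ _ 40]) (use *(6)[of j, unfolded M.J_def] in auto)
  moreover have "k \<le> 1000 * ((reg_bits I)\<^sup>2 * path_len I * (num_arcs I + num_verts I) + 1)"
    using *(1) M.main_time_le by (rule order.trans)
  ultimately show ?thesis using that *(2-5) by blast
qed

theorem theorem3p1:
  shows "\<exists>A :: algorithm.
    catalytic_logspace A \<and>
    (\<forall>I \<tau>. well_formed I \<and> length \<tau> = tape_size I \<and> all_registers_valid I \<tau> \<longrightarrow>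
       returns A I \<tau> (num_paths I mod modulus I)) \<and>
    (\<exists>t \<in> soft_O (\<lambda>I. (reg_bits I)\<^sup>2 * path_len I * (num_arcs I + num_verts I)).
       runs_in_time A t) \<and>
    (\<exists>t \<in> soft_O (\<lambda>I. reg_bits I * max_in_degree I).
       locally_revertible_in_time A t)"
proof (intro exI[of _ path_counter] conjI)
  show "catalytic_logspace path_counter"
    unfolding catalytic_logspace_def
  proof (intro bexI[OF _ cell_bound_log_space[of 83]] allI impI conjI)
    fix I and \<tau> :: "bool list" assume "well_formed I \<and> length \<tau> = tape_size I"
    then obtain k a where "halted_with (main_prog path_counter) (run I (main_prog path_counter) k (init_config \<tau>)) a"
      "cat (run I (main_prog path_counter) k (init_config \<tau>)) = \<tau>"
      using path_counter_main by blast
    then show "\<exists>k a. halted_with (main_prog path_counter) (run I (main_prog path_counter) k (init_config \<tau>)) a \<and>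
            cat (run I (main_prog path_counter) k (init_config \<tau>)) = \<tau>" by blast
  next
    fix I and \<tau> :: "bool list" and k assume "well_formed I \<and> length \<tau> = tape_size I"
    then show "work_space (run I (main_prog path_counter) k (init_config \<tau>)) \<le> 83 * floorlog 2 (cell_bound I)"
      using path_counter_main by blast
  qed
  show "\<forall>I \<tau>. well_formed I \<and> length \<tau> = tape_size I \<and> all_registers_valid I \<tau> \<longrightarrow>
       returns path_counter I \<tau> (num_paths I mod modulus I)"
    unfolding returns_def using path_counter_main by metis
  show "\<exists>t \<in> soft_O (\<lambda>I. (reg_bits I)\<^sup>2 * path_len I * (num_arcs I + num_verts I)). runs_in_time path_counter t"
  proof (rule bexI)
    show "runs_in_time path_counter (\<lambda>I. 1000 * ((reg_bits I)\<^sup>2 * path_len I * (num_arcs I + num_verts I) + 1))"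
      unfolding runs_in_time_def using path_counter_main by metis
  qed (rule soft_OI, rule order.refl)
  show "\<exists>t \<in> soft_O (\<lambda>I. reg_bits I * max_in_degree I). locally_revertible_in_time path_counter t"
  proof (rule bexI)
    show "locally_revertible_in_time path_counter (\<lambda>I. 200 * (reg_bits I * max_in_degree I + 1))"
      unfolding locally_revertible_in_time_def Let_def
      by (intro bexI[OF _ cell_bound_log_space[of 83]] allI impI conjI) (use path_counter_answers in blast)+
  qed (rule soft_OI, rule order.refl)
qed

end
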